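(* Let $\mu$ be a self-similar measure of finite type (setting described in the context), with support $K$ and $s=\dim_H K$. Assume there are a constant $C>0$ and real numbers $\varepsilon_n$ with $\sup_n n\varepsilon_n<\infty$ such that for every $n$, the norm of any product of $n$ essential, primitive transition matrices (that is, $\|T(\gamma_1,\dots,\gamma_{n+1})\|$ for any admissible path $(\gamma_1,\dots,\gamma_{n+1})$ in the essential class) is bounded above by $C\varrho^{sn(1-\varepsilon_n)}$. Then $\mu$ is absolutely continuous with respect to $H^s$, the $s$-dimensional Hausdorff measure restricted to $K$ (normalized so that $H^s(K)=1$).
   Context: Setting. Let $m\ge 1$ be an integer, $0<\varrho<1$, $0=d_0<d_1<\dots<d_m$, $S_j(x)=\varrho x+d_j$ for $j\in\mathcal A=\{0,\dots,m\}$. Let $K$ be the unique non-empty compact set with $K=\bigcup_j S_j(K)$; the $d_j$ are scaled so that the convex hull of $K$ is $[0,1]$ ($K$ need not be an interval). For $\sigma=(j_1,\dots,j_n)\in\mathcal A^n$ put $S_\sigma=S_{j_1}\circ\cdots\circ S_{j_n}$. The IFS is of finite type if there is a finite set $F\subseteq\mathbb R$ such that for every $n\ge1$ and all $\sigma,\sigma'\in\mathcal A^n$, either $\varrho^{-n}|S_\sigma(0)-S_{\sigma'}(0)|>1$ or $\varrho^{-n}(S_\sigma(0)-S_{\sigma'}(0))\in F$. Given $p_j>0$ with $\sum_j p_j=1$, $\mu$ is the unique Borel probability measure with $\mu=\sum_j p_j\,\mu\circ S_j^{-1}$; its support is $K$; $\mu$ is called of finite type if the IFS is. It is known that for finite type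 IFS $0<\mathcal H^s(K)<\infty$ with $s=\dim_HK$. Net intervals. Let $h_1<\dots<h_{s_n}$ be the elements of $\{S_\sigma(0),S_\sigma(1):\sigma\in\mathcal A^n\}$; $\mathcal F_n$ (net intervals of level $n$) is the set of $[h_j,h_{j+1}]$ with $(h_j,h_{j+1})\cap K\ne\emptyset$; $\mathcal F_0=\{[0,1]\}$. Each $\Delta\in\mathcal F_n$, $n\ge1$, is contained in a unique $\widehat\Delta\in\mathcal F_{n-1}$, its parent ($\Delta$ is a child of $\widehat\Delta$). For $\Delta=[a,b]\in\mathcal F_n$: normalized length $\ell_n(\Delta)=\varrho^{-n}(b-a)$; neighbour set $V_n(\Delta)$ = the increasingly ordered tuple of the distinct elements of $\{\varrho^{-n}(a-S_\sigma(0)):\sigma\in\mathcal A^n,\ \Delta\subseteq S_\sigma[0,1]\}$; $r_n(\Delta)$ = position of $\Delta$, from left to right, among the level $n$ net intervals with the same parent and the same normalized length. The characteristic vector is $\mathcal C_n(\Delta)=(\ell_n(\Delta),V_n(\Delta),r_n(\Delta))$. Under finite type the set $\Omega$ of characteristic vectors is finite, and the characteristic vectors of the children of $\Delta$ depend only on that of $\Delta$, so one may speak of children of characteristic vectors. An admissible path is a finite sequence of characteristic vectors, each being the parent of the next. A loop class is a non-empty $\Omega'\subseteq\Omega$ such that any $\alpha,\beta\in\Omega'$ are joined by an admissible path from $\alpha$ to $\beta$ inside $\Omega'$; it is an essential class if in addition all children of elements of $\Omega'$ are in $\Omega'$. There is exactly one essential class $\Omega_0$ (known). A path is in the essential class if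 all its letters are in $\Omega_0$. Transition matrices. For a level $n$ net interval $\Delta=[a,b]$ with parent $\widehat\Delta=[c,d]$, $V_n(\Delta)=(a_1,\dots,a_N)$, $V_{n-1}(\widehat\Delta)=(c_1,\dots,c_M)$, the primitive transition matrix $T(\mathcal C_{n-1}(\widehat\Delta),\mathcal C_n(\Delta))$ is the $M\times N$ matrix whose $jk$ entry is $p_\ell$ if there are $\ell\in\mathcal A$ and $\sigma\in\mathcal A^{n-1}$ with $S_\sigma(0)=c-\varrho^{n-1}c_j$ and $S_{\sigma\ell}(0)=a-\varrho^n a_k$, and $0$ otherwise (it depends only on the two characteristic vectors). It is essential if both characteristic vectors are in $\Omega_0$. For an admissible path, $T(\gamma_1,\dots,\gamma_n)=T(\gamma_1,\gamma_2)\cdots T(\gamma_{n-1},\gamma_n)$. The norm of a matrix is $\|T\|=\sum_{j,k}|T_{jk}|$. *)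

theory Defs
  imports "HOL-Probability.Probability" "Jordan_Normal_Form.Matrix"
begin

section \<open>Hausdorff measure and dimension\<close>

text \<open>The case distinction fixes the conventions for exponent \<open>0\<close> (where \<open>0 powr 0 = 0\<close> would be
  wrong): the empty set contributes \<open>0\<close> and every non-empty set contributes \<open>1\<close>.\<close>

definition hausdorff_gauge :: "real \<Rightarrow> 'a::metric_space set \<Rightarrow> ennreal" where
  "hausdorff_gauge s U =
     (if U = {} then 0 else if s = 0 then 1 else ennreal (diameter U powr s))"

text \<open>\<open>diameter\<close> is meaningful only for bounded sets, hence the explicit boundedness condition.\<close>

definition hausdorff_delta :: "real \<Rightarrow> real \<Rightarrow> 'a::metric_space set \<Rightarrow> ennreal" where
  "hausdorff_delta s \<delta> A =
     (INF U \<in> {U :: nat \<Rightarrow> 'a set. A \<subseteq> (\<Union>i. U i) \<and> (\<forall>i. bounded (U i) \<and> diameter (U i) \<le> \<delta>)}.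
        \<Sum>i. hausdorff_gauge s (U i))"

definition hausdorff_outer :: "real \<Rightarrow> 'a::metric_space set \<Rightarrow> ennreal" where
  "hausdorff_outer s A = (SUP \<delta>\<in>{0<..}. hausdorff_delta s \<delta> A)"

text \<open>\<open>hausdorff_outer s\<close> is a metric outer measure for \<open>s \<ge> 0\<close>, hence countably additive on the
  Borel sets, so that \<open>measure_of\<close> does not collapse to the zero measure.\<close>

definition hausdorff_measure :: "real \<Rightarrow> 'a::metric_space measure" where
  "hausdorff_measure s = measure_of UNIV (sets borel) (hausdorff_outer s)"

definition hausdorff_dim :: "'a::metric_space set \<Rightarrow> real" where
  "hausdorff_dim A = Inf {t. 0 \<le> t \<and> hausdorff_outer t A = 0}"

text \<open>The restriction to \<open>K\<close> is kept as a measure on all Borel sets of the ambient space.\<close>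

definition normalized_hausdorff :: "real \<Rightarrow> 'a::metric_space set \<Rightarrow> 'a measure" where
  "normalized_hausdorff s K =
     scale_measure (inverse (emeasure (hausdorff_measure s) K))
       (density (hausdorff_measure s) (indicator K))"

section \<open>Iterated function systems and self-similar measures\<close>

definition ifs_map :: "real \<Rightarrow> (nat \<Rightarrow> real) \<Rightarrow> nat \<Rightarrow> real \<Rightarrow> real" where
  "ifs_map \<rho> d j x = \<rho> * x + d j"

definition words :: "nat \<Rightarrow> nat \<Rightarrow> nat list set" where
  "words m n = {\<sigma>. length \<sigma> = n \<and> set \<sigma> \<subseteq> {..m}}"

definition ifs_word :: "real \<Rightarrow> (nat \<Rightarrow> real) \<Rightarrow> nat list \<Rightarrow> real \<Rightarrow> real" where
  "ifs_word \<rho> d \<sigma> = foldr (\<lambda>j f. ifs_map \<rho> d j \<circ> f) \<sigma> id"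

definition is_attractor :: "nat \<Rightarrow> real \<Rightarrow> (nat \<Rightarrow> real) \<Rightarrow> real set \<Rightarrow> bool" where
  "is_attractor m \<rho> d K \<longleftrightarrow>
     compact K \<and> K \<noteq> {} \<and> K = (\<Union>j\<le>m. ifs_map \<rho> d j ` K)"

definition finite_type :: "nat \<Rightarrow> real \<Rightarrow> (nat \<Rightarrow> real) \<Rightarrow> bool" where
  "finite_type m \<rho> d \<longleftrightarrow>
     (\<exists>F :: real set. finite F \<and>
       (\<forall>n\<ge>1. \<forall>\<sigma>\<in>words m n. \<forall>\<sigma>'\<in>words m n.
          \<bar>ifs_word \<rho> d \<sigma> 0 - ifs_word \<rho> d \<sigma>' 0\<bar> / \<rho> ^ n > 1 \<or>
          (ifs_word \<rho> d \<sigma> 0 - ifs_word \<rho> d \<sigma>' 0) / \<rho> ^ n \<in> F))"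

definition is_self_similar_measure ::
    "nat \<Rightarrow> real \<Rightarrow> (nat \<Rightarrow> real) \<Rightarrow> (nat \<Rightarrow> real) \<Rightarrow> real measure \<Rightarrow> bool" where
  "is_self_similar_measure m \<rho> d p \<mu> \<longleftrightarrow>
     prob_space \<mu> \<and> sets \<mu> = sets borel \<and>
     (\<forall>A\<in>sets borel. measure \<mu> A = (\<Sum>j\<le>m. p j * measure (distr \<mu> borel (ifs_map \<rho> d j)) A))"

section \<open>Net intervals and characteristic vectors\<close>

text \<open>A net interval \<open>[a, b]\<close> is represented by the pair \<open>(a, b)\<close> of its endpoints.\<close>

definition level_endpoints :: "nat \<Rightarrow> real \<Rightarrow> (nat \<Rightarrow> real) \<Rightarrow> nat \<Rightarrow> real set" where
  "level_endpoints m \<rho> d n = (\<Union>\<sigma>\<in>words m n. {ifs_word \<rho> d \<sigma> 0, ifs_word \<rho> d \<sigma> 1})"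

definition net_intervals ::
    "nat \<Rightarrow> real \<Rightarrow> (nat \<Rightarrow> real) \<Rightarrow> real set \<Rightarrow> nat \<Rightarrow> (real \<times> real) set" where
  "net_intervals m \<rho> d K n =
     (if n = 0 then {(0, 1)}
      else {(a, b). a \<in> level_endpoints m \<rho> d n \<and> b \<in> level_endpoints m \<rho> d n \<and> a < b \<and>
              {a<..<b} \<inter> level_endpoints m \<rho> d n = {} \<and> {a<..<b} \<inter> K \<noteq> {}})"

definition sub_interval :: "real \<times> real \<Rightarrow> real \<times> real \<Rightarrow> bool" where
  "sub_interval \<Delta> P \<longleftrightarrow> {fst \<Delta>..snd \<Delta>} \<subseteq> {fst P..snd P}"

text \<open>For \<open>n = 0\<close>, where no parent exists, \<open>n - 1 = 0\<close> makes \<open>(0, 1)\<close> its own parent. This is used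
  only to give \<open>(0, 1)\<close> the position \<open>1\<close> at level \<open>0\<close>.\<close>

definition parent ::
    "nat \<Rightarrow> real \<Rightarrow> (nat \<Rightarrow> real) \<Rightarrow> real set \<Rightarrow> nat \<Rightarrow> real \<times> real \<Rightarrow> real \<times> real" where
  "parent m \<rho> d K n \<Delta> = (THE P. P \<in> net_intervals m \<rho> d K (n - 1) \<and> sub_interval \<Delta> P)"

definition norm_length :: "real \<Rightarrow> nat \<Rightarrow> real \<times> real \<Rightarrow> real" where
  "norm_length \<rho> n \<Delta> = (snd \<Delta> - fst \<Delta>) / \<rho> ^ n"

definition neighbour_set ::
    "nat \<Rightarrow> real \<Rightarrow> (nat \<Rightarrow> real) \<Rightarrow> nat \<Rightarrow> real \<times> real \<Rightarrow> real list" where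
  "neighbour_set m \<rho> d n \<Delta> =
     sorted_list_of_set {(fst \<Delta> - ifs_word \<rho> d \<sigma> 0) / \<rho> ^ n | \<sigma>.
        \<sigma> \<in> words m n \<and> {fst \<Delta>..snd \<Delta>} \<subseteq> ifs_word \<rho> d \<sigma> ` {0..1}}"

definition net_position ::
    "nat \<Rightarrow> real \<Rightarrow> (nat \<Rightarrow> real) \<Rightarrow> real set \<Rightarrow> nat \<Rightarrow> real \<times> real \<Rightarrow> nat" where
  "net_position m \<rho> d K n \<Delta> =
     card {\<Delta>' \<in> net_intervals m \<rho> d K n.
        parent m \<rho> d K n \<Delta>' = parent m \<rho> d K n \<Delta> \<and>
        norm_length \<rho> n \<Delta>' = norm_length \<rho> n \<Delta> \<and> fst \<Delta>' \<le> fst \<Delta>}"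

type_synonym char_vec = "real \<times> real list \<times> nat"

definition cv_neighbours :: "char_vec \<Rightarrow> real list" where
  "cv_neighbours \<gamma> = fst (snd \<gamma>)"

definition char_vector ::
    "nat \<Rightarrow> real \<Rightarrow> (nat \<Rightarrow> real) \<Rightarrow> real set \<Rightarrow> nat \<Rightarrow> real \<times> real \<Rightarrow> char_vec" where
  "char_vector m \<rho> d K n \<Delta> =
     (norm_length \<rho> n \<Delta>, neighbour_set m \<rho> d n \<Delta>, net_position m \<rho> d K n \<Delta>)"

definition char_vectors :: "nat \<Rightarrow> real \<Rightarrow> (nat \<Rightarrow> real) \<Rightarrow> real set \<Rightarrow> char_vec set" where
  "char_vectors m \<rho> d K = (\<Union>n. char_vector m \<rho> d K n ` net_intervals m \<rho> d K n)"

text \<open>A net interval \<open>P\<close> of level \<open>n\<close> together with a child \<open>\<Delta>\<close> (of level \<open>n + 1\<close>) whose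
  characteristic vectors are \<open>\<alpha>\<close> and \<open>\<beta>\<close>.\<close>

definition realizes ::
    "nat \<Rightarrow> real \<Rightarrow> (nat \<Rightarrow> real) \<Rightarrow> real set \<Rightarrow> char_vec \<Rightarrow> char_vec
      \<Rightarrow> nat \<Rightarrow> real \<times> real \<Rightarrow> real \<times> real \<Rightarrow> bool" where
  "realizes m \<rho> d K \<alpha> \<beta> n P \<Delta> \<longleftrightarrow>
     \<Delta> \<in> net_intervals m \<rho> d K (Suc n) \<and> P \<in> net_intervals m \<rho> d K n \<and> sub_interval \<Delta> P \<and>
     char_vector m \<rho> d K n P = \<alpha> \<and> char_vector m \<rho> d K (Suc n) \<Delta> = \<beta>"

definition is_child ::
    "nat \<Rightarrow> real \<Rightarrow> (nat \<Rightarrow> real) \<Rightarrow> real set \<Rightarrow> char_vec \<Rightarrow> char_vec \<Rightarrow> bool" where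
  "is_child m \<rho> d K \<alpha> \<beta> \<longleftrightarrow> (\<exists>n P \<Delta>. realizes m \<rho> d K \<alpha> \<beta> n P \<Delta>)"

definition admissible_path ::
    "nat \<Rightarrow> real \<Rightarrow> (nat \<Rightarrow> real) \<Rightarrow> real set \<Rightarrow> char_vec list \<Rightarrow> bool" where
  "admissible_path m \<rho> d K \<gamma> \<longleftrightarrow>
     \<gamma> \<noteq> [] \<and> set \<gamma> \<subseteq> char_vectors m \<rho> d K \<and> successively (is_child m \<rho> d K) \<gamma>"

definition loop_class ::
    "nat \<Rightarrow> real \<Rightarrow> (nat \<Rightarrow> real) \<Rightarrow> real set \<Rightarrow> char_vec set \<Rightarrow> bool" where
  "loop_class m \<rho> d K \<Omega>' \<longleftrightarrow>
     \<Omega>' \<noteq> {} \<and> \<Omega>' \<subseteq> char_vectors m \<rho> d K \<and>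
     (\<forall>\<alpha>\<in>\<Omega>'. \<forall>\<beta>\<in>\<Omega>'. \<exists>\<gamma>. admissible_path m \<rho> d K \<gamma> \<and> set \<gamma> \<subseteq> \<Omega>' \<and>
        hd \<gamma> = \<alpha> \<and> last \<gamma> = \<beta>)"

definition is_essential_class ::
    "nat \<Rightarrow> real \<Rightarrow> (nat \<Rightarrow> real) \<Rightarrow> real set \<Rightarrow> char_vec set \<Rightarrow> bool" where
  "is_essential_class m \<rho> d K \<Omega>' \<longleftrightarrow>
     loop_class m \<rho> d K \<Omega>' \<and> (\<forall>\<alpha>\<in>\<Omega>'. \<forall>\<beta>. is_child m \<rho> d K \<alpha> \<beta> \<longrightarrow> \<beta> \<in> \<Omega>')"

text \<open>Under finite type the essential class exists and is unique.\<close>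

definition essential_class :: "nat \<Rightarrow> real \<Rightarrow> (nat \<Rightarrow> real) \<Rightarrow> real set \<Rightarrow> char_vec set" where
  "essential_class m \<rho> d K = (THE \<Omega>'. is_essential_class m \<rho> d K \<Omega>')"

section \<open>Transition matrices\<close>

text \<open>Here \<open>P\<close> has level \<open>n\<close> and its child \<open>\<Delta>\<close> has level \<open>n + 1\<close>; \<open>x\<close> and \<open>y\<close> are elements of the
  respective neighbour sets.\<close>

definition trans_letter ::
    "nat \<Rightarrow> real \<Rightarrow> (nat \<Rightarrow> real) \<Rightarrow> nat \<Rightarrow> real \<times> real \<Rightarrow> real \<times> real \<Rightarrow> real \<Rightarrow> real \<Rightarrow> nat \<Rightarrow> bool"
  where
  "trans_letter m \<rho> d n P \<Delta> x y l \<longleftrightarrow>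
     l \<le> m \<and> (\<exists>\<sigma>\<in>words m n. ifs_word \<rho> d \<sigma> 0 = fst P - \<rho> ^ n * x \<and>
                 ifs_word \<rho> d (\<sigma> @ [l]) 0 = fst \<Delta> - \<rho> ^ Suc n * y)"

text \<open>The letter is unique if it exists, because the \<open>d j\<close> are distinct and
  \<open>ifs_word \<rho> d (\<sigma> @ [l]) 0 = ifs_word \<rho> d \<sigma> 0 + \<rho> ^ n * d l\<close>.\<close>

definition net_transition ::
    "nat \<Rightarrow> real \<Rightarrow> (nat \<Rightarrow> real) \<Rightarrow> (nat \<Rightarrow> real) \<Rightarrow> nat \<Rightarrow> real \<times> real \<Rightarrow> real \<times> real \<Rightarrow> real mat"
  where
  "net_transition m \<rho> d p n P \<Delta> =
     (let c = neighbour_set m \<rho> d n P; a = neighbour_set m \<rho> d (Suc n) \<Delta> in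
      mat (length c) (length a)
        (\<lambda>(j, k). if \<exists>l. trans_letter m \<rho> d n P \<Delta> (c ! j) (a ! k) l
                  then p (THE l. trans_letter m \<rho> d n P \<Delta> (c ! j) (a ! k) l) else 0))"

text \<open>The matrix depends only on the two characteristic vectors, so that any choice of net intervals
  realizing them gives the same result.\<close>

definition transition_matrix ::
    "nat \<Rightarrow> real \<Rightarrow> (nat \<Rightarrow> real) \<Rightarrow> real set \<Rightarrow> (nat \<Rightarrow> real) \<Rightarrow> char_vec \<Rightarrow> char_vec \<Rightarrow> real mat"
  where
  "transition_matrix m \<rho> d K p \<alpha> \<beta> =
     (case (SOME (n, P, \<Delta>). realizes m \<rho> d K \<alpha> \<beta> n P \<Delta>) of
        (n, P, \<Delta>) \<Rightarrow> net_transition m \<rho> d p n P \<Delta>)"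

fun path_matrix ::
    "nat \<Rightarrow> real \<Rightarrow> (nat \<Rightarrow> real) \<Rightarrow> real set \<Rightarrow> (nat \<Rightarrow> real) \<Rightarrow> char_vec list \<Rightarrow> real mat" where
  "path_matrix m \<rho> d K p [] = 1\<^sub>m 0"
| "path_matrix m \<rho> d K p [\<alpha>] = 1\<^sub>m (length (cv_neighbours \<alpha>))"
| "path_matrix m \<rho> d K p (\<alpha> # \<beta> # \<gamma>) =
     transition_matrix m \<rho> d K p \<alpha> \<beta> * path_matrix m \<rho> d K p (\<beta> # \<gamma>)"

definition mat_norm :: "real mat \<Rightarrow> real" where
  "mat_norm T = (\<Sum>j<dim_row T. \<Sum>k<dim_col T. \<bar>T $$ (j, k)\<bar>)"

end

(*
  Write q n v for the total probability of the words of length n whose cell has left endpoint v, so that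
  the masses along a chain of net intervals are transported by the transition matrices. Inside an
  essential net interval the hypothesis gives q n v <= C' rho^(s n). Some fixed word has its cell inside
  such an interval, and prefixing it only multiplies q by a positive constant, so the same bound holds for
  all words. Since by finite type a set of diameter rho^n meets boundedly many cells of level n, mu is at
  most a constant times the s-dimensional Hausdorff measure.

  That this measure is positive and finite on K is a count: the number N n of distinct left endpoints of
  level n is submultiplicative, and supermultiplicative up to a constant by finite type, so N n is
  comparable to rho^(-s n); a finite cover of K is weighed by counting the points of a fine level.

  The essential class is well defined because a net interval with the largest possible number of neighbours
  is reproduced, with the same characteristic data, by every similarity of the system.
*)
theory Submission
  imports Defs
begin

text \<open>The exponent \<open>s\<close> is given only as an infimum, while masses must be compared
  with covers at a concrete exponent, so \<open>s\<close> is identified with the growth rate of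
  \<open>ln (N n)\<close> divided by \<open>- ln \<rho>\<close>. The lower bound for the Hausdorff
  measure of \<open>K\<close> makes this identification possible; the upper bound keeps the
  normalizing factor away from 0. Boundedness of n eps_n turns the correction in the exponent of the
  hypothesis into a constant factor.

  The essential class and the transition matrices are given by description and choice operators, so
  each must first be shown to be well defined. Both proofs rescale a net interval to its own
  coordinate: there its length and its neighbour set determine everything about its children, and
  the position is what separates siblings of equal length. A similar copy of a net interval may
  however have another position among its own siblings; the characteristic vector reachable from
  everywhere is therefore taken from a child of the maximal net interval, not from that interval
  itself.\<close>

section \<open>Hausdorff measure\<close>

text \<open>Caratheodory's criterion. Additivity is immediate for \<open>B n\<close>, the part of
  \<open>A\<close> at distance at least 1/(n+1) from \<open>E\<close>. The rest of
  \<open>A - E\<close> is cut into layers \<open>R k\<close>; layers two apart are at positive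
  distance, so the values of all layers have a finite sum and the remainder tends to 0.\<close>

lemma closed_in_lambda_system:
  fixes f :: "'a::metric_space set \<Rightarrow> ennreal"
  assumes oms: "outer_measure_space UNIV f"
    and metric: "\<And>A B e. 0 < e \<Longrightarrow> (\<And>x y. x \<in> A \<Longrightarrow> y \<in> B \<Longrightarrow> e \<le> dist x y) \<Longrightarrow> f A + f B \<le> f (A \<union> B)"
    and E: "closed E"
  shows "E \<in> lambda_system UNIV UNIV f"
proof -
  have f0: "f {} = 0" using oms by (auto simp: outer_measure_space_def positive_def)
  have mono: "A \<subseteq> B \<Longrightarrow> f A \<le> f B" for A B
    using oms by (auto simp: outer_measure_space_def increasing_def)
  have csub: "f (\<Union>i. A i) \<le> (\<Sum>i. f (A i))" for A :: "nat \<Rightarrow> 'a set"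
  proof -
    have "f (\<Union>i. disjointed A i) \<le> (\<Sum>i. f (disjointed A i))"
      using oms disjoint_family_disjointed[of A]
      by (simp add: outer_measure_space_def countably_subadditive_def)
    also have "\<dots> \<le> (\<Sum>i. f (A i))"
      by (intro suminf_le mono disjointed_subset) auto
    finally show ?thesis by (simp add: UN_disjointed_eq)
  qed
  have sub: "f (A \<union> B) \<le> f A + f B" for A B
  proof -
    have "f (\<Union>i. binaryset A B i) \<le> (\<Sum>i. f (binaryset A B i))" by (rule csub)
    then show ?thesis by (simp add: UN_binaryset_eq suminf_binaryset_eq[where f=f, OF f0])
  qed
  have "f (E \<inter> A) + f (A - E) \<le> f A" if ne: "E \<noteq> {}" for A
  proof (cases "f A = Orderings.top")
    case False
    define B where "B n = {x \<in> A. 1 / real (n + 1) \<le> infdist x E}" for n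
    define R where "R k = {x \<in> A. 1 / real (k + 2) \<le> infdist x E \<and> infdist x E < 1 / real (k + 1)}" for k
    have B: "f (E \<inter> A) + f (B n) \<le> f A" for n
    proof -
      have "f (E \<inter> A) + f (B n) \<le> f (E \<inter> A \<union> B n)"
      proof (rule metric[of "1 / real (n + 1)"])
        fix x y assume "x \<in> E \<inter> A" "y \<in> B n"
        then show "1 / real (n + 1) \<le> dist x y"
          using infdist_le[of x E y] by (auto simp: B_def dist_commute)
      qed simp
      also have "\<dots> \<le> f A" by (rule mono) (auto simp: B_def)
      finally show ?thesis .
    qed
    have sep: "f (R j) + f X \<le> f (R j \<union> X)" if "X \<subseteq> (\<Union>i\<in>{i. i + 2 \<le> j}. R i)" for X j
    proof -
      have "f (R j) + f X \<le> f (R j \<union> X)"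
      \<comment> \<open>Points of \<open>R j\<close> are closer to \<open>E\<close> than 1/(j+1),
        those of \<open>X\<close> at least 1/j away; the gap is 1/(j(j+1)). The smaller constant
        used here is positive even for j = 0, where \<open>X\<close> is empty.\<close>
      proof (rule metric[of "1 / real (j + 2) * (1 / real (j + 1))"])
        fix x y assume x: "x \<in> R j" and "y \<in> X"
        then obtain i where i: "i + 2 \<le> j" and y: "y \<in> R i" using \<open>X \<subseteq> _\<close> by auto
        have "infdist y E \<le> infdist x E + dist y x" by (rule infdist_triangle)
        moreover have "infdist x E < 1 / real (j + 1)" using x by (auto simp: R_def)
        moreover have "1 / real (i + 2) \<le> infdist y E" using y by (auto simp: R_def)
        moreover have "1 / real j \<le> 1 / real (i + 2)" using i by (intro divide_left_mono) auto
        moreover have "1 / real j - 1 / real (j + 1) = 1 / (real j * (real j + 1))"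
          using i by (simp add: field_simps)
        moreover have "1 / real (j + 2) * (1 / real (j + 1)) \<le> 1 / (real j * (real j + 1))"
          using i by (auto simp: intro!: divide_left_mono mult_mono)
        ultimately show "1 / real (j + 2) * (1 / real (j + 1)) \<le> dist x y"
          by (simp add: dist_commute)
      qed simp
      then show ?thesis .
    qed
    \<comment> \<open>Layers whose indices have the same parity are pairwise two apart, so their
      values add up; even and odd layers together then give at most
      \<open>f A + f A\<close>.\<close>
    have par: "(\<Sum>i<n. f (R (2 * i + b))) \<le> f (\<Union>i<n. R (2 * i + b))" for b n
    proof (induction n)
      case (Suc n)
      have "(\<Sum>i<Suc n. f (R (2 * i + b))) \<le> f (R (2 * n + b)) + f (\<Union>i<n. R (2 * i + b))"
        using add_left_mono[OF Suc, of "f (R (2 * n + b))"] by (simp add: add.commute)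
      also have "\<dots> \<le> f (R (2 * n + b) \<union> (\<Union>i<n. R (2 * i + b)))"
      proof (rule sep, rule UN_least)
        fix i assume "i \<in> {..<n}"
        then have "2 * i + b \<in> {i. i + 2 \<le> 2 * n + b}" by auto
        then show "R (2 * i + b) \<subseteq> (\<Union>i\<in>{i. i + 2 \<le> 2 * n + b}. R i)" by blast
      qed
      also have "R (2 * n + b) \<union> (\<Union>i<n. R (2 * i + b)) = (\<Union>i<Suc n. R (2 * i + b))"
        by (simp add: lessThan_Suc)
      finally show ?case .
    qed (simp add: f0)
    have RA: "(\<Union>i<n. R (2 * i + b)) \<subseteq> A" for n b by (auto simp: R_def)
    have "(\<Sum>k<n. f (R k)) \<le> f A + f A" for n
    proof -
      have "(\<Sum>k<n. f (R k)) \<le> (\<Sum>k<2*n. f (R k))" by (intro sum_mono2) auto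
      also have "(\<Sum>k<2*n. f (R k)) = (\<Sum>i<n. f (R (2 * i))) + (\<Sum>i<n. f (R (2 * i + 1)))"
        by (induction n) (simp_all add: algebra_simps)
      also have "\<dots> \<le> f A + f A"
        using order_trans[OF par[of 0 n] mono[OF RA]] order_trans[OF par[of 1 n] mono[OF RA]]
        by (intro add_mono) simp_all
      finally show ?thesis .
    qed
    then have "(\<Sum>k. f (R k)) \<le> f A + f A"
      unfolding suminf_eq_SUP by (intro SUP_least)
    moreover have "f A + f A < Orderings.top" using False by (simp add: less_top)
    ultimately have fin: "(\<Sum>k. f (R k)) < Orderings.top" by (rule le_less_trans)
    then have Rk: "f (R k) = ennreal (enn2real (f (R k)))" for k
      using ennreal_suminf_lessD[OF fin, of k] by simp
    have smb: "summable (\<lambda>k. enn2real (f (R k)))"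
      using fin Rk by (intro summable_suminf_not_top) (simp_all add: less_top)
    show ?thesis
    proof (rule ennreal_le_epsilon)
      fix e :: real assume "0 < e"
      then obtain n where n: "norm (\<Sum>i. enn2real (f (R (i + n)))) < e"
        using suminf_exist_split[OF _ smb] by blast
      have "(\<Sum>i. f (R (i + n))) = ennreal (\<Sum>i. enn2real (f (R (i + n))))"
        by (subst Rk, subst suminf_ennreal2) (simp_all add: summable_ignore_initial_segment[OF smb])
      also have "\<dots> \<le> ennreal e" using n by (intro ennreal_leI) auto
      finally have tail: "(\<Sum>i. f (R (i + n))) \<le> ennreal e" .
      have "A - E \<subseteq> B n \<union> (\<Union>i. R (i + n))"
      proof
        fix x assume x: "x \<in> A - E"
        then have "0 < infdist x E"
          using E ne by (metis DiffD2 in_closed_iff_infdist_zero infdist_nonneg less_eq_real_def)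
        \<comment> \<open>With this \<open>j\<close>, 1/j \<le> infdist < 1/(j-1), which places
          \<open>x\<close> in layer \<open>j - 2\<close>; the index is later written with
          \<open>+ n\<close> to fit the shifted union.\<close>
        define j where "j = nat (\<lceil>1 / infdist x E\<rceil>)"
        have j1: "1 / infdist x E \<le> real j" unfolding j_def by linarith
        have j2: "real j < 1 / infdist x E + 1"
          unfolding j_def using \<open>0 < infdist x E\<close> by (smt (verit) ceiling_correct of_int_of_nat_eq of_nat_nat zero_le_ceiling divide_pos_pos)
        have j0: "0 < j" using j1 \<open>0 < infdist x E\<close>
          by (smt (verit) divide_pos_pos of_nat_0 gr0I)
        show "x \<in> B n \<union> (\<Union>i. R (i + n))"
        proof (cases "1 / real (n + 1) \<le> infdist x E")
          case True then show ?thesis using x by (auto simp: B_def)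
        next
          case False
          have "real n + 1 < 1 / infdist x E"
            using False \<open>0 < infdist x E\<close> by (simp add: field_simps)
          then have nj: "n + 2 \<le> j" using j1 by linarith
          have lo: "1 / real j \<le> infdist x E"
            using j1 j0 \<open>0 < infdist x E\<close> by (simp add: field_simps)
          have hi: "infdist x E < 1 / (real j - 1)"
            using j2 nj \<open>0 < infdist x E\<close> by (simp add: field_simps)
          have "x \<in> R (j - 2 - n + n)"
            using x lo hi nj by (auto simp: R_def of_nat_diff algebra_simps)
          then show ?thesis by blast
        qed
      qed
      then have "f (A - E) \<le> f (B n) + (\<Sum>i. f (R (i + n)))"
        using mono sub csub by (meson add_left_mono order_trans)
      then have "f (A - E) \<le> f (B n) + ennreal e" using tail by (meson add_left_mono order_trans)
      then have "f (E \<inter> A) + f (A - E) \<le> f (E \<inter> A) + f (B n) + ennreal e"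
        by (metis add.assoc add_left_mono)
      also have "\<dots> \<le> f A + ennreal e" using B by (rule add_right_mono)
      finally show "f (E \<inter> A) + f (A - E) \<le> f A + ennreal e" .
    qed
  qed simp
  moreover have "f A \<le> f (E \<inter> A) + f (A - E)" for A
    using sub[of "E \<inter> A" "A - E"] by (simp add: Int_commute Un_Diff_Int Un_commute)
  ultimately show ?thesis
    by (cases "E = {}") (auto simp: lambda_system_def f0 Int_commute Diff_eq intro!: antisym)
qed

text \<open>The sets measurable in the sense of Caratheodory form a sigma-algebra on which
  \<open>f\<close> is a measure. It contains the closed sets, hence all Borel sets, so
  \<open>measure_of\<close> really returns \<open>f\<close>.\<close>

lemma emeasure_measure_of_metric_outer_measure:
  fixes f :: "'a::metric_space set \<Rightarrow> ennreal"
  assumes oms: "outer_measure_space UNIV f"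
    and metric: "\<And>A B e. 0 < e \<Longrightarrow> (\<And>x y. x \<in> A \<Longrightarrow> y \<in> B \<Longrightarrow> e \<le> dist x y) \<Longrightarrow> f A + f B \<le> f (A \<union> B)"
    and A: "A \<in> sets borel"
  shows "emeasure (measure_of UNIV (sets borel) f) A = f A"
proof -
  interpret sigma_algebra UNIV "UNIV :: 'a set set" by (metis Pow_UNIV sigma_algebra_Pow)
  have ms: "measure_space UNIV (lambda_system UNIV UNIV f) f"
    using caratheodory_lemma[OF oms] by simp
  then have sa: "sigma_algebra UNIV (lambda_system UNIV UNIV f)" by (simp add: measure_space_def)
  have "sets borel = sigma_sets UNIV {S :: 'a set. closed S}"
    by (simp add: borel_eq_closed)
  also have "\<dots> \<subseteq> lambda_system UNIV UNIV f"
    using closed_in_lambda_system[OF oms metric]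
    by (intro sigma_algebra.sigma_sets_subset[OF sa]) auto
  finally have "measure_space UNIV (sets borel) f"
    using ms by (intro measure_down[OF ms]) (auto intro: sets.sigma_algebra_axioms[of borel, simplified])
  then show ?thesis
    using A by (intro emeasure_measure_of_sigma) (auto simp: measure_space_def)
qed

section \<open>Subadditivity and metric additivity of the Hausdorff outer measure\<close>

lemma hausdorff_delta_le:
  assumes "A \<subseteq> (\<Union>i. U i)" "\<And>i. bounded (U i)" "\<And>i. diameter (U i) \<le> \<delta>"
  shows "hausdorff_delta s \<delta> A \<le> (\<Sum>i. hausdorff_gauge s (U i))"
  unfolding hausdorff_delta_def using assms by (intro INF_lower) auto

lemma hausdorff_delta_less:
  assumes "hausdorff_delta s \<delta> A < c"
  obtains U where "A \<subseteq> (\<Union>i. U i)" "\<And>i. bounded (U i)" "\<And>i. diameter (U i) \<le> \<delta>"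
    "(\<Sum>i. hausdorff_gauge s (U i)) < c"
  using assms unfolding hausdorff_delta_def INF_less_iff by auto

lemma hausdorff_delta_mono: "A \<subseteq> B \<Longrightarrow> hausdorff_delta s \<delta> A \<le> hausdorff_delta s \<delta> B"
  unfolding hausdorff_delta_def by (intro INF_superset_mono) auto

lemma hausdorff_delta_antimono: "\<delta> \<le> \<delta>' \<Longrightarrow> hausdorff_delta s \<delta>' A \<le> hausdorff_delta s \<delta> A"
  unfolding hausdorff_delta_def by (intro INF_superset_mono) (auto intro: order_trans)

lemma hausdorff_delta_le_outer: "0 < \<delta> \<Longrightarrow> hausdorff_delta s \<delta> A \<le> hausdorff_outer s A"
  unfolding hausdorff_outer_def by (intro SUP_upper) auto

lemma hausdorff_delta_empty: "0 \<le> \<delta> \<Longrightarrow> hausdorff_delta s \<delta> {} = 0"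
  using hausdorff_delta_le[of "{}" "\<lambda>_. {}" \<delta> s] by (simp add: hausdorff_gauge_def)

lemma hausdorff_delta_countable_union_le:
  "hausdorff_delta s \<delta> (\<Union>i. A i) \<le> (\<Sum>i::nat. hausdorff_delta s \<delta> (A i))"
proof (rule ennreal_le_epsilon)
  fix e :: real assume e: "0 < e" and fin: "(\<Sum>i. hausdorff_delta s \<delta> (A i)) < Orderings.top"
  let ?O = "hausdorff_delta s \<delta>" and ?f = "hausdorff_gauge s"
  have *: "?O (A n) < ?O (A n) + ennreal (e * (1/2) ^ Suc n)" for n
    using ennreal_suminf_lessD[OF fin, of n] e by simp
  have "\<exists>B. A n \<subseteq> (\<Union>i. B i) \<and> (\<forall>i. bounded (B i) \<and> diameter (B i) \<le> \<delta>) \<and>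
      (\<Sum>i. ?f (B i)) < ?O (A n) + ennreal (e * (1/2) ^ Suc n)" for n
    by (rule hausdorff_delta_less[OF *[of n]]) blast
  then obtain B where B: "\<And>n. A n \<subseteq> (\<Union>i. B n i)" "\<And>n i. bounded (B n i)" "\<And>n i. diameter (B n i) \<le> \<delta>"
    "\<And>n. (\<Sum>i. ?f (B n i)) < ?O (A n) + ennreal (e * (1/2) ^ Suc n)" by metis
  define U where "U = case_prod B \<circ> prod_decode"
  have "(\<Union>i. A i) \<subseteq> (\<Union>i. U i)"
    using B(1) by (auto simp: U_def subset_eq) (metis prod.case prod_encode_inverse)
  then have "?O (\<Union>i. A i) \<le> (\<Sum>i. ?f (U i))"
    using B(2,3) by (intro hausdorff_delta_le) (auto simp: U_def split_beta)
  also have "\<dots> = (\<Sum>n. \<Sum>i. ?f (B n i))"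
    unfolding U_def comp_def by (intro suminf_ennreal_2dimen[where f="\<lambda>p. ?f (case_prod B p)"]) auto
  also have "\<dots> \<le> (\<Sum>n. ?O (A n) + ennreal (e * (1/2) ^ Suc n))"
    using B(4) by (intro suminf_le) (auto intro: less_imp_le)
  also have "\<dots> = (\<Sum>n. ?O (A n)) + (\<Sum>n. ennreal e * ennreal ((1/2) ^ Suc n))"
    using e by (subst suminf_add[symmetric])
      (auto simp del: ennreal_suminf_cmult simp add: ennreal_mult[symmetric])
  also have "\<dots> = (\<Sum>n. ?O (A n)) + e"
    unfolding ennreal_suminf_cmult
    by (subst suminf_ennreal_eq[OF zero_le_power power_half_series]) auto
  finally show "?O (\<Union>i. A i) \<le> (\<Sum>n. ?O (A n)) + e" .
qed

lemma hausdorff_outer_empty: "hausdorff_outer s {} = 0"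
  unfolding hausdorff_outer_def by (auto simp: hausdorff_delta_empty intro!: antisym SUP_least)

lemma outer_measure_space_hausdorff_outer: "outer_measure_space UNIV (hausdorff_outer s)"
proof -
  have "hausdorff_outer s (\<Union>i. A i) \<le> (\<Sum>i. hausdorff_outer s (A i))" for A :: "nat \<Rightarrow> 'a set"
    unfolding hausdorff_outer_def[of s "\<Union>i. A i"]
  proof (rule SUP_least)
    fix \<delta> :: real assume "\<delta> \<in> {0<..}"
    then have "(\<Sum>i. hausdorff_delta s \<delta> (A i)) \<le> (\<Sum>i. hausdorff_outer s (A i))"
      by (intro suminf_le hausdorff_delta_le_outer) auto
    then show "hausdorff_delta s \<delta> (\<Union>i. A i) \<le> (\<Sum>i. hausdorff_outer s (A i))"
      using hausdorff_delta_countable_union_le order_trans by blast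
  qed
  moreover have "increasing UNIV (hausdorff_outer s)"
    unfolding increasing_def hausdorff_outer_def by (auto intro!: SUP_mono hausdorff_delta_mono)
  ultimately show ?thesis
    by (simp add: outer_measure_space_def positive_def countably_subadditive_def hausdorff_outer_empty)
qed

text \<open>A covering set of diameter less than \<open>e\<close> cannot meet both \<open>A\<close> and \<open>B\<close>.\<close>

lemma hausdorff_delta_separated:
  assumes "0 \<le> \<delta>" "\<delta> < e" and sep: "\<And>x y. x \<in> A \<Longrightarrow> y \<in> B \<Longrightarrow> e \<le> dist x y"
  shows "hausdorff_delta s \<delta> A + hausdorff_delta s \<delta> B \<le> hausdorff_delta s \<delta> (A \<union> B)"
  unfolding hausdorff_delta_def[of s \<delta> "A \<union> B"]
proof (rule INF_greatest, clarsimp)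
  fix U :: "nat \<Rightarrow> 'a set"
  assume U: "A \<subseteq> (\<Union>i. U i)" "B \<subseteq> (\<Union>i. U i)" "\<forall>i. bounded (U i) \<and> diameter (U i) \<le> \<delta>"
  define V where "V i = (if U i \<inter> A \<noteq> {} then U i else {})" for i
  define W where "W i = (if U i \<inter> B \<noteq> {} then U i else {})" for i
  have dj: "U i \<inter> A = {} \<or> U i \<inter> B = {}" for i
  proof (rule ccontr)
    assume "\<not> ?thesis"
    then obtain x y where xy: "x \<in> U i" "x \<in> A" "y \<in> U i" "y \<in> B" by auto
    then have "dist x y \<le> diameter (U i)" using U(3) by (intro diameter_bounded_bound) auto
    also have "\<dots> \<le> \<delta>" using U(3) by auto
    finally show False using sep[of x y] xy assms(2) by auto
  qed
  have "hausdorff_delta s \<delta> A \<le> (\<Sum>i. hausdorff_gauge s (V i))"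
    using U assms(1) by (intro hausdorff_delta_le) (fastforce simp: V_def)+
  moreover have "hausdorff_delta s \<delta> B \<le> (\<Sum>i. hausdorff_gauge s (W i))"
    using U assms(1) by (intro hausdorff_delta_le) (fastforce simp: W_def)+
  moreover have "hausdorff_gauge s (V i) + hausdorff_gauge s (W i) \<le> hausdorff_gauge s (U i)" for i
    using dj[of i] by (auto simp: V_def W_def hausdorff_gauge_def)
  then have "(\<Sum>i. hausdorff_gauge s (V i) + hausdorff_gauge s (W i)) \<le> (\<Sum>i. hausdorff_gauge s (U i))"
    by (intro suminf_le) auto
  moreover have "(\<Sum>i. hausdorff_gauge s (V i)) + (\<Sum>i. hausdorff_gauge s (W i)) =
      (\<Sum>i. hausdorff_gauge s (V i) + hausdorff_gauge s (W i))"
    by (intro suminf_add) auto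
  ultimately show "hausdorff_delta s \<delta> A + hausdorff_delta s \<delta> B \<le> (\<Sum>i. hausdorff_gauge s (U i))"
    by (metis add_mono order_trans)
qed

text \<open>The suprema for \<open>A\<close> and \<open>B\<close> are taken independently, so two
  unrelated scales are first lowered to a common one, at most \<open>e/2\<close>, where no covering
  set can meet both sets.\<close>

lemma hausdorff_outer_separated:
  assumes "0 < e" and sep: "\<And>x y. x \<in> A \<Longrightarrow> y \<in> B \<Longrightarrow> e \<le> dist x y"
  shows "hausdorff_outer s A + hausdorff_outer s B \<le> hausdorff_outer s (A \<union> B)"
proof -
  have *: "hausdorff_delta s \<delta>1 A + hausdorff_delta s \<delta>2 B \<le> hausdorff_outer s (A \<union> B)"
    if "0 < \<delta>1" "0 < \<delta>2" for \<delta>1 \<delta>2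
  proof -
    define \<delta> where "\<delta> = min (e/2) (min \<delta>1 \<delta>2)"
    have "hausdorff_delta s \<delta>1 A + hausdorff_delta s \<delta>2 B \<le> hausdorff_delta s \<delta> A + hausdorff_delta s \<delta> B"
      by (intro add_mono hausdorff_delta_antimono) (auto simp: \<delta>_def)
    also have "\<dots> \<le> hausdorff_delta s \<delta> (A \<union> B)"
      using assms that by (intro hausdorff_delta_separated[where e=e]) (auto simp: \<delta>_def)
    also have "\<dots> \<le> hausdorff_outer s (A \<union> B)"
      using assms that by (intro hausdorff_delta_le_outer) (auto simp: \<delta>_def)
    finally show ?thesis .
  qed
  have "hausdorff_outer s A + hausdorff_delta s \<delta>2 B \<le> hausdorff_outer s (A \<union> B)" if "0 < \<delta>2" for \<delta>2
    unfolding hausdorff_outer_def[of s A]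
    using * that by (subst ennreal_SUP_add_left[symmetric]) (auto intro!: SUP_least)
  then show ?thesis
    unfolding hausdorff_outer_def[of s B]
    by (subst ennreal_SUP_add_right) (auto intro!: SUP_least)
qed

lemma emeasure_hausdorff_measure:
  "A \<in> sets borel \<Longrightarrow> emeasure (hausdorff_measure s) A = hausdorff_outer s A"
  unfolding hausdorff_measure_def
  by (rule emeasure_measure_of_metric_outer_measure[OF outer_measure_space_hausdorff_outer hausdorff_outer_separated])

lemma sets_hausdorff_measure [measurable_cong]: "sets (hausdorff_measure s) = sets borel"
  unfolding hausdorff_measure_def using sets.sigma_sets_eq[of borel] by simp

lemma emeasure_normalized_hausdorff:
  assumes "K \<in> sets borel" "A \<in> sets borel"
  shows "emeasure (normalized_hausdorff s K) A = inverse (hausdorff_outer s K) * hausdorff_outer s (K \<inter> A)"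
proof -
  have "emeasure (density (hausdorff_measure s) (indicator K)) A = emeasure (hausdorff_measure s) (K \<inter> A)"
    using assms by (subst emeasure_density)
      (auto simp: sets_hausdorff_measure indicator_inter_arith[symmetric] measurable_cong_sets[OF sets_hausdorff_measure refl])
  then show ?thesis
    using assms by (simp add: normalized_hausdorff_def emeasure_hausdorff_measure)
qed

section \<open>Words and cells of an equicontractive system\<close>

lemma ifs_word_Nil [simp]: "ifs_word \<rho> d [] x = x"
  by (simp add: ifs_word_def)

lemma ifs_word_Cons: "ifs_word \<rho> d (j # \<sigma>) x = \<rho> * ifs_word \<rho> d \<sigma> x + d j"
  by (simp add: ifs_word_def ifs_map_def)

lemma ifs_word_affine: "ifs_word \<rho> d \<sigma> x = \<rho> ^ length \<sigma> * x + ifs_word \<rho> d \<sigma> 0"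
  by (induction \<sigma>) (simp_all add: ifs_word_Cons algebra_simps)

lemma ifs_word_append: "ifs_word \<rho> d (\<sigma> @ \<tau>) x = ifs_word \<rho> d \<sigma> (ifs_word \<rho> d \<tau> x)"
  by (induction \<sigma>) (simp_all add: ifs_word_Cons)

lemma ifs_word_append_0:
  "ifs_word \<rho> d (\<sigma> @ \<tau>) 0 = ifs_word \<rho> d \<sigma> 0 + \<rho> ^ length \<sigma> * ifs_word \<rho> d \<tau> 0"
  by (simp add: ifs_word_append ifs_word_affine[of _ _ _ "ifs_word _ _ _ 0"])

lemma ifs_word_snoc_0: "ifs_word \<rho> d (\<sigma> @ [l]) 0 = ifs_word \<rho> d \<sigma> 0 + \<rho> ^ length \<sigma> * d l"
  by (simp add: ifs_word_append_0 ifs_word_Cons)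

lemma words_0 [simp]: "words m 0 = {[]}"
  by (auto simp: words_def)

lemma finite_words [simp]: "finite (words m n)"
  using finite_lists_length_eq[of "{..m}" n] by (simp add: words_def conj_commute)

lemma length_words: "\<sigma> \<in> words m n \<Longrightarrow> length \<sigma> = n"
  by (simp add: words_def)

lemma append_words: "\<sigma> \<in> words m n \<Longrightarrow> \<tau> \<in> words m k \<Longrightarrow> \<sigma> @ \<tau> \<in> words m (n + k)"
  by (auto simp: words_def)

lemma replicate_words: "j \<le> m \<Longrightarrow> replicate n j \<in> words m n"
  by (auto simp: words_def)

lemma bij_betw_append_words:
  "bij_betw (\<lambda>(\<sigma>, \<tau>). \<sigma> @ \<tau>) (words m n \<times> words m k) (words m (n + k))"
proof (rule bij_betw_byWitness[where f' = "\<lambda>\<omega>. (take n \<omega>, drop n \<omega>)"])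
  show "(\<lambda>\<omega>. (take n \<omega>, drop n \<omega>)) ` words m (n + k) \<subseteq> words m n \<times> words m k"
  proof clarsimp
    fix \<omega> assume \<omega>: "\<omega> \<in> words m (n + k)"
    have \<omega>': "set \<omega> \<subseteq> {..m}" "length \<omega> = n + k" using \<omega> unfolding words_def by blast+
    have "take n \<omega> \<in> words m n"
      unfolding words_def mem_Collect_eq length_take \<omega>'(2)
      by (rule conjI[OF _ subset_trans[OF set_take_subset \<omega>'(1)]]) (rule min_absorb2[OF le_add1])
    moreover have "drop n \<omega> \<in> words m k"
      unfolding words_def mem_Collect_eq length_drop \<omega>'(2)
      by (rule conjI[OF _ subset_trans[OF set_drop_subset \<omega>'(1)]]) (rule add_diff_cancel_left')
    ultimately show "take n \<omega> \<in> words m n \<and> drop n \<omega> \<in> words m k" ..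
  qed
qed (auto simp: words_def)

lemma words_addE:
  assumes "\<omega> \<in> words m (n + k)"
  obtains \<sigma> \<tau> where "\<sigma> \<in> words m n" "\<tau> \<in> words m k" "\<omega> = \<sigma> @ \<tau>"
proof -
  have "\<omega> \<in> (\<lambda>(\<sigma>, \<tau>). \<sigma> @ \<tau>) ` (words m n \<times> words m k)"
    unfolding bij_betw_imp_surj_on[OF bij_betw_append_words] by (rule assms)
  then show ?thesis using that by auto
qed

lemma bij_betw_singleton_words: "bij_betw (\<lambda>l. [l]) {..m} (words m 1)"
  by (rule bij_betw_byWitness[where f' = hd]) (auto simp: words_def length_Suc_conv)

lemma sum_words_add:
  fixes g :: "nat list \<Rightarrow> 'a::comm_monoid_add"
  shows "(\<Sum>\<omega>\<in>words m (n + k). g \<omega>) = (\<Sum>\<sigma>\<in>words m n. \<Sum>\<tau>\<in>words m k. g (\<sigma> @ \<tau>))"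
  using sum.reindex_bij_betw[OF bij_betw_append_words, of g m n k]
  by (simp add: sum.cartesian_product split_beta)

lemma sum_words_1:
  fixes g :: "nat list \<Rightarrow> 'a::comm_monoid_add"
  shows "(\<Sum>\<omega>\<in>words m 1. g \<omega>) = (\<Sum>l\<le>m. g [l])"
  using sum.reindex_bij_betw[OF bij_betw_singleton_words, of g m] by simp

lemma words_SucE:
  assumes "\<omega> \<in> words m (Suc n)"
  obtains \<sigma> l where "\<sigma> \<in> words m n" "l \<le> m" "\<omega> = \<sigma> @ [l]"
proof -
  obtain \<sigma> \<tau> where "\<sigma> \<in> words m n" "\<tau> \<in> words m 1" "\<omega> = \<sigma> @ \<tau>"
    using words_addE[of \<omega> m n 1] assms by auto
  moreover then obtain l where "\<tau> = [l]" "l \<le> m" by (auto simp: words_def length_Suc_conv)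
  ultimately show ?thesis using that by auto
qed

lemma snoc_words: "\<sigma> \<in> words m n \<Longrightarrow> l \<le> m \<Longrightarrow> \<sigma> @ [l] \<in> words m (Suc n)"
  by (auto simp: words_def)

section \<open>The attractor and the left endpoints of its cells\<close>

locale equicontractive_ifs =
  fixes m :: nat and \<rho> :: real and d :: "nat \<Rightarrow> real" and K :: "real set"
  assumes m_ge_1: "1 \<le> m" and rho_pos: "0 < \<rho>" and rho_less_1: "\<rho> < 1"
    and d_0: "d 0 = 0" and d_strict_mono: "strict_mono_on {..m} d"
    and attractor: "is_attractor m \<rho> d K" and hull: "convex hull K = {0..1}"
begin

abbreviation left :: "nat list \<Rightarrow> real" where "left \<sigma> \<equiv> ifs_word \<rho> d \<sigma> 0"

text \<open>All maps of level \<open>n\<close> have the same ratio, so the left endpoint determines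
  the map: words with equal maps are counted once. The cardinality is the \<open>N n\<close> of the
  overview.\<close>

definition lefts :: "nat \<Rightarrow> real set" where "lefts n = left ` words m n"

lemma rho_power_pos [simp]: "0 < \<rho> ^ n" using rho_pos by simp

lemma compact_K: "compact K" and K_nonempty: "K \<noteq> {}" and K_eq: "K = (\<Union>j\<le>m. ifs_map \<rho> d j ` K)"
  using attractor by (auto simp: is_attractor_def)

lemma K_subset: "K \<subseteq> {0..1}" using hull hull_subset[of K convex] by auto

lemma ifs_map_in_K: "j \<le> m \<Longrightarrow> x \<in> K \<Longrightarrow> \<rho> * x + d j \<in> K"
  using K_eq by (auto simp: ifs_map_def)

lemma K_cases: assumes "x \<in> K" obtains j y where "j \<le> m" "y \<in> K" "x = \<rho> * y + d j"
proof -
  have "x \<in> (\<Union>j\<le>m. ifs_map \<rho> d j ` K)" using assms K_eq by blast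
  then show ?thesis using that by (auto simp: ifs_map_def)
qed

text \<open>Extreme points of a convex hull belong to the set itself.\<close>

lemma zero_one_in_K: "0 \<in> K" "1 \<in> K"
proof -
  have *: "x \<in> K" if "x extreme_point_of {0..1}" for x
    by (rule extreme_point_of_convex_hull) (simp add: hull that)
  show "0 \<in> K" by (rule *) (auto simp: extreme_point_of_def open_segment_eq_real_ivl)
  show "1 \<in> K" by (rule *) (auto simp: extreme_point_of_def open_segment_eq_real_ivl)
qed

lemma d_le: "j \<le> m \<Longrightarrow> d j \<le> d m"
  using strict_mono_onD[OF d_strict_mono, of j m] by (cases "j = m") auto

lemma d_nonneg: "j \<le> m \<Longrightarrow> 0 \<le> d j"
  using strict_mono_onD[OF d_strict_mono, of 0 j] d_0 by (cases "j = 0") auto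

text \<open>The image of 1 under the last map is at most 1; conversely 1 lies in some image of
  \<open>K\<close>, and no image reaches beyond \<rho> + \<open>d m\<close>.\<close>

lemma d_m: "d m = 1 - \<rho>"
proof -
  have "\<rho> + d m \<le> 1" using ifs_map_in_K[of m 1] zero_one_in_K K_subset by auto
  moreover obtain j y where "j \<le> m" "y \<in> K" "1 = \<rho> * y + d j" using zero_one_in_K(2) by (rule K_cases)
  moreover from this have "\<rho> * y \<le> \<rho> * 1" using K_subset rho_pos by (intro mult_left_mono) auto
  ultimately show ?thesis using d_le[of j] by linarith
qed

lemma d_inj: "i \<le> m \<Longrightarrow> j \<le> m \<Longrightarrow> d i = d j \<Longrightarrow> i = j"
  using strict_mono_on_eqD[OF d_strict_mono, of i j] by auto

lemma ifs_word_eq: "\<sigma> \<in> words m n \<Longrightarrow> ifs_word \<rho> d \<sigma> x = left \<sigma> + \<rho> ^ n * x"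
  using ifs_word_affine[of \<rho> d \<sigma> x] by (simp add: length_words)

lemma left_append: "\<sigma> \<in> words m n \<Longrightarrow> left (\<sigma> @ \<tau>) = left \<sigma> + \<rho> ^ n * left \<tau>"
  by (simp add: ifs_word_append_0 length_words)

lemma left_snoc: "\<sigma> \<in> words m n \<Longrightarrow> left (\<sigma> @ [l]) = left \<sigma> + \<rho> ^ n * d l"
  by (simp add: ifs_word_snoc_0 length_words)

lemma ifs_word_in_K: "\<sigma> \<in> words m n \<Longrightarrow> x \<in> K \<Longrightarrow> ifs_word \<rho> d \<sigma> x \<in> K"
proof (induction \<sigma> arbitrary: n)
  case (Cons j \<sigma>)
  then have "\<sigma> \<in> words m (n - 1)" "j \<le> m" by (auto simp: words_def)
  then show ?case unfolding ifs_word_Cons using Cons.IH Cons.prems(2) by (intro ifs_map_in_K)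
qed simp

lemma K_word_cases:
  assumes "x \<in> K" obtains \<sigma> y where "\<sigma> \<in> words m n" "y \<in> K" "x = left \<sigma> + \<rho> ^ n * y"
proof -
  have "\<exists>\<sigma>\<in>words m n. \<exists>y\<in>K. x = left \<sigma> + \<rho> ^ n * y"
  proof (induction n)
    case (Suc n)
    then obtain \<sigma> y where 1: "\<sigma> \<in> words m n" "y \<in> K" "x = left \<sigma> + \<rho> ^ n * y" by auto
    obtain j z where 2: "j \<le> m" "z \<in> K" "y = \<rho> * z + d j" using \<open>y \<in> K\<close> by (rule K_cases)
    show ?case
      using 1 2 by (intro bexI[of _ "\<sigma> @ [j]"] bexI[of _ z]) (auto simp: left_snoc snoc_words algebra_simps)
  qed (use assms in simp)
  then show ?thesis using that by blast
qed

lemma left_in_K: "\<sigma> \<in> words m n \<Longrightarrow> left \<sigma> \<in> K"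
  using ifs_word_in_K zero_one_in_K by blast

lemma right_in_K: "\<sigma> \<in> words m n \<Longrightarrow> left \<sigma> + \<rho> ^ n \<in> K"
  using ifs_word_in_K[OF _ zero_one_in_K(2), of \<sigma> n] ifs_word_eq[of \<sigma> n 1] by simp

lemma left_nonneg: "\<sigma> \<in> words m n \<Longrightarrow> 0 \<le> left \<sigma>"
  using left_in_K[of \<sigma> n] K_subset by auto

lemma right_le_1: "\<sigma> \<in> words m n \<Longrightarrow> left \<sigma> + \<rho> ^ n \<le> 1"
  using right_in_K[of \<sigma> n] K_subset by auto

lemma lefts_subset_K: "lefts n \<subseteq> K"
  using left_in_K by (auto simp: lefts_def)

lemma lefts_subset: "lefts n \<subseteq> {0..1}"
  using lefts_subset_K K_subset by (rule subset_trans)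

lemma left_replicate_0: "left (replicate n 0) = 0"
  by (induction n) (auto simp: ifs_word_Cons d_0)

lemma left_replicate_m: "left (replicate n m) = 1 - \<rho> ^ n"
  by (induction n) (simp_all add: ifs_word_Cons d_m right_diff_distrib)

lemma finite_lefts [simp]: "finite (lefts n)" by (simp add: lefts_def)

lemma lefts_0 [simp]: "lefts 0 = {0}" by (simp add: lefts_def)

lemma lefts_add: "lefts (n + k) = (\<lambda>(v, w). v + \<rho> ^ n * w) ` (lefts n \<times> lefts k)"
proof -
  have "lefts (n + k) = (\<lambda>(\<sigma>, \<tau>). left (\<sigma> @ \<tau>)) ` (words m n \<times> words m k)"
    unfolding lefts_def bij_betw_imp_surj_on[OF bij_betw_append_words, symmetric]
    by (simp add: image_image split_beta)
  also have "\<dots> = (\<lambda>(\<sigma>, \<tau>). left \<sigma> + \<rho> ^ n * left \<tau>) ` (words m n \<times> words m k)"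
    by (intro image_cong) (auto simp: left_append)
  also have "\<dots> = (\<lambda>(v, w). v + \<rho> ^ n * w) ` (map_prod left left ` (words m n \<times> words m k))"
    by (simp add: image_image split_beta)
  also have "map_prod left left ` (words m n \<times> words m k) = lefts n \<times> lefts k"
    by (simp add: lefts_def map_prod_surj_on)
  finally show ?thesis .
qed

lemma card_lefts_pos: "0 < card (lefts n)"
  using replicate_words[of 0 m n] by (auto simp: card_gt_0_iff lefts_def)

lemma card_lefts_add_le: "card (lefts (n + k)) \<le> card (lefts n) * card (lefts k)"
  unfolding lefts_add by (metis card_cartesian_product card_image_le finite_SigmaI finite_lefts)

text \<open>Each level adds the left endpoint of its rightmost cell, which is too close to 1 to
  start a cell of the previous level. Unbounded counts are what makes the growth rate
  positive.\<close>

lemma card_lefts_gt: "n < card (lefts n)"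
proof (induction n)
  case (Suc n)
  have "lefts n \<subseteq> lefts (Suc n)"
  proof
    fix v assume "v \<in> lefts n"
    then obtain \<sigma> where "\<sigma> \<in> words m n" "v = left \<sigma>" by (auto simp: lefts_def)
    then show "v \<in> lefts (Suc n)"
      unfolding lefts_def by (intro image_eqI[of _ _ "\<sigma> @ [0]"]) (auto simp: left_snoc d_0 snoc_words)
  qed
  moreover have "1 - \<rho> ^ Suc n \<in> lefts (Suc n)"
    using replicate_words[of m m "Suc n"] left_replicate_m[of "Suc n"] unfolding lefts_def
    by (intro image_eqI[of _ _ "replicate (Suc n) m"]) simp_all
  moreover have "1 - \<rho> ^ Suc n \<notin> lefts n"
  proof
    assume "1 - \<rho> ^ Suc n \<in> lefts n"
    then obtain \<sigma> where "\<sigma> \<in> words m n" "left \<sigma> = 1 - \<rho> ^ Suc n" by (auto simp: lefts_def)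
    then have "1 - \<rho> ^ Suc n + \<rho> ^ n \<le> 1" using right_le_1[of \<sigma> n] by simp
    moreover have "\<rho> ^ Suc n < \<rho> ^ n" using rho_pos rho_less_1 by simp
    ultimately show False by simp
  qed
  ultimately have "lefts n \<subset> lefts (Suc n)" by blast
  then have "card (lefts n) < card (lefts (Suc n))" by (simp add: psubset_card_mono)
  then show ?case using Suc by simp
qed (simp add: lefts_def)

end

section \<open>Counting left endpoints under finite type\<close>

locale finite_type_ifs = equicontractive_ifs +
  fixes F :: "real set"
  assumes finite_F: "finite F"
    and finite_type_F: "\<And>n \<sigma> \<sigma>'. n \<ge> 1 \<Longrightarrow> \<sigma> \<in> words m n \<Longrightarrow> \<sigma>' \<in> words m n \<Longrightarrow>
      \<bar>left \<sigma> - left \<sigma>'\<bar> / \<rho> ^ n > 1 \<or> (left \<sigma> - left \<sigma>') / \<rho> ^ n \<in> F"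
begin

text \<open>The successor covers level 0, about which the finite type condition says nothing, and
  makes the bound positive.\<close>

definition mult_bound :: nat where "mult_bound = Suc (card F)"

text \<open>Relative to one fixed left endpoint in the interval, the normalized differences of all
  the others are at most 1 in absolute value and hence lie in \<open>F\<close>.\<close>

lemma card_lefts_interval: "card (lefts n \<inter> {x..x + \<rho> ^ n}) \<le> mult_bound"
proof (cases "n = 0 \<or> lefts n \<inter> {x..x + \<rho> ^ n} = {}")
  case True
  moreover have "card ({0} \<inter> {x..x + 1}) \<le> card {0::real}" by (intro card_mono) auto
  ultimately show ?thesis by (auto simp: mult_bound_def)
next
  case False
  then obtain v0 where "v0 \<in> lefts n" "v0 \<in> {x..x + \<rho> ^ n}" by blast
  then obtain \<sigma>0 where \<sigma>0: "\<sigma>0 \<in> words m n" "left \<sigma>0 \<in> {x..x + \<rho> ^ n}" unfolding lefts_def by blast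
  have "(\<lambda>v. (v - left \<sigma>0) / \<rho> ^ n) ` (lefts n \<inter> {x..x + \<rho> ^ n}) \<subseteq> F"
  proof clarsimp
    fix v assume v: "v \<in> lefts n" "x \<le> v" "v \<le> x + \<rho> ^ n"
    then obtain \<sigma> where "\<sigma> \<in> words m n" "v = left \<sigma>" by (auto simp: lefts_def)
    moreover have "\<bar>v - left \<sigma>0\<bar> / \<rho> ^ n \<le> 1" using v \<sigma>0 by (simp add: divide_le_eq abs_le_iff)
    ultimately show "(v - left \<sigma>0) / \<rho> ^ n \<in> F"
      using finite_type_F[of n \<sigma> \<sigma>0] \<sigma>0 False by auto
  qed
  then have "card ((\<lambda>v. (v - left \<sigma>0) / \<rho> ^ n) ` (lefts n \<inter> {x..x + \<rho> ^ n})) \<le> card F"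
    using finite_F by (intro card_mono)
  then show ?thesis
    by (subst (asm) card_image) (use rho_pos in \<open>auto simp: inj_on_def mult_bound_def\<close>)
qed

lemma card_lefts_interval_multiple:
  "card (lefts n \<inter> {x..x + real k * \<rho> ^ n}) \<le> Suc k * mult_bound"
proof (induction k)
  case 0
  have "lefts n \<inter> {x..x} \<subseteq> lefts n \<inter> {x..x + \<rho> ^ n}"
    using rho_power_pos[of n] by (auto simp del: rho_power_pos)
  then have "card (lefts n \<inter> {x..x}) \<le> card (lefts n \<inter> {x..x + \<rho> ^ n})" by (intro card_mono) auto
  with card_lefts_interval[of n x] show ?case by simp
next
  case (Suc k)
  let ?y = "x + real k * \<rho> ^ n"
  have "lefts n \<inter> {x..x + real (Suc k) * \<rho> ^ n} \<subseteq> lefts n \<inter> {x..?y} \<union> lefts n \<inter> {?y..?y + \<rho> ^ n}"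
    by (auto simp: algebra_simps)
  then have "card (lefts n \<inter> {x..x + real (Suc k) * \<rho> ^ n}) \<le> card (lefts n \<inter> {x..?y} \<union> lefts n \<inter> {?y..?y + \<rho> ^ n})"
    by (intro card_mono) auto
  also have "\<dots> \<le> card (lefts n \<inter> {x..?y}) + card (lefts n \<inter> {?y..?y + \<rho> ^ n})" by (rule card_Un_le)
  also have "\<dots> \<le> Suc (Suc k) * mult_bound" using Suc card_lefts_interval[of n ?y] by simp
  finally show ?case .
qed

text \<open>Concatenation maps pairs \<open>(v, w)\<close> onto the left endpoints of level
  \<open>n + k\<close>. In the fibre over \<open>u\<close> the first component determines the second
  and lies within \<rho>^n to the left of \<open>u\<close>, so a fibre has at most
  \<open>mult_bound\<close> elements.\<close>

lemma card_lefts_mult_le: "card (lefts n) * card (lefts k) \<le> mult_bound * card (lefts (n + k))"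
proof -
  let ?f = "\<lambda>(v, w). v + \<rho> ^ n * w" and ?S = "lefts n \<times> lefts k"
  have "card ?S = (\<Sum>u\<in>?f ` ?S. card {p \<in> ?S. ?f p = u})"
    using sum.image_gen[of ?S "\<lambda>_. 1::nat" ?f] by simp
  also have "\<dots> \<le> (\<Sum>u\<in>?f ` ?S. mult_bound)"
  proof (rule sum_mono)
    fix u
    have "inj_on fst {p \<in> ?S. ?f p = u}"
      using rho_pos by (auto simp: inj_on_def)
    then have "card {p \<in> ?S. ?f p = u} = card (fst ` {p \<in> ?S. ?f p = u})" by (simp add: card_image)
    also have "\<dots> \<le> card (lefts n \<inter> {u - \<rho> ^ n..(u - \<rho> ^ n) + \<rho> ^ n})"
    proof (rule card_mono)
      show "fst ` {p \<in> ?S. ?f p = u} \<subseteq> lefts n \<inter> {u - \<rho> ^ n..(u - \<rho> ^ n) + \<rho> ^ n}"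
      proof (rule image_subsetI)
        fix p assume "p \<in> {p \<in> ?S. ?f p = u}"
        then obtain v w where p: "p = (v, w)" "v \<in> lefts n" "w \<in> lefts k" "v + \<rho> ^ n * w = u" by auto
        then have "0 \<le> w" "w \<le> 1" using lefts_subset[of k] by auto
        then have "0 \<le> \<rho> ^ n * w" "\<rho> ^ n * w \<le> \<rho> ^ n" using rho_pos by (simp_all add: mult_left_le)
        then show "fst p \<in> lefts n \<inter> {u - \<rho> ^ n..(u - \<rho> ^ n) + \<rho> ^ n}" using p by auto
      qed
    qed simp
    also have "\<dots> \<le> mult_bound" by (rule card_lefts_interval)
    finally show "card {p \<in> ?S. ?f p = u} \<le> mult_bound" .
  qed
  finally show ?thesis by (simp add: card_cartesian_product lefts_add mult.commute)
qed

text \<open>The Fekete limit of a subadditive sequence, taken as an infimum so that the lower bound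
  for the counts holds at every level with constant 1.\<close>

definition growth :: real where "growth = (INF n\<in>{1..}. ln (card (lefts n)) / real n)"

lemma card_lefts_ge_exp: "exp (real n * growth) \<le> card (lefts n)"
proof (cases "n = 0")
  case False
  have "bdd_below ((\<lambda>n. ln (card (lefts n)) / real n) ` {1..})"
    using card_lefts_pos by (intro bdd_belowI2[of _ 0]) (auto intro!: divide_nonneg_nonneg simp: Suc_leI)
  then have "growth \<le> ln (card (lefts n)) / real n"
    unfolding growth_def using False by (intro cINF_lower) auto
  then have "real n * growth \<le> ln (card (lefts n))" using False by (simp add: field_simps)
  then show ?thesis using card_lefts_pos[of n] by (metis exp_le_cancel_iff exp_ln of_nat_0_less_iff)
qed (use card_lefts_pos[of 0] in simp)

text \<open>With a(n) the logarithm of the count and c = \<open>ln mult_bound\<close>,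
  supermultiplicativity gives k (a(n) - c) \<le> a(kn) and submultiplicativity a(nk) \<le> n a(k).
  Hence (a(n) - c)/n is below every a(k)/k, and so below their infimum.\<close>

lemma card_lefts_le_exp: "card (lefts n) \<le> mult_bound * exp (real n * growth)"
proof (cases "n = 0")
  case True
  then show ?thesis by (simp add: lefts_def mult_bound_def)
next
  case False
  define c where "c = ln (real mult_bound)"
  have M: "0 < mult_bound" by (simp add: mult_bound_def)
  let ?a = "\<lambda>n. ln (card (lefts n))"
  have "?a n + ?a k \<le> c + ?a (n + k)" for n k
  proof -
    have "real (card (lefts n)) * real (card (lefts k)) \<le> real mult_bound * real (card (lefts (n + k)))"
      using card_lefts_mult_le[of n k] by (metis of_nat_le_iff of_nat_mult)
    then have "ln (real (card (lefts n)) * real (card (lefts k))) \<le> ln (real mult_bound * real (card (lefts (n + k))))"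
      using card_lefts_pos M by (subst ln_le_cancel_iff) auto
    then show ?thesis using card_lefts_pos M by (simp add: ln_mult_pos c_def)
  qed
  note sup = this
  have up: "real k * (?a n - c) \<le> ?a (k * n)" for k
  proof (induction k)
    case (Suc k) then show ?case using sup[of n "k * n"] by (simp add: algebra_simps)
  qed (simp add: lefts_def)
  have "?a (n + k) \<le> ?a n + ?a k" for n k
  proof -
    have "real (card (lefts (n + k))) \<le> real (card (lefts n)) * real (card (lefts k))"
      using card_lefts_add_le[of n k] by (metis of_nat_le_iff of_nat_mult)
    then have "?a (n + k) \<le> ln (real (card (lefts n)) * real (card (lefts k)))"
      using card_lefts_pos by (subst ln_le_cancel_iff) auto
    then show ?thesis using card_lefts_pos by (simp add: ln_mult_pos)
  qed
  note sub = this
  have dn: "?a (n * k) \<le> real n * ?a k" for n k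
  proof (induction n)
    case (Suc n) then show ?case using sub[of k "n * k"] by (simp add: algebra_simps)
  qed (simp add: lefts_def)
  have "(?a n - c) / real n \<le> ?a k / real k" if "1 \<le> k" for k
    using up[of k] dn[of n k] False that by (simp add: field_simps)
  then have "(?a n - c) / real n \<le> growth"
    unfolding growth_def by (intro cINF_greatest) auto
  then have "?a n \<le> c + real n * growth" using False by (simp add: field_simps)
  then have "exp (?a n) \<le> exp (c + real n * growth)" by simp
  then show ?thesis using card_lefts_pos[of n] M by (simp add: exp_add c_def)
qed

text \<open>Otherwise all counts would be at most \<open>mult_bound\<close>, which fails at level
  \<open>mult_bound\<close>.\<close>

lemma growth_pos: "0 < growth"
proof (rule ccontr)
  assume "\<not> 0 < growth"
  then have "real mult_bound * exp (real mult_bound * growth) \<le> real mult_bound * 1"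
    by (intro mult_left_mono) (auto simp: mult_nonneg_nonpos)
  then show False using card_lefts_le_exp[of mult_bound] card_lefts_gt[of mult_bound] by simp
qed

text \<open>The exponent for which \<rho>^\<open>sim_dim\<close> is exp(-\<open>growth\<close>). It
  is based on distinct cells, so exact overlaps lower it below the similarity dimension of the
  \<open>m + 1\<close> maps.\<close>

definition sim_dim :: real where "sim_dim = growth / - ln \<rho>"

lemma sim_dim_pos: "0 < sim_dim"
  using growth_pos rho_pos rho_less_1 by (simp add: sim_dim_def divide_pos_neg)

lemma rho_powr_sim_dim: "\<rho> powr (real n * sim_dim) = exp (- (real n * growth))"
  using rho_pos rho_less_1 by (simp add: powr_def sim_dim_def field_simps)

lemma card_lefts_ge: "1 \<le> card (lefts n) * \<rho> powr (real n * sim_dim)"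
  using card_lefts_ge_exp[of n] by (simp add: rho_powr_sim_dim exp_minus field_simps)

lemma card_lefts_le: "card (lefts n) * \<rho> powr (real n * sim_dim) \<le> mult_bound"
  using card_lefts_le_exp[of n] by (simp add: rho_powr_sim_dim exp_minus field_simps)

end

section \<open>Dimension of the attractor\<close>

context equicontractive_ifs begin

text \<open>The error term \<open>e\<close> makes room for sets of diameter \<open>0\<close>.\<close>

lemma scale_obtain:
  assumes "0 \<le> D" "D \<le> 1" "0 < t" "0 < e"
  obtains k where "D \<le> \<rho> ^ k" "\<rho> powr (real k * t) \<le> \<rho> powr (- t) * D powr t + e"
proof (cases "D = 0")
  case True
  have "0 < \<rho> powr t" "\<rho> powr t < 1"
    using rho_pos rho_less_1 powr_less_mono2[OF assms(3), of \<rho> 1] by auto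
  then obtain k where "(\<rho> powr t) ^ k < e"
    using real_arch_pow_inv assms(4) by blast
  then have "\<rho> powr (real k * t) \<le> e"
    using rho_pos by (simp add: powr_power mult.commute)
  then show ?thesis using that[of k] True rho_pos by simp
next
  case False
  then have D: "0 < D" using assms(1) by simp
  \<comment> \<open>The first power below \<open>D\<close>; the one before it is comparable with
    \<open>D\<close> up to a factor \<rho>, and it exists because \<open>D\<close> \<le> 1.\<close>
  define n where "n = (LEAST n. \<rho> ^ n < D)"
  have ex: "\<exists>n. \<rho> ^ n < D" using real_arch_pow_inv D rho_less_1 by blast
  have n: "\<rho> ^ n < D" unfolding n_def using ex by (rule LeastI_ex)
  then have "n \<noteq> 0" using assms(2) by (intro notI) simp
  then obtain k where k: "n = Suc k" by (cases n) auto
  have "D \<le> \<rho> ^ k" using not_less_Least[of k "\<lambda>n. \<rho> ^ n < D"] k n_def by simp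
  moreover have "\<rho> ^ k \<le> D / \<rho>" using n k rho_pos by (simp add: field_simps)
  then have "(\<rho> ^ k) powr t \<le> (D / \<rho>) powr t" using assms(3) rho_pos by (intro powr_mono2) auto
  then have "\<rho> powr (real k * t) \<le> \<rho> powr (- t) * D powr t"
    using rho_pos D by (simp add: powr_divide powr_minus field_simps powr_powr flip: powr_realpow)
  ultimately show ?thesis using that[of k] assms(4) by simp
qed

lemma rho_power_less: "0 < e \<Longrightarrow> \<exists>n. \<rho> ^ n < e"
  using real_arch_pow_inv rho_less_1 by blast

lemma hausdorff_delta_K_le:
  assumes "0 < t" "\<rho> ^ n \<le> \<delta>"
  shows "hausdorff_delta t \<delta> K \<le> ennreal (card (lefts n) * \<rho> powr (real n * t))"
proof -
  let ?N = "card (lefts n)"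
  obtain h where h: "bij_betw h {0..<?N} (lefts n)"
    using ex_bij_betw_nat_finite[OF finite_lefts] by blast
  \<comment> \<open>A finite cover by cells, padded with empty sets of gauge 0.\<close>
  define U where "U i = (if i < ?N then {h i..h i + \<rho> ^ n} else {})" for i
  have diam: "diameter (U i) = (if i < ?N then \<rho> ^ n else 0)" for i
    using rho_pos by (simp add: U_def not_less)
  have "K \<subseteq> (\<Union>i. U i)"
  proof
    fix x assume "x \<in> K"
    then obtain \<sigma> y where \<sigma>: "\<sigma> \<in> words m n" "y \<in> K" "x = left \<sigma> + \<rho> ^ n * y" by (rule K_word_cases)
    then have "left \<sigma> \<in> h ` {0..<?N}" using h by (auto simp: bij_betw_def lefts_def)
    then obtain i where i: "i < ?N" "h i = left \<sigma>" by auto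
    have "0 \<le> y" "y \<le> 1" using \<sigma>(2) K_subset by auto
    then have "x \<in> U i" using i \<sigma>(3) rho_pos by (simp add: U_def mult_left_le)
    then show "x \<in> (\<Union>i. U i)" by blast
  qed
  then have "hausdorff_delta t \<delta> K \<le> (\<Sum>i. hausdorff_gauge t (U i))"
    using assms(2) order_trans[OF less_imp_le[OF rho_power_pos] assms(2)]
    by (intro hausdorff_delta_le) (auto simp: diam, simp add: U_def)
  also have "\<dots> = (\<Sum>i<?N. hausdorff_gauge t (U i))"
    by (rule suminf_finite) (auto simp: U_def hausdorff_gauge_def)
  also have "\<dots> = (\<Sum>i<?N. ennreal (\<rho> powr (real n * t)))"
    using rho_pos assms(1)
    by (intro sum.cong) (auto simp: hausdorff_gauge_def diam U_def powr_powr simp flip: powr_realpow)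
  also have "\<dots> = ennreal (?N * \<rho> powr (real n * t))"
    by (simp add: ennreal_mult ennreal_of_nat_eq_real_of_nat)
  finally show ?thesis .
qed

text \<open>The prefix of length \<open>k\<close> of a word moves its left endpoint by at most
  \<rho>^k to the left, which is why the window is widened on that side only.\<close>

lemma card_lefts_interval_le_refined:
  assumes "k \<le> n"
  shows "card (lefts n \<inter> {a..b}) \<le> card (lefts k \<inter> {a - \<rho> ^ k..b}) * card (lefts (n - k))"
proof -
  have "lefts n = lefts (k + (n - k))" using assms by simp
  then have "lefts n \<inter> {a..b} \<subseteq> (\<lambda>(v, w). v + \<rho> ^ k * w) ` ((lefts k \<inter> {a - \<rho> ^ k..b}) \<times> lefts (n - k))"
  proof (clarsimp simp: lefts_add)
    fix v w assume vw: "v \<in> lefts k" "w \<in> lefts (n - k)" and ab: "a \<le> v + \<rho> ^ k * w" "v + \<rho> ^ k * w \<le> b"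
    have "0 \<le> w" "w \<le> 1" using vw lefts_subset[of "n - k"] by auto
    then have "0 \<le> \<rho> ^ k * w" "\<rho> ^ k * w \<le> \<rho> ^ k" using rho_pos by (simp_all add: mult_left_le)
    then have "v \<in> {a - \<rho> ^ k..b}" using ab unfolding atLeastAtMost_iff by linarith
    then show "v + \<rho> ^ k * w \<in> (\<lambda>(v, w). v + \<rho> ^ k * w) ` ((lefts k \<inter> {a - \<rho> ^ k..b}) \<times> lefts (n - k))"
      using vw by (intro image_eqI[of _ _ "(v, w)"]) auto
  qed
  then have "card (lefts n \<inter> {a..b}) \<le> card ((lefts k \<inter> {a - \<rho> ^ k..b}) \<times> lefts (n - k))"
    by (intro surj_card_le) auto
  then show ?thesis by (simp add: card_cartesian_product)
qed

end

section \<open>Bounds for the Hausdorff measure of the attractor\<close>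

context finite_type_ifs begin

lemma mult_bound_pos: "0 < mult_bound" by (simp add: mult_bound_def)

text \<open>Cover by the cells of one level. Finiteness is what later makes the normalizing factor
  non-zero.\<close>

lemma hausdorff_outer_K_le: "hausdorff_outer sim_dim K \<le> ennreal mult_bound"
  unfolding hausdorff_outer_def
proof (rule SUP_least)
  fix \<delta> :: real assume "\<delta> \<in> {0<..}"
  then obtain n where "\<rho> ^ n < \<delta>" using rho_power_less by auto
  then have "hausdorff_delta sim_dim \<delta> K \<le> ennreal (card (lefts n) * \<rho> powr (real n * sim_dim))"
    using sim_dim_pos by (intro hausdorff_delta_K_le) auto
  also have "\<dots> \<le> ennreal mult_bound" by (intro ennreal_leI card_lefts_le)
  finally show "hausdorff_delta sim_dim \<delta> K \<le> ennreal mult_bound" .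
qed

lemma hausdorff_outer_K_eq_0:
  assumes "sim_dim < t"
  shows "hausdorff_outer t K = 0"
proof -
  have "hausdorff_delta t \<delta> K \<le> 0" if "0 < \<delta>" for \<delta>
  proof (rule ennreal_le_epsilon)
    fix e :: real assume e: "0 < e"
    let ?u = "t - sim_dim"
    \<comment> \<open>Chosen so that \<rho>^n < \<open>e'\<close> gives both cells shorter than
      \<delta> and \<open>mult_bound\<close> \<rho>^(n(t - \<open>sim_dim\<close>)) \<le>
      \<open>e\<close>.\<close>
    define e' where "e' = min \<delta> ((e / mult_bound) powr (1 / ?u))"
    have "0 < e'" using e that mult_bound_pos by (simp add: e'_def)
    then obtain n where n: "\<rho> ^ n < e'" using rho_power_less by blast
    then have "(\<rho> ^ n) powr ?u \<le> ((e / mult_bound) powr (1 / ?u)) powr ?u"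
      using assms by (intro powr_mono2) (auto simp: e'_def less_imp_le)
    also have "\<dots> = e / mult_bound" using assms e by (simp add: powr_powr)
    finally have 1: "mult_bound * \<rho> powr (real n * ?u) \<le> e"
      using mult_bound_pos rho_pos by (simp add: field_simps powr_powr flip: powr_realpow)
    have "card (lefts n) * \<rho> powr (real n * t) = card (lefts n) * \<rho> powr (real n * sim_dim) * \<rho> powr (real n * ?u)"
      using rho_pos by (simp add: algebra_simps flip: powr_add)
    also have "\<dots> \<le> mult_bound * \<rho> powr (real n * ?u)"
      using card_lefts_le by (intro mult_right_mono) auto
    also note 1
    finally have 2: "card (lefts n) * \<rho> powr (real n * t) \<le> e" .
    have "hausdorff_delta t \<delta> K \<le> ennreal (card (lefts n) * \<rho> powr (real n * t))"
      using n sim_dim_pos assms by (intro hausdorff_delta_K_le) (auto simp: e'_def)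
    also have "\<dots> \<le> ennreal e" using 2 by (rule ennreal_leI)
    finally show "hausdorff_delta t \<delta> K \<le> 0 + ennreal e" by simp
  qed
  then show ?thesis by (simp add: hausdorff_outer_def)
qed

text \<open>The ball, widened by \<rho>^k on the left, is an interval of length 5 \<rho>^k and meets
  at most 6 \<open>mult_bound\<close> left endpoints of level \<open>k\<close>; the second factor
  \<open>mult_bound\<close> comes from the count at level \<open>n - k\<close>.\<close>

lemma card_lefts_ball:
  assumes "k \<le> n"
  shows "card (lefts n \<inter> ball x (2 * \<rho> ^ k)) * \<rho> powr (real n * sim_dim)
    \<le> 6 * mult_bound ^ 2 * \<rho> powr (real k * sim_dim)"
proof -
  let ?r = "\<rho> ^ k" and ?M = "real mult_bound"
  have "card (lefts n \<inter> ball x (2 * ?r)) \<le> card (lefts n \<inter> {x - 2 * ?r..x + 2 * ?r})"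
    by (intro card_mono) (auto simp: dist_real_def)
  also have "\<dots> \<le> card (lefts k \<inter> {x - 2 * ?r - ?r..x + 2 * ?r}) * card (lefts (n - k))"
    by (rule card_lefts_interval_le_refined[OF assms])
  also have "{x - 2 * ?r - ?r..x + 2 * ?r} = {x - 3 * ?r..(x - 3 * ?r) + real 5 * ?r}" by simp
  also have "card (lefts k \<inter> {x - 3 * ?r..(x - 3 * ?r) + real 5 * ?r}) * card (lefts (n - k))
      \<le> (6 * mult_bound) * card (lefts (n - k))"
    using card_lefts_interval_multiple[of k "x - 3 * ?r" 5] by (intro mult_right_mono) simp_all
  finally have "real (card (lefts n \<inter> ball x (2 * ?r))) \<le> real (6 * mult_bound * card (lefts (n - k)))"
    by (rule of_nat_mono)
  then have "card (lefts n \<inter> ball x (2 * ?r)) * \<rho> powr (real n * sim_dim)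
      \<le> (6 * ?M * card (lefts (n - k))) * \<rho> powr (real n * sim_dim)"
    by (intro mult_right_mono) auto
  also have "\<dots> = 6 * ?M * (card (lefts (n - k)) * \<rho> powr (real (n - k) * sim_dim)) * \<rho> powr (real k * sim_dim)"
    using assms by (simp add: of_nat_diff algebra_simps flip: powr_add)
  also have "\<dots> \<le> 6 * ?M * ?M * \<rho> powr (real k * sim_dim)"
    using card_lefts_le by (intro mult_right_mono mult_left_mono) auto
  finally show ?thesis by (simp add: power2_eq_square)
qed

text \<open>12 is twice the 6 of \<open>card_lefts_ball\<close>: half of the estimate is given up to
  the error terms.\<close>

definition hausdorff_lower :: real where
  "hausdorff_lower = \<rho> powr sim_dim / (12 * mult_bound ^ 2)"

lemma hausdorff_lower_pos: "0 < hausdorff_lower"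
  using rho_pos mult_bound_pos by (simp add: hausdorff_lower_def)

text \<open>The uniform weights on the left endpoints of one level replace a limiting measure. They
  live on a single level, so the cover is first reduced to a finite one by compactness, and the
  level is then taken finer than every set that remains.\<close>

lemma cover_K_gauge_ge:
  fixes U :: "nat \<Rightarrow> real set"
  assumes cover: "K \<subseteq> (\<Union>i. U i)" and bdd: "\<And>i. bounded (U i)" and diam: "\<And>i. diameter (U i) \<le> 1"
  shows "ennreal hausdorff_lower \<le> (\<Sum>i. hausdorff_gauge sim_dim (U i))"
proof -
  let ?t = sim_dim and ?M = "real mult_bound"
  \<comment> \<open>This makes 6 \<open>mult_bound\<close>^2 \<open>e\<close> = 1/2; the errors,
    weighted by powers of 1/2, then use up half of the total 1.\<close>
  define e where "e = 1 / (12 * ?M ^ 2)"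
  have e: "0 < e" using mult_bound_pos by (simp add: e_def)
  have "\<exists>k. diameter (U i) \<le> \<rho> ^ k \<and>
      \<rho> powr (real k * ?t) \<le> \<rho> powr (- ?t) * diameter (U i) powr ?t + e * (1/2) ^ Suc i" for i
  proof -
    have "0 < e * (1/2) ^ Suc i" using e by simp
    from scale_obtain[OF diameter_ge_0[OF bdd] diam sim_dim_pos this] show ?thesis by metis
  qed
  then obtain k where k: "\<And>i. diameter (U i) \<le> \<rho> ^ k i"
    "\<And>i. \<rho> powr (real (k i) * ?t) \<le> \<rho> powr (- ?t) * diameter (U i) powr ?t + e * (1/2) ^ Suc i"
    by metis
  define x where "x i = (SOME y. y \<in> U i)" for i
  define J where "J = {i. U i \<noteq> {}}"
  have x: "x i \<in> U i" if "i \<in> J" for i using that by (auto simp: J_def x_def some_in_eq)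
  \<comment> \<open>Doubling the radius makes the ball open while still containing
    \<open>U i\<close>, whose diameter may equal \<rho>^(\<open>k i\<close>).\<close>
  define B where "B i = ball (x i) (2 * \<rho> ^ k i)" for i
  have "K \<subseteq> (\<Union>i\<in>J. B i)"
  proof
    fix z assume "z \<in> K"
    then obtain i where i: "z \<in> U i" using cover by blast
    then have "i \<in> J" by (auto simp: J_def)
    have "dist (x i) z \<le> diameter (U i)" by (rule diameter_bounded_bound[OF bdd x[OF \<open>i \<in> J\<close>] i])
    also have "\<dots> \<le> \<rho> ^ k i" by (rule k)
    also have "\<dots> < 2 * \<rho> ^ k i" using rho_power_pos[of "k i"] by linarith
    finally show "z \<in> (\<Union>i\<in>J. B i)" using \<open>i \<in> J\<close> by (auto simp: B_def)
  qed
  then obtain I where I: "I \<subseteq> J" "finite I" "K \<subseteq> (\<Union>i\<in>I. B i)"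
    using compactE_image[OF compact_K, of J B] by (auto simp: B_def)
  \<comment> \<open>Any common level not coarser than all \<open>k i\<close> would do; the sum is
    also defined when \<open>I\<close> is empty.\<close>
  define n where "n = (\<Sum>i\<in>I. k i)"
  have kn: "k i \<le> n" if "i \<in> I" for i
    unfolding n_def using that I(2) by (intro member_le_sum) auto
  have "lefts n = (\<Union>i\<in>I. lefts n \<inter> B i)" using I(3) lefts_subset_K by blast
  then have "card (lefts n) \<le> (\<Sum>i\<in>I. card (lefts n \<inter> B i))"
    using card_UN_le[OF I(2), of "\<lambda>i. lefts n \<inter> B i"] by simp
  then have "card (lefts n) * \<rho> powr (real n * ?t) \<le> (\<Sum>i\<in>I. card (lefts n \<inter> B i)) * \<rho> powr (real n * ?t)"
    by (intro mult_right_mono) (auto simp flip: of_nat_sum)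
  then have "1 \<le> (\<Sum>i\<in>I. card (lefts n \<inter> B i) * \<rho> powr (real n * ?t))"
    using card_lefts_ge[of n] by (simp add: sum_distrib_right)
  also have "\<dots> \<le> (\<Sum>i\<in>I. 6 * ?M ^ 2 * (\<rho> powr (- ?t) * diameter (U i) powr ?t + e * (1/2) ^ Suc i))"
  proof (rule sum_mono)
    fix i assume "i \<in> I"
    have "card (lefts n \<inter> B i) * \<rho> powr (real n * ?t) \<le> 6 * ?M ^ 2 * \<rho> powr (real (k i) * ?t)"
      using card_lefts_ball[OF kn[OF \<open>i \<in> I\<close>], of "x i"] by (simp add: B_def)
    also have "\<dots> \<le> 6 * ?M ^ 2 * (\<rho> powr (- ?t) * diameter (U i) powr ?t + e * (1/2) ^ Suc i)"
      by (intro mult_left_mono k) simp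
    finally show "card (lefts n \<inter> B i) * \<rho> powr (real n * ?t)
      \<le> 6 * ?M ^ 2 * (\<rho> powr (- ?t) * diameter (U i) powr ?t + e * (1/2) ^ Suc i)" .
  qed
  also have "\<dots> = 6 * ?M ^ 2 * (\<rho> powr (- ?t) * (\<Sum>i\<in>I. diameter (U i) powr ?t) + e * (\<Sum>i\<in>I. (1/2) ^ Suc i))"
    by (simp only: sum_distrib_left[symmetric] sum.distrib)
  also have "\<dots> \<le> 6 * ?M ^ 2 * (\<rho> powr (- ?t) * (\<Sum>i\<in>I. diameter (U i) powr ?t) + e * 1)"
  proof -
    have "(\<Sum>i\<in>I. (1/2::real) ^ Suc i) \<le> (\<Sum>i. (1/2) ^ Suc i)"
      by (rule sum_le_suminf[OF sums_summable[OF power_half_series] I(2)]) simp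
    also have "\<dots> = 1" using sums_unique[OF power_half_series] by simp
    finally show ?thesis using e by (intro mult_left_mono add_left_mono) auto
  qed
  finally have "1 \<le> 6 * ?M ^ 2 * (\<rho> powr (- ?t) * (\<Sum>i\<in>I. diameter (U i) powr ?t) + e * 1)" .
  then have "\<rho> powr ?t \<le> 12 * ?M ^ 2 * (\<Sum>i\<in>I. diameter (U i) powr ?t)"
  proof -
    assume *: "1 \<le> 6 * ?M ^ 2 * (\<rho> powr (- ?t) * (\<Sum>i\<in>I. diameter (U i) powr ?t) + e * 1)"
    have "6 * ?M ^ 2 * e = 1/2" using mult_bound_pos by (simp add: e_def)
    then have "1 \<le> 12 * ?M ^ 2 * (\<Sum>i\<in>I. diameter (U i) powr ?t) * \<rho> powr (- ?t)"
      using * by (simp add: algebra_simps)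
    then show ?thesis using rho_pos by (simp add: powr_minus field_simps)
  qed
  then have "hausdorff_lower \<le> (\<Sum>i\<in>I. diameter (U i) powr ?t)"
    using mult_bound_pos by (simp add: hausdorff_lower_def field_simps)
  then have "ennreal hausdorff_lower \<le> (\<Sum>i\<in>I. ennreal (diameter (U i) powr ?t))"
    by (simp add: ennreal_leI)
  also have "\<dots> = (\<Sum>i\<in>I. hausdorff_gauge ?t (U i))"
    using I(1) sim_dim_pos by (intro sum.cong) (auto simp: J_def hausdorff_gauge_def)
  also have "\<dots> \<le> (\<Sum>i. hausdorff_gauge ?t (U i))"
    by (intro sum_le_suminf) (auto simp: I)
  finally show ?thesis .
qed

text \<open>The dimension is an infimum over exponents of measure zero, so all smaller exponents, 0
  included, have to be excluded. Covering sets of diameter at most 1 have a larger gauge at a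
  smaller exponent.\<close>

lemma hausdorff_outer_K_ge:
  assumes "0 \<le> t" "t \<le> sim_dim"
  shows "ennreal hausdorff_lower \<le> hausdorff_outer t K"
proof -
  have "ennreal hausdorff_lower \<le> hausdorff_delta t 1 K"
    unfolding hausdorff_delta_def
  proof (rule INF_greatest, clarsimp)
    fix U :: "nat \<Rightarrow> real set"
    assume U: "K \<subseteq> (\<Union>i. U i)" "\<forall>i. bounded (U i) \<and> diameter (U i) \<le> 1"
    then have "ennreal hausdorff_lower \<le> (\<Sum>i. hausdorff_gauge sim_dim (U i))"
      by (intro cover_K_gauge_ge) auto
    also have "\<dots> \<le> (\<Sum>i. hausdorff_gauge t (U i))"
    proof (intro suminf_le)
      fix i
      have D: "0 \<le> diameter (U i)" "diameter (U i) \<le> 1" using U(2) diameter_ge_0[of "U i"] by auto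
      \<comment> \<open>For \<open>t\<close> = 0, where the gauge of a non-empty set is 1.\<close>
      have "diameter (U i) powr sim_dim \<le> 1"
        using powr_mono2[of sim_dim "diameter (U i)" 1] D sim_dim_pos by simp
      moreover have "diameter (U i) powr sim_dim \<le> diameter (U i) powr t"
        using powr_mono'[of t sim_dim "diameter (U i)"] D assms by simp
      ultimately show "hausdorff_gauge sim_dim (U i) \<le> hausdorff_gauge t (U i)"
        using sim_dim_pos by (auto simp: hausdorff_gauge_def ennreal_leI)
    qed auto
    finally show "ennreal hausdorff_lower \<le> (\<Sum>i. hausdorff_gauge t (U i))" .
  qed
  also have "\<dots> \<le> hausdorff_outer t K" by (rule hausdorff_delta_le_outer) simp
  finally show ?thesis .
qed

lemma hausdorff_dim_K: "hausdorff_dim K = sim_dim"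
proof -
  have "{t. 0 \<le> t \<and> hausdorff_outer t K = 0} = {sim_dim<..}"
  proof (intro equalityI subsetI)
    fix t assume t: "t \<in> {t. 0 \<le> t \<and> hausdorff_outer t K = 0}"
    show "t \<in> {sim_dim<..}"
    proof (rule ccontr)
      assume "t \<notin> {sim_dim<..}"
      then have "ennreal hausdorff_lower \<le> 0" using hausdorff_outer_K_ge[of t] t by auto
      then show False using hausdorff_lower_pos by simp
    qed
  qed (use hausdorff_outer_K_eq_0 sim_dim_pos in auto)
  then show ?thesis by (simp add: hausdorff_dim_def)
qed

end

section \<open>Net intervals\<close>

context equicontractive_ifs begin

abbreviation endpoints :: "nat \<Rightarrow> real set" where "endpoints n \<equiv> level_endpoints m \<rho> d n"

abbreviation net :: "nat \<Rightarrow> (real \<times> real) set" where "net n \<equiv> net_intervals m \<rho> d K n"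

abbreviation nbrs :: "nat \<Rightarrow> real \<times> real \<Rightarrow> real list" where "nbrs n \<equiv> neighbour_set m \<rho> d n"

abbreviation char_vec :: "nat \<Rightarrow> real \<times> real \<Rightarrow> char_vec" where "char_vec n \<equiv> char_vector m \<rho> d K n"

lemma level_endpoints_eq: "endpoints n = (\<Union>\<sigma>\<in>words m n. {left \<sigma>, left \<sigma> + \<rho> ^ n})"
  unfolding level_endpoints_def by (intro SUP_cong refl) (simp add: ifs_word_eq[of _ n 1])

lemma finite_endpoints: "finite (endpoints n)"
  by (simp add: level_endpoints_eq)

lemma endpoints_subset_K: "endpoints n \<subseteq> K"
  by (auto simp: level_endpoints_eq left_in_K right_in_K)

lemma endpoints_add_subset: "endpoints n \<subseteq> endpoints (n + k)"
proof
  fix x assume "x \<in> endpoints n"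
  then obtain \<sigma> where \<sigma>: "\<sigma> \<in> words m n" "x = left \<sigma> \<or> x = left \<sigma> + \<rho> ^ n" by (auto simp: level_endpoints_eq)
  have eq0: "left (\<sigma> @ replicate k 0) = left \<sigma>"
    using left_append[OF \<sigma>(1), of "replicate k 0"] by (simp add: left_replicate_0)
  have "left (\<sigma> @ replicate k 0) \<in> endpoints (n + k)"
    using append_words[OF \<sigma>(1) replicate_words[of 0 m k]] unfolding level_endpoints_eq by blast
  moreover have eqm: "left (\<sigma> @ replicate k m) + \<rho> ^ (n + k) = left \<sigma> + \<rho> ^ n"
    using left_append[OF \<sigma>(1), of "replicate k m"] by (simp add: left_replicate_m algebra_simps power_add)
  moreover have "left (\<sigma> @ replicate k m) + \<rho> ^ (n + k) \<in> endpoints (n + k)"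
    using append_words[OF \<sigma>(1) replicate_words[of m m k]] unfolding level_endpoints_eq by blast
  ultimately show "x \<in> endpoints (n + k)" using \<sigma>(2) unfolding eq0 eqm by blast
qed

lemma endpoints_mono: "k \<le> n \<Longrightarrow> endpoints k \<subseteq> endpoints n"
  using endpoints_add_subset[of k "n - k"] by simp

lemma endpoints_0: "endpoints 0 = {0, 1}" by (simp add: level_endpoints_eq)

lemma zero_one_in_endpoints: "0 \<in> endpoints n" "1 \<in> endpoints n"
  using endpoints_mono[of 0 n] by (auto simp: endpoints_0)

lemma rho_power_in_K: "\<rho> ^ n \<in> K" "1 - \<rho> ^ n \<in> K"
  using right_in_K[OF replicate_words[of 0 m n]] left_in_K[OF replicate_words[of m m n]]
  by (simp_all add: left_replicate_0 left_replicate_m)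

text \<open>The powers \<rho>^k lie in \<open>K\<close>, as do their mirror images 1 - \<rho>^k.
  Scaled into a cell they give points of \<open>K\<close> arbitrarily close to either end that avoid
  a finite set of endpoints.\<close>

lemma K_accumulates_at_0:
  assumes "0 < e" "finite A" obtains k where "0 < k" "\<rho> ^ k < e" "\<rho> ^ k \<notin> A"
proof -
  obtain N where N: "\<rho> ^ N < e" using rho_power_less assms(1) by blast
  have "inj (\<lambda>k. \<rho> ^ (N + Suc k))"
  proof (rule linorder_injI)
    fix i j :: nat assume "i < j"
    then have "\<rho> ^ (N + Suc j) < \<rho> ^ (N + Suc i)"
      using rho_pos rho_less_1 by (intro power_strict_decreasing) auto
    then show "\<rho> ^ (N + Suc i) \<noteq> \<rho> ^ (N + Suc j)" by (rule less_imp_neq[THEN not_sym])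
  qed
  then have "\<not> range (\<lambda>k. \<rho> ^ (N + Suc k)) \<subseteq> A"
    using finite_subset[OF _ assms(2)] finite_imageD[of _ UNIV] infinite_UNIV_nat by blast
  then obtain k where k: "\<rho> ^ (N + Suc k) \<notin> A" by blast
  have "\<rho> ^ (N + Suc k) \<le> \<rho> ^ N" using rho_pos rho_less_1 by (intro power_decreasing) auto
  then show ?thesis using N k by (intro that[of "N + Suc k"]) auto
qed

text \<open>Level 0 also obeys the general rule, since \<rho> is a point of \<open>K\<close> inside
  (0,1); later proofs need no separate case for it.\<close>

lemma net_iff: "(a, b) \<in> net n \<longleftrightarrow> a \<in> endpoints n \<and> b \<in> endpoints n \<and> a < b \<and>
    {a<..<b} \<inter> endpoints n = {} \<and> {a<..<b} \<inter> K \<noteq> {}"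
proof (cases "n = 0")
  case True
  have "\<rho> \<in> {0<..<1} \<inter> K" using rho_pos rho_less_1 rho_power_in_K(1)[of 1] by simp
  then show ?thesis using True by (auto simp: net_intervals_def endpoints_0)
qed (simp add: net_intervals_def)

lemma net_less: "\<Delta> \<in> net n \<Longrightarrow> fst \<Delta> < snd \<Delta>"
  by (cases \<Delta>) (simp add: net_iff)

lemma endpoint_outside_net:
  assumes "\<Delta> \<in> net n" "e \<in> endpoints k" "k \<le> n"
  shows "e \<le> fst \<Delta> \<or> snd \<Delta> \<le> e"
proof -
  have "e \<in> endpoints n" using assms endpoints_mono by blast
  moreover have "{fst \<Delta><..<snd \<Delta>} \<inter> endpoints n = {}"
    using assms(1) net_iff[of "fst \<Delta>" "snd \<Delta>" n] by simp
  ultimately have "e \<notin> {fst \<Delta><..<snd \<Delta>}" by blast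
  then show ?thesis by auto
qed

lemma net_endpoints: "\<Delta> \<in> net n \<Longrightarrow> fst \<Delta> \<in> endpoints n" "\<Delta> \<in> net n \<Longrightarrow> snd \<Delta> \<in> endpoints n"
  by (cases \<Delta>, simp add: net_iff)+

lemma net_K_point: assumes "\<Delta> \<in> net n" obtains x where "x \<in> K" "fst \<Delta> < x" "x < snd \<Delta>" "x \<notin> endpoints n"
proof -
  have *: "{fst \<Delta><..<snd \<Delta>} \<inter> endpoints n = {}" "{fst \<Delta><..<snd \<Delta>} \<inter> K \<noteq> {}"
    using assms net_iff[of "fst \<Delta>" "snd \<Delta>" n] by simp_all
  then obtain x where "x \<in> K" "x \<in> {fst \<Delta><..<snd \<Delta>}" by blast
  moreover from this have "x \<notin> endpoints n" using *(1) by blast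
  ultimately show ?thesis using that by simp
qed

lemma net_around:
  assumes "x \<in> K" "x \<notin> endpoints n"
  obtains \<Delta> where "\<Delta> \<in> net n" "fst \<Delta> < x" "x < snd \<Delta>"
proof -
  define L where "L = {e \<in> endpoints n. e < x}"
  define R where "R = {e \<in> endpoints n. x < e}"
  have "0 < x" "x < 1" using assms zero_one_in_endpoints[of n] K_subset by (force simp: less_le)+
  then have L: "finite L" "L \<noteq> {}" and R: "finite R" "R \<noteq> {}"
    using finite_endpoints[of n] zero_one_in_endpoints[of n] by (auto simp: L_def R_def)
  have "Max L \<in> L" "Min R \<in> R" using Max_in[OF L] Min_in[OF R] by auto
  then have in_E: "Max L \<in> endpoints n" "Min R \<in> endpoints n" and x: "Max L < x" "x < Min R"
    by (auto simp: L_def R_def)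
  have "{Max L<..<Min R} \<inter> endpoints n = {}"
  proof (rule equals0I)
    fix e assume e: "e \<in> {Max L<..<Min R} \<inter> endpoints n"
    then have "e \<noteq> x" using assms(2) by blast
    then have "e \<in> L \<or> e \<in> R" using e by (auto simp: L_def R_def)
    then show False using Max_ge[OF L(1), of e] Min_le[OF R(1), of e] e by auto
  qed
  moreover have "x \<in> {Max L<..<Min R} \<inter> K" using x assms(1) by simp
  then have "{Max L<..<Min R} \<inter> K \<noteq> {}" by blast
  ultimately have "(Max L, Min R) \<in> net n" using in_E less_trans[OF x] by (simp add: net_iff)
  then show ?thesis using that[of "(Max L, Min R)"] x by simp
qed

lemma subcell_bounds:
  assumes "l \<le> m" shows "0 \<le> \<rho> ^ n * d l" "\<rho> ^ n * d l + \<rho> ^ Suc n \<le> \<rho> ^ n"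
proof -
  show "0 \<le> \<rho> ^ n * d l" using d_nonneg[OF assms] rho_pos by simp
  have "\<rho> ^ n * (d l + \<rho>) \<le> \<rho> ^ n * 1"
    using d_le[OF assms] d_m rho_pos by (intro mult_left_mono) auto
  then show "\<rho> ^ n * d l + \<rho> ^ Suc n \<le> \<rho> ^ n" by (simp add: algebra_simps)
qed

text \<open>Endpoints of coarser levels persist at finer levels, so a net interval has none inside:
  a cell that overlaps it must contain it.\<close>

lemma cell_of_net:
  assumes "\<Delta> \<in> net n" "\<sigma> \<in> words m k" "k \<le> n" "left \<sigma> < snd \<Delta>" "fst \<Delta> < left \<sigma> + \<rho> ^ k"
  shows "left \<sigma> \<le> fst \<Delta>" "snd \<Delta> \<le> left \<sigma> + \<rho> ^ k"
proof -
  have "left \<sigma> \<in> endpoints k" "left \<sigma> + \<rho> ^ k \<in> endpoints k"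
    using assms(2) by (auto simp: level_endpoints_eq)
  then show "left \<sigma> \<le> fst \<Delta>" "snd \<Delta> \<le> left \<sigma> + \<rho> ^ k"
    using endpoint_outside_net[OF assms(1) _ assms(3)] assms(4,5) by (meson not_le)+
qed

text \<open>A small power of \<rho>, scaled into the cell, is a point of \<open>K\<close> that is no
  endpoint; the net interval around it cannot leave the cell.\<close>

lemma net_in_cell:
  assumes "\<sigma> \<in> words m n"
  obtains \<Delta> where "\<Delta> \<in> net n" "left \<sigma> \<le> fst \<Delta>" "snd \<Delta> \<le> left \<sigma> + \<rho> ^ n"
proof -
  obtain k where k: "0 < k" "\<rho> ^ k < 1" "\<rho> ^ k \<notin> (\<lambda>x. (x - left \<sigma>) / \<rho> ^ n) ` endpoints n"
    by (rule K_accumulates_at_0[of 1 "(\<lambda>x. (x - left \<sigma>) / \<rho> ^ n) ` endpoints n"]) (auto simp: finite_endpoints)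
  define x where "x = left \<sigma> + \<rho> ^ n * \<rho> ^ k"
  have "x \<in> K" unfolding x_def using ifs_word_in_K[OF assms rho_power_in_K(1), of k] unfolding ifs_word_eq[OF assms, of "\<rho> ^ k"] .
  moreover have "x \<notin> endpoints n"
  proof
    assume "x \<in> endpoints n"
    then have "(x - left \<sigma>) / \<rho> ^ n \<in> (\<lambda>x. (x - left \<sigma>) / \<rho> ^ n) ` endpoints n" by (rule imageI)
    then show False using k(3) rho_pos by (simp add: x_def)
  qed
  ultimately obtain \<Delta> where \<Delta>: "\<Delta> \<in> net n" "fst \<Delta> < x" "x < snd \<Delta>" by (rule net_around)
  have "left \<sigma> < x" "x < left \<sigma> + \<rho> ^ n" using k(2) rho_pos by (simp_all add: x_def)
  moreover have "left \<sigma> \<in> endpoints n" "left \<sigma> + \<rho> ^ n \<in> endpoints n"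
    using assms by (auto simp: level_endpoints_eq)
  ultimately have "left \<sigma> \<le> fst \<Delta>" "snd \<Delta> \<le> left \<sigma> + \<rho> ^ n"
    using endpoint_outside_net[OF \<Delta>(1) _ order_refl] \<Delta>(2,3) by (meson less_trans not_le)+
  then show ?thesis using that \<Delta>(1) by blast
qed

lemma cell_in_net:
  assumes "\<Delta> \<in> net n"
  obtains k \<omega> where "n \<le> k" "\<omega> \<in> words m k" "fst \<Delta> \<le> left \<omega>" "left \<omega> + \<rho> ^ k \<le> snd \<Delta>"
proof -
  obtain x where x: "x \<in> K" "fst \<Delta> < x" "x < snd \<Delta>" using net_K_point[OF assms] by blast
  obtain N where N: "\<rho> ^ N < min (x - fst \<Delta>) (snd \<Delta> - x)"
    using rho_power_less[of "min (x - fst \<Delta>) (snd \<Delta> - x)"] x by auto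
  obtain \<omega> y where \<omega>: "\<omega> \<in> words m (N + n)" "y \<in> K" "x = left \<omega> + \<rho> ^ (N + n) * y"
    using K_word_cases[OF x(1)] by blast
  have "0 \<le> y" "y \<le> 1" using \<omega>(2) K_subset by auto
  then have "left \<omega> \<le> x" "x \<le> left \<omega> + \<rho> ^ (N + n)"
    using \<omega>(3) rho_pos by (simp_all add: mult_left_le)
  moreover have "\<rho> ^ (N + n) \<le> \<rho> ^ N" using rho_pos rho_less_1 by (intro power_decreasing) auto
  ultimately show ?thesis using \<omega>(1) N by (intro that[of "N + n" \<omega>]) auto
qed

section \<open>Nesting of net intervals and the cells covering them\<close>

lemma sub_interval_iff: "fst \<Delta> < snd \<Delta> \<Longrightarrow> sub_interval \<Delta> P \<longleftrightarrow> fst P \<le> fst \<Delta> \<and> snd \<Delta> \<le> snd P"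
  by (simp add: sub_interval_def)

lemma net_sub_interval:
  assumes "\<Delta> \<in> net n" "P \<in> net k" "k \<le> n" "fst P < snd \<Delta>" "fst \<Delta> < snd P"
  shows "sub_interval \<Delta> P"
  using endpoint_outside_net[OF assms(1) net_endpoints(1)[OF assms(2)] assms(3)]
    endpoint_outside_net[OF assms(1) net_endpoints(2)[OF assms(2)] assms(3)] assms(4,5) net_less[OF assms(1)]
  by (auto simp: sub_interval_iff)

lemma net_ancestor:
  assumes "\<Delta> \<in> net n" "k \<le> n" obtains P where "P \<in> net k" "sub_interval \<Delta> P"
proof -
  obtain x where x: "x \<in> K" "fst \<Delta> < x" "x < snd \<Delta>" "x \<notin> endpoints n" using net_K_point[OF assms(1)] .
  then have "x \<notin> endpoints k" using endpoints_mono[OF assms(2)] by blast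
  with x(1) obtain P where P: "P \<in> net k" "fst P < x" "x < snd P" by (rule net_around)
  have "sub_interval \<Delta> P"
    by (rule net_sub_interval[OF assms(1) P(1) assms(2)]) (use P(2,3) x in linarith)+
  then show ?thesis using that P(1) by blast
qed

lemma net_sub_unique:
  assumes "P \<in> net k" "P' \<in> net k" "fst \<Delta> < snd \<Delta>" "sub_interval \<Delta> P" "sub_interval \<Delta> P'"
  shows "P = P'"
proof -
  have "fst P < snd P'" "fst P' < snd P" using assms(3-5) by (auto simp: sub_interval_iff)
  then have "sub_interval P P'" "sub_interval P' P"
    using net_sub_interval[OF assms(1,2)] net_sub_interval[OF assms(2,1)] by auto
  then show ?thesis using net_less[OF assms(1)] net_less[OF assms(2)]
    by (intro prod_eqI) (auto simp: sub_interval_iff)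
qed

lemma parent_eq:
  assumes "\<Delta> \<in> net (Suc n)" "P \<in> net n" "sub_interval \<Delta> P"
  shows "parent m \<rho> d K (Suc n) \<Delta> = P"
  unfolding parent_def diff_Suc_1
proof (rule the_equality)
  fix Q assume "Q \<in> net n \<and> sub_interval \<Delta> Q"
  then show "Q = P" using net_sub_unique[OF _ assms(2) net_less[OF assms(1)] _ assms(3)] by blast
qed (use assms in blast)

lemma net_intermediate:
  assumes "\<Delta> \<in> net n" "P \<in> net k" "sub_interval \<Delta> P" "k \<le> l" "l \<le> n"
  obtains Q where "Q \<in> net l" "sub_interval \<Delta> Q" "sub_interval Q P"
proof -
  obtain Q where Q: "Q \<in> net l" "sub_interval \<Delta> Q" by (rule net_ancestor[OF assms(1,5)])
  have "sub_interval Q P"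
    using Q(2) assms(3) net_less[OF assms(1)]
    by (intro net_sub_interval[OF Q(1) assms(2,4)]) (auto simp: sub_interval_iff)
  then show ?thesis using that Q by blast
qed

text \<open>Words are kept instead of normalized offsets so that probabilities can be summed; the
  distinct left endpoints correspond one to one to the neighbours.\<close>

definition covers :: "nat \<Rightarrow> real \<times> real \<Rightarrow> nat list set" where
  "covers n \<Delta> = {\<sigma> \<in> words m n. left \<sigma> \<le> fst \<Delta> \<and> snd \<Delta> \<le> left \<sigma> + \<rho> ^ n}"

lemma finite_covers: "finite (covers n \<Delta>)" by (simp add: covers_def)

lemma neighbour_set_eq:
  assumes "fst \<Delta> < snd \<Delta>"
  shows "nbrs n \<Delta> = sorted_list_of_set ((\<lambda>v. (fst \<Delta> - v) / \<rho> ^ n) ` left ` covers n \<Delta>)"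
proof -
  have "ifs_word \<rho> d \<sigma> ` {0..1} = {left \<sigma>..left \<sigma> + \<rho> ^ n}" if "\<sigma> \<in> words m n" for \<sigma>
  proof -
    have "ifs_word \<rho> d \<sigma> ` {0..1} = (\<lambda>x. \<rho> ^ n * x + left \<sigma>) ` {0..1}"
      by (intro image_cong refl) (rule trans[OF ifs_word_eq[OF that] add.commute])
    also have "\<dots> = {left \<sigma>..left \<sigma> + \<rho> ^ n}"
      using image_affinity_atLeastAtMost[of "\<rho> ^ n" "left \<sigma>" 0 1] rho_pos by (simp add: add.commute)
    finally show ?thesis .
  qed
  then have "{(fst \<Delta> - left \<sigma>) / \<rho> ^ n |\<sigma>. \<sigma> \<in> words m n \<and> {fst \<Delta>..snd \<Delta>} \<subseteq> ifs_word \<rho> d \<sigma> ` {0..1}}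
      = (\<lambda>v. (fst \<Delta> - v) / \<rho> ^ n) ` left ` covers n \<Delta>"
    using assms by (auto simp: covers_def)
  then show ?thesis by (simp add: neighbour_set_def)
qed

lemma set_neighbour_set:
  "\<Delta> \<in> net n \<Longrightarrow> set (nbrs n \<Delta>) = (\<lambda>v. (fst \<Delta> - v) / \<rho> ^ n) ` left ` covers n \<Delta>"
  by (simp add: neighbour_set_eq net_less finite_covers)

lemma neighbour_iff:
  assumes "\<Delta> \<in> net n"
  shows "y \<in> set (nbrs n \<Delta>) \<longleftrightarrow> (\<exists>\<sigma>\<in>covers n \<Delta>. left \<sigma> = fst \<Delta> - \<rho> ^ n * y)"
  using rho_pos by (auto simp: set_neighbour_set[OF assms] image_iff field_simps)

lemma distinct_neighbour_set: "distinct (nbrs n \<Delta>)"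
  by (simp add: neighbour_set_def)

section \<open>Children of a net interval\<close>

text \<open>All data of the children of a net interval \<open>P = [a, b]\<close> are expressed in the coordinate
  \<open>z = (x - a) / \<rho> ^ n\<close>, in which they depend only on the normalized length and on the neighbour set
  of \<open>P\<close>.\<close>

definition child_endpoint :: "real set \<Rightarrow> real \<Rightarrow> bool" where
  "child_endpoint V z \<longleftrightarrow> (\<exists>y\<in>V. \<exists>l\<le>m. z = d l - y \<or> z = d l - y + \<rho>)"

text \<open>The cell of a neighbour \<open>y\<close> starts at coordinate \<open>- y\<close>, so a
  point with coordinate \<open>z\<close> has position \<open>z + y\<close> in it; the last clause
  thus says that the open interval meets \<open>K\<close>. The ends 0 and \<open>L\<close> are
  always allowed, because endpoints of the parent remain endpoints.\<close>

definition child_coords :: "real \<Rightarrow> real set \<Rightarrow> real \<Rightarrow> real \<Rightarrow> bool" where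
  "child_coords L V s t \<longleftrightarrow> 0 \<le> s \<and> s < t \<and> t \<le> L \<and> (s = 0 \<or> child_endpoint V s) \<and> (t = L \<or> child_endpoint V t) \<and>
     (\<forall>z. s < z \<and> z < t \<longrightarrow> \<not> child_endpoint V z) \<and> (\<exists>z y. s < z \<and> z < t \<and> y \<in> V \<and> z + y \<in> K)"

definition child_nbrs :: "real set \<Rightarrow> real \<Rightarrow> real \<Rightarrow> real set" where
  "child_nbrs V s t = {(s - (d l - y)) / \<rho> | y l. y \<in> V \<and> l \<le> m \<and> d l - y \<le> s \<and> t \<le> d l - y + \<rho>}"

definition child_position :: "real \<Rightarrow> real set \<Rightarrow> real \<Rightarrow> real \<Rightarrow> nat" where
  "child_position L V s t = card {(s', t'). child_coords L V s' t' \<and> t' - s' = t - s \<and> s' \<le> s}"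

definition child_interval :: "nat \<Rightarrow> real \<times> real \<Rightarrow> real \<Rightarrow> real \<Rightarrow> real \<times> real" where
  "child_interval n P s t = (fst P + \<rho> ^ n * s, fst P + \<rho> ^ n * t)"

lemma child_interval_sel [simp]:
  "fst (child_interval n P s t) = fst P + \<rho> ^ n * s" "snd (child_interval n P s t) = fst P + \<rho> ^ n * t"
  by (simp_all add: child_interval_def)

lemma snd_eq_norm_length: "snd P = fst P + \<rho> ^ n * norm_length \<rho> n P"
  using rho_pos by (simp add: norm_length_def)

text \<open>An endpoint inside \<open>P\<close> belongs to a subcell of a cell overlapping
  \<open>P\<close>, and such a cell covers \<open>P\<close>. This is why neighbours suffice to
  describe the next level.\<close>

lemma endpoint_in_net_iff:
  assumes P: "P \<in> net n" and z: "0 < z" "z < norm_length \<rho> n P"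
  shows "fst P + \<rho> ^ n * z \<in> endpoints (Suc n) \<longleftrightarrow> child_endpoint (set (nbrs n P)) z"
proof -
  let ?x = "fst P + \<rho> ^ n * z"
  have x: "fst P < ?x" "?x < snd P"
    using z rho_pos by (simp_all add: snd_eq_norm_length[of P n])
  have "?x \<in> endpoints (Suc n) \<longleftrightarrow>
      (\<exists>\<sigma>\<in>words m n. \<exists>l\<le>m. ?x = left \<sigma> + \<rho> ^ n * d l \<or> ?x = left \<sigma> + \<rho> ^ n * d l + \<rho> ^ Suc n)"
  proof
    assume "?x \<in> endpoints (Suc n)"
    then obtain \<omega> where \<omega>: "\<omega> \<in> words m (Suc n)" "?x = left \<omega> \<or> ?x = left \<omega> + \<rho> ^ Suc n"
      unfolding level_endpoints_eq by blast
    obtain \<sigma> l where \<sigma>: "\<sigma> \<in> words m n" "l \<le> m" "\<omega> = \<sigma> @ [l]" using \<omega>(1) by (rule words_SucE)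
    then show "\<exists>\<sigma>\<in>words m n. \<exists>l\<le>m. ?x = left \<sigma> + \<rho> ^ n * d l \<or> ?x = left \<sigma> + \<rho> ^ n * d l + \<rho> ^ Suc n"
      using \<omega>(2) left_snoc[OF \<sigma>(1), of l] by (intro bexI[of _ \<sigma>] exI[of _ l]) simp_all
  next
    assume "\<exists>\<sigma>\<in>words m n. \<exists>l\<le>m. ?x = left \<sigma> + \<rho> ^ n * d l \<or> ?x = left \<sigma> + \<rho> ^ n * d l + \<rho> ^ Suc n"
    then obtain \<sigma> l where \<sigma>: "\<sigma> \<in> words m n" "l \<le> m"
      "?x = left \<sigma> + \<rho> ^ n * d l \<or> ?x = left \<sigma> + \<rho> ^ n * d l + \<rho> ^ Suc n" by blast
    then have "?x = left (\<sigma> @ [l]) \<or> ?x = left (\<sigma> @ [l]) + \<rho> ^ Suc n" using left_snoc[OF \<sigma>(1)] by metis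
    then show "?x \<in> endpoints (Suc n)" using snoc_words[OF \<sigma>(1,2)] unfolding level_endpoints_eq by blast
  qed
  also have "\<dots> \<longleftrightarrow> (\<exists>\<sigma>\<in>covers n P. \<exists>l\<le>m. ?x = left \<sigma> + \<rho> ^ n * d l \<or> ?x = left \<sigma> + \<rho> ^ n * d l + \<rho> ^ Suc n)"
  proof -
    have "\<sigma> \<in> covers n P" if \<sigma>: "\<sigma> \<in> words m n" "l \<le> m"
      "?x = left \<sigma> + \<rho> ^ n * d l \<or> ?x = left \<sigma> + \<rho> ^ n * d l + \<rho> ^ Suc n" for \<sigma> l
    proof -
      have "0 < \<rho> ^ Suc n" by (rule rho_power_pos)
      with subcell_bounds[OF \<sigma>(2), of n] have "left \<sigma> \<le> ?x" "?x \<le> left \<sigma> + \<rho> ^ n" using \<sigma>(3) by linarith+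
      then show ?thesis
        using cell_of_net[OF P \<sigma>(1) order_refl] x \<sigma>(1) by (simp add: covers_def)
    qed
    then show ?thesis unfolding covers_def by blast
  qed
  also have "\<dots> \<longleftrightarrow> child_endpoint (set (nbrs n P)) z"
  proof -
    have "fst P + \<rho> ^ n * z = (fst P - \<rho> ^ n * y) + \<rho> ^ n * c \<longleftrightarrow> z = c - y" for y c
    proof -
      have "fst P + \<rho> ^ n * z = (fst P - \<rho> ^ n * y) + \<rho> ^ n * c \<longleftrightarrow> \<rho> ^ n * z = \<rho> ^ n * (c - y)"
        by (auto simp: algebra_simps)
      then show ?thesis using rho_pos by simp
    qed
    note eq = this
    have eq2: "fst P + \<rho> ^ n * z = (fst P - \<rho> ^ n * y) + \<rho> ^ n * c + \<rho> ^ Suc n \<longleftrightarrow> z = c - y + \<rho>" for y c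
      using eq[of y "c + \<rho>"] by (simp add: algebra_simps)
    have "left \<sigma> = fst P - \<rho> ^ n * ((fst P - left \<sigma>) / \<rho> ^ n)" for \<sigma> using rho_pos by simp
    then have "(\<exists>\<sigma>\<in>covers n P. Q (left \<sigma>)) \<longleftrightarrow> (\<exists>y\<in>set (nbrs n P). Q (fst P - \<rho> ^ n * y))" for Q
      unfolding set_neighbour_set[OF P] by auto
    note this[of "\<lambda>v. \<exists>l\<le>m. ?x = v + \<rho> ^ n * d l \<or> ?x = v + \<rho> ^ n * d l + \<rho> ^ Suc n"]
    then show ?thesis unfolding child_endpoint_def eq eq2 .
  qed
  finally show ?thesis .
qed

text \<open>The same localization for \<open>K\<close>: any cell containing an interior point of
  \<open>P\<close> covers \<open>P\<close>.\<close>

lemma K_in_net_iff: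
  assumes P: "P \<in> net n" and z: "0 < z" "z < norm_length \<rho> n P"
  shows "fst P + \<rho> ^ n * z \<in> K \<longleftrightarrow> (\<exists>y\<in>set (nbrs n P). z + y \<in> K)"
proof
  let ?x = "fst P + \<rho> ^ n * z"
  have x: "fst P < ?x" "?x < snd P"
    using z rho_pos by (simp_all add: snd_eq_norm_length[of P n])
  assume "?x \<in> K"
  then obtain \<sigma> y where \<sigma>: "\<sigma> \<in> words m n" "y \<in> K" "?x = left \<sigma> + \<rho> ^ n * y" by (rule K_word_cases)
  have "0 \<le> y" "y \<le> 1" using \<sigma>(2) K_subset by auto
  then have "left \<sigma> \<le> ?x" "?x \<le> left \<sigma> + \<rho> ^ n" unfolding \<sigma>(3) using rho_pos by (simp_all add: mult_left_le)
  then have "\<sigma> \<in> covers n P" using cell_of_net[OF P \<sigma>(1) order_refl] x \<sigma>(1) by (simp add: covers_def)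
  moreover have "left \<sigma> = fst P - \<rho> ^ n * (y - z)" using \<sigma>(3) by (simp add: algebra_simps)
  ultimately have "y - z \<in> set (nbrs n P)" using neighbour_iff[OF P] by blast
  then show "\<exists>y\<in>set (nbrs n P). z + y \<in> K" using \<sigma>(2) by (intro bexI[of _ "y - z"]) auto
next
  assume "\<exists>y\<in>set (nbrs n P). z + y \<in> K"
  then obtain y \<sigma> where "z + y \<in> K" and \<sigma>: "\<sigma> \<in> words m n" "left \<sigma> = fst P - \<rho> ^ n * y"
    by (auto simp: neighbour_iff[OF P] covers_def)
  from ifs_word_in_K[OF \<sigma>(1) \<open>z + y \<in> K\<close>] have "left \<sigma> + \<rho> ^ n * (z + y) \<in> K"
    unfolding ifs_word_eq[OF \<sigma>(1), of "z + y"] .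
  then show "fst P + \<rho> ^ n * z \<in> K" using \<sigma>(2) by (simp add: algebra_simps)
qed

lemma child_interval_iff:
  assumes P: "P \<in> net n"
  shows "child_interval n P s t \<in> net (Suc n) \<and> sub_interval (child_interval n P s t) P \<longleftrightarrow>
    child_coords (norm_length \<rho> n P) (set (nbrs n P)) s t"
proof -
  let ?L = "norm_length \<rho> n P" and ?V = "set (nbrs n P)" and ?a = "fst P"
  let ?f = "\<lambda>z. ?a + \<rho> ^ n * z"
  show ?thesis
  proof (cases "0 \<le> s \<and> s < t \<and> t \<le> ?L")
    case False
    have "?f s < ?f t \<longleftrightarrow> s < t" "?a \<le> ?f s \<longleftrightarrow> 0 \<le> s" "?f t \<le> snd P \<longleftrightarrow> t \<le> ?L"
      using rho_pos mult_le_cancel_left_pos[OF rho_power_pos, of n 0 s] by (simp_all add: snd_eq_norm_length[of P n])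
    then have "\<not> (child_interval n P s t \<in> net (Suc n) \<and> sub_interval (child_interval n P s t) P)"
      using False net_less[of "child_interval n P s t" "Suc n"] by (auto simp: sub_interval_iff)
    then show ?thesis using False by (auto simp: child_coords_def)
  next
    case True
    have "sub_interval (child_interval n P s t) P"
      using True rho_pos by (simp add: sub_interval_iff snd_eq_norm_length[of P n])
    moreover have "?f s \<in> endpoints (Suc n) \<longleftrightarrow> s = 0 \<or> child_endpoint ?V s"
    proof (cases "s = 0")
      case True then show ?thesis using net_endpoints(1)[OF P] endpoints_mono[of n "Suc n"] by auto
    next
      case False then show ?thesis using endpoint_in_net_iff[OF P, of s] True by auto
    qed
    moreover have "?f t \<in> endpoints (Suc n) \<longleftrightarrow> t = ?L \<or> child_endpoint ?V t"
    proof (cases "t = ?L")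
      case True then show ?thesis
        using net_endpoints(2)[OF P] endpoints_mono[of n "Suc n"] by (auto simp: snd_eq_norm_length[of P n])
    next
      case False then show ?thesis using endpoint_in_net_iff[OF P, of t] True by auto
    qed
    moreover have img: "{?f s<..<?f t} = ?f ` {s<..<t}"
    proof
      show "{?f s<..<?f t} \<subseteq> ?f ` {s<..<t}"
      proof
        fix x assume "x \<in> {?f s<..<?f t}"
        then show "x \<in> ?f ` {s<..<t}"
          using rho_pos by (intro image_eqI[of _ _ "(x - ?a) / \<rho> ^ n"]) (auto simp: field_simps)
      qed
    qed (use rho_pos in auto)
    have img_disjoint: "?f ` {s<..<t} \<inter> X = {} \<longleftrightarrow> (\<forall>z. s < z \<and> z < t \<longrightarrow> ?f z \<notin> X)" for X
    proof -
      have "?f ` {s<..<t} \<inter> X = {} \<longleftrightarrow> (\<forall>z\<in>{s<..<t}. ?f z \<notin> X)" by blast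
      then show ?thesis by (simp add: Ball_def)
    qed
    have "{?f s<..<?f t} \<inter> endpoints (Suc n) = {} \<longleftrightarrow> (\<forall>z. s < z \<and> z < t \<longrightarrow> \<not> child_endpoint ?V z)"
    proof -
      have "?f z \<in> endpoints (Suc n) \<longleftrightarrow> child_endpoint ?V z" if "s < z" "z < t" for z
        using that True by (intro endpoint_in_net_iff[OF P]) auto
      then show ?thesis unfolding img img_disjoint by blast
    qed
    moreover have "{?f s<..<?f t} \<inter> K \<noteq> {} \<longleftrightarrow> (\<exists>z y. s < z \<and> z < t \<and> y \<in> ?V \<and> z + y \<in> K)"
    proof -
      have "?f z \<in> K \<longleftrightarrow> (\<exists>y\<in>?V. z + y \<in> K)" if "s < z" "z < t" for z
        using that True by (intro K_in_net_iff[OF P]) auto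
      then show ?thesis unfolding img img_disjoint by blast
    qed
    moreover have "?f s < ?f t" using True rho_pos by simp
    ultimately show ?thesis using True
      by (simp add: child_coords_def child_interval_def net_iff)
  qed
qed

lemma child_obtain:
  assumes "P \<in> net n" "\<Delta> \<in> net (Suc n)" "sub_interval \<Delta> P"
  obtains s t where "child_coords (norm_length \<rho> n P) (set (nbrs n P)) s t" "\<Delta> = child_interval n P s t"
proof -
  have "\<Delta> = child_interval n P ((fst \<Delta> - fst P) / \<rho> ^ n) ((snd \<Delta> - fst P) / \<rho> ^ n)"
    using rho_pos by (cases \<Delta>) (simp add: child_interval_def)
  then show ?thesis using child_interval_iff[OF assms(1)] assms(2,3) that by metis
qed

text \<open>Deleting the last letter of a word covering a child leaves a word whose cell overlaps
  \<open>P\<close> and hence covers it, so the covering words of the child are one-letter extensions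
  of those of \<open>P\<close>.\<close>

lemma set_nbrs_child:
  assumes P: "P \<in> net n" and c: "child_coords (norm_length \<rho> n P) (set (nbrs n P)) s t"
  shows "set (nbrs (Suc n) (child_interval n P s t)) = child_nbrs (set (nbrs n P)) s t"
proof -
  let ?D = "child_interval n P s t"
  have D: "?D \<in> net (Suc n)" "sub_interval ?D P" using child_interval_iff[OF P] c by auto
  have sub: "fst P \<le> fst ?D" "snd ?D \<le> snd P" using D(2) net_less[OF D(1)] by (simp_all add: sub_interval_iff del: child_interval_sel)
  have "left ` covers (Suc n) ?D = {v + \<rho> ^ n * d l | v l. v \<in> left ` covers n P \<and> l \<le> m \<and>
      v + \<rho> ^ n * d l \<le> fst ?D \<and> snd ?D \<le> v + \<rho> ^ n * d l + \<rho> ^ Suc n}" (is "?A = ?B")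
  proof
    show "?A \<subseteq> ?B"
    proof
      fix u assume "u \<in> ?A"
      then obtain \<omega> where \<omega>: "\<omega> \<in> words m (Suc n)" "u = left \<omega>" "left \<omega> \<le> fst ?D" "snd ?D \<le> left \<omega> + \<rho> ^ Suc n"
        unfolding covers_def by blast
      obtain \<sigma> l where \<sigma>: "\<sigma> \<in> words m n" "l \<le> m" "\<omega> = \<sigma> @ [l]" using \<omega>(1) by (rule words_SucE)
      have u: "u = left \<sigma> + \<rho> ^ n * d l" using \<omega>(2) \<sigma> left_snoc by metis
      from subcell_bounds[OF \<sigma>(2), of n] have "left \<sigma> \<le> fst ?D" "snd ?D \<le> left \<sigma> + \<rho> ^ n" using \<omega>(2,3,4) u by linarith+
      then have "left \<sigma> < snd P" "fst P < left \<sigma> + \<rho> ^ n" using sub net_less[OF D(1)] by linarith+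
      then have "\<sigma> \<in> covers n P" using cell_of_net[OF P \<sigma>(1) order_refl] \<sigma>(1) by (simp add: covers_def)
      moreover have "u \<le> fst ?D" "snd ?D \<le> u + \<rho> ^ Suc n" using \<omega>(2,3,4) by blast+
      ultimately show "u \<in> ?B" unfolding mem_Collect_eq u using \<sigma>(2)
        by (intro exI[of _ "left \<sigma>"] exI[of _ l]) simp
    qed
    show "?B \<subseteq> ?A"
    proof
      fix u assume "u \<in> ?B"
      then obtain \<sigma> l where \<sigma>: "\<sigma> \<in> words m n" "l \<le> m" "u = left \<sigma> + \<rho> ^ n * d l"
        "u \<le> fst ?D" "snd ?D \<le> u + \<rho> ^ Suc n" unfolding covers_def by blast
      then have "u = left (\<sigma> @ [l])" "\<sigma> @ [l] \<in> words m (Suc n)" by (simp_all add: left_snoc snoc_words)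
      then show "u \<in> ?A" using \<sigma>(4,5) unfolding covers_def by blast
    qed
  qed
  then have "set (nbrs (Suc n) ?D) = (\<lambda>v. (fst ?D - v) / \<rho> ^ Suc n) ` ?B"
    using set_neighbour_set[OF D(1)] by simp
  also have "\<dots> = child_nbrs (set (nbrs n P)) s t"
  proof -
    let ?g = "\<lambda>v. (fst P - v) / \<rho> ^ n" and ?X = "left ` covers n P"
    have *: "v + \<rho> ^ n * c \<le> fst P + \<rho> ^ n * s \<longleftrightarrow> c - (fst P - v) / \<rho> ^ n \<le> s"
      "fst P + \<rho> ^ n * t \<le> v + \<rho> ^ n * c + \<rho> ^ Suc n \<longleftrightarrow> t \<le> c - (fst P - v) / \<rho> ^ n + \<rho>"
      "(fst P + \<rho> ^ n * s - (v + \<rho> ^ n * c)) / \<rho> ^ Suc n = (s - (c - (fst P - v) / \<rho> ^ n)) / \<rho>" for v c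
      using rho_pos by (auto simp: field_simps)
    have "(\<lambda>v. (fst ?D - v) / \<rho> ^ Suc n) ` ?B = {(fst ?D - (v + \<rho> ^ n * d l)) / \<rho> ^ Suc n | v l. v \<in> ?X \<and> l \<le> m \<and>
      v + \<rho> ^ n * d l \<le> fst ?D \<and> snd ?D \<le> v + \<rho> ^ n * d l + \<rho> ^ Suc n}" by blast
    also have "\<dots> = {(s - (d l - ?g v)) / \<rho> | v l. v \<in> ?X \<and> l \<le> m \<and> d l - ?g v \<le> s \<and> t \<le> d l - ?g v + \<rho>}"
      by (simp only: child_interval_sel *)
    also have "\<dots> = child_nbrs (?g ` ?X) s t" unfolding child_nbrs_def by blast
    finally show ?thesis unfolding set_neighbour_set[OF P] .
  qed
  finally show ?thesis .
qed

lemma net_position_child: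
  assumes P: "P \<in> net n" and c: "child_coords (norm_length \<rho> n P) (set (nbrs n P)) s t"
  shows "net_position m \<rho> d K (Suc n) (child_interval n P s t) =
    child_position (norm_length \<rho> n P) (set (nbrs n P)) s t"
proof -
  let ?D = "child_interval n P s t" and ?C = "child_coords (norm_length \<rho> n P) (set (nbrs n P))"
  have D: "?D \<in> net (Suc n)" "sub_interval ?D P" using child_interval_iff[OF P] c by auto
  let ?A = "{\<Delta> \<in> net (Suc n). parent m \<rho> d K (Suc n) \<Delta> = parent m \<rho> d K (Suc n) ?D \<and>
    norm_length \<rho> (Suc n) \<Delta> = norm_length \<rho> (Suc n) ?D \<and> fst \<Delta> \<le> fst ?D}"
  let ?B = "{(s', t'). ?C s' t' \<and> t' - s' = t - s \<and> s' \<le> s}"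
  have len: "norm_length \<rho> (Suc n) (child_interval n P s' t') = (t' - s') / \<rho>" for s' t'
    using rho_pos by (simp add: norm_length_def field_simps)
  have "?A = (\<lambda>(s', t'). child_interval n P s' t') ` ?B"
  proof
    show "?A \<subseteq> (\<lambda>(s', t'). child_interval n P s' t') ` ?B"
    proof
      fix \<Delta> assume \<Delta>: "\<Delta> \<in> ?A"
      obtain P' where P': "P' \<in> net n" "sub_interval \<Delta> P'" using net_ancestor[of \<Delta> "Suc n" n] \<Delta> by auto
      have "P' = P" using parent_eq[OF _ P'] parent_eq[OF D(1) P D(2)] \<Delta> by auto
      then obtain s' t' where st: "?C s' t'" "\<Delta> = child_interval n P s' t'"
        using child_obtain[OF P _ ] P'(2) \<Delta> by blast
      have "norm_length \<rho> (Suc n) \<Delta> = norm_length \<rho> (Suc n) ?D" using \<Delta> by blast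
      then have "t' - s' = t - s" unfolding st(2) len using rho_pos by simp
      moreover have "s' \<le> s" using \<Delta> rho_pos unfolding st(2) by simp
      ultimately show "\<Delta> \<in> (\<lambda>(s', t'). child_interval n P s' t') ` ?B" using st by blast
    qed
    show "(\<lambda>(s', t'). child_interval n P s' t') ` ?B \<subseteq> ?A"
    proof
      fix \<Delta> assume "\<Delta> \<in> (\<lambda>(s', t'). child_interval n P s' t') ` ?B"
      then obtain s' t' where \<Delta>: "\<Delta> = child_interval n P s' t'"
        and st: "?C s' t'" "t' - s' = t - s" "s' \<le> s" by auto
      then have D': "child_interval n P s' t' \<in> net (Suc n)" "sub_interval (child_interval n P s' t') P"
        using child_interval_iff[OF P] by auto
      have "fst (child_interval n P s' t') \<le> fst ?D" using st(3) rho_pos by simp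
      moreover have "norm_length \<rho> (Suc n) (child_interval n P s' t') = norm_length \<rho> (Suc n) ?D"
        unfolding len st(2) ..
      ultimately show "\<Delta> \<in> ?A" unfolding \<Delta>
        using D' parent_eq[OF D'(1) P D'(2)] parent_eq[OF D(1) P D(2)] by simp
    qed
  qed
  moreover have "inj_on (\<lambda>(s', t'). child_interval n P s' t') ?B"
    using rho_pos by (auto simp: inj_on_def child_interval_def)
  ultimately have "card ?A = card ?B" by (simp add: card_image)
  then show ?thesis by (simp only: net_position_def child_position_def)
qed

definition child_char :: "real \<Rightarrow> real set \<Rightarrow> real \<Rightarrow> real \<Rightarrow> char_vec" where
  "child_char L V s t = ((t - s) / \<rho>, sorted_list_of_set (child_nbrs V s t), child_position L V s t)"

text \<open>The position of \<open>P\<close> among its own siblings does not appear on the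
  right-hand side; this is used for similar copies, whose position is not controlled.\<close>

lemma char_vector_child:
  assumes P: "P \<in> net n" and c: "child_coords (norm_length \<rho> n P) (set (nbrs n P)) s t"
  shows "char_vec (Suc n) (child_interval n P s t) = child_char (norm_length \<rho> n P) (set (nbrs n P)) s t"
proof -
  let ?D = "child_interval n P s t"
  have "norm_length \<rho> (Suc n) ?D = (t - s) / \<rho>"
    using rho_pos by (simp add: norm_length_def field_simps)
  moreover have "sorted_list_of_set (set (nbrs (Suc n) ?D)) = nbrs (Suc n) ?D"
    by (simp add: neighbour_set_def)
  ultimately show ?thesis
    using net_position_child[OF P c] set_nbrs_child[OF P c] by (simp add: char_vector_def child_char_def)
qed

lemma finite_child_coords:
  assumes "finite V" shows "finite {(s, t). child_coords L V s t}"
proof -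
  let ?E = "insert 0 (insert L (\<Union>y\<in>V. \<Union>l\<in>{..m}. {d l - y, d l - y + \<rho>}))"
  have "{(s, t). child_coords L V s t} \<subseteq> ?E \<times> ?E"
  proof
    fix p assume "p \<in> {(s, t). child_coords L V s t}"
    then obtain s t where p: "p = (s, t)" and "child_coords L V s t" by auto
    then have "s = 0 \<or> child_endpoint V s" "t = L \<or> child_endpoint V t" by (auto simp: child_coords_def)
    moreover have "z \<in> ?E" if "child_endpoint V z" for z using that by (auto simp: child_endpoint_def)
    ultimately show "p \<in> ?E \<times> ?E" unfolding p by blast
  qed
  then show ?thesis by (rule finite_subset) (use assms in auto)
qed

lemma child_position_less:
  assumes "finite V" "child_coords L V s' t'" "t' - s' = t - s" "s < s'"
  shows "child_position L V s t < child_position L V s' t'"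
  unfolding child_position_def
proof (rule psubset_card_mono)
  show "finite {(s'', t''). child_coords L V s'' t'' \<and> t'' - s'' = t' - s' \<and> s'' \<le> s'}"
    by (rule finite_subset[OF _ finite_child_coords[OF assms(1), of L]]) auto
  have "(s', t') \<notin> {(s'', t''). child_coords L V s'' t'' \<and> t'' - s'' = t - s \<and> s'' \<le> s}" (is "_ \<notin> ?A")
    using assms(4) by simp
  moreover have "(s', t') \<in> {(s'', t''). child_coords L V s'' t'' \<and> t'' - s'' = t' - s' \<and> s'' \<le> s'}" (is "_ \<in> ?B")
    using assms(2) by simp
  moreover have "?A \<subseteq> ?B" using assms(3,4) by auto
  ultimately show "?A \<subset> ?B" by blast
qed

text \<open>Among siblings of equal length the position increases strictly from left to right. So
  the parent data and the characteristic vector of the child locate the child, which makes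
  transition matrices independent of the chosen realization.\<close>

lemma child_char_inject:
  assumes "finite V" "child_coords L V s t" "child_coords L V s' t'" "child_char L V s t = child_char L V s' t'"
  shows "s = s'"
proof -
  have "t - s = t' - s'" "child_position L V s t = child_position L V s' t'"
    using assms(4) rho_pos by (auto simp: child_char_def)
  then show ?thesis
    using child_position_less[OF assms(1,3), of t s] child_position_less[OF assms(1,2), of t' s']
    by (metis less_irrefl linorder_neqE_linordered_idom)
qed

end

section \<open>The essential class\<close>

context equicontractive_ifs begin

abbreviation child :: "char_vec \<Rightarrow> char_vec \<Rightarrow> bool" where "child \<equiv> is_child m \<rho> d K"

lemma char_vec_in [intro]: "\<Delta> \<in> net n \<Longrightarrow> char_vec n \<Delta> \<in> char_vectors m \<rho> d K"
  by (auto simp: char_vectors_def)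

lemma child_in_char_vectors: "child \<alpha> \<beta> \<Longrightarrow> \<beta> \<in> char_vectors m \<rho> d K"
  by (auto simp: is_child_def realizes_def)

lemma child_char_vec:
  "P \<in> net n \<Longrightarrow> \<Delta> \<in> net (Suc n) \<Longrightarrow> sub_interval \<Delta> P \<Longrightarrow> child (char_vec n P) (char_vec (Suc n) \<Delta>)"
  unfolding is_child_def realizes_def by blast

lemma net_self_sub: "\<Delta> \<in> net n \<Longrightarrow> P \<in> net n \<Longrightarrow> sub_interval \<Delta> P \<Longrightarrow> P = \<Delta>"
  by (rule net_sub_unique[of P n \<Delta> \<Delta>]) (auto simp: net_less sub_interval_def)

lemma descendant_reachable:
  "P \<in> net n \<Longrightarrow> \<Delta> \<in> net (n + k) \<Longrightarrow> sub_interval \<Delta> P \<Longrightarrow> child\<^sup>*\<^sup>* (char_vec n P) (char_vec (n + k) \<Delta>)"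
proof (induction k arbitrary: n P)
  case 0
  then have "P = \<Delta>" using net_self_sub by simp
  then show ?case by simp
next
  case (Suc k)
  obtain Q where Q: "Q \<in> net (Suc n)" "sub_interval \<Delta> Q" "sub_interval Q P"
    by (rule net_intermediate[OF Suc.prems(2,1,3), of "Suc n"]) auto
  have "child\<^sup>*\<^sup>* (char_vec (Suc n) Q) (char_vec (n + Suc k) \<Delta>)"
    using Suc.IH[OF Q(1) _ Q(2)] Suc.prems(2) by simp
  with child_char_vec[OF Suc.prems(1) Q(1,3)] show ?case by (rule converse_rtranclp_into_rtranclp)
qed

lemma rtranclp_child_path:
  assumes "child\<^sup>*\<^sup>* \<alpha> \<beta>" "\<alpha> \<in> char_vectors m \<rho> d K"
  shows "\<exists>\<gamma>. admissible_path m \<rho> d K \<gamma> \<and> set \<gamma> \<subseteq> {\<delta>. child\<^sup>*\<^sup>* \<alpha> \<delta>} \<and> hd \<gamma> = \<alpha> \<and> last \<gamma> = \<beta>"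
  using assms(1)
proof (induction rule: rtranclp_induct)
  case base
  then show ?case using assms(2) by (intro exI[of _ "[\<alpha>]"]) (simp add: admissible_path_def)
next
  case (step \<beta> \<beta>')
  then obtain \<gamma> where \<gamma>: "admissible_path m \<rho> d K \<gamma>" "set \<gamma> \<subseteq> {\<delta>. child\<^sup>*\<^sup>* \<alpha> \<delta>}" "hd \<gamma> = \<alpha>" "last \<gamma> = \<beta>"
    by blast
  moreover have "child\<^sup>*\<^sup>* \<alpha> \<beta>'" using step.hyps by (rule rtranclp.rtrancl_into_rtrancl)
  ultimately show ?case
    using step.hyps child_in_char_vectors[OF step.hyps(2)]
    by (intro exI[of _ "\<gamma> @ [\<beta>']"]) (auto simp: admissible_path_def successively_append_iff)
qed

lemma admissible_path_reach:
  assumes "admissible_path m \<rho> d K \<gamma>"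
  shows "child\<^sup>*\<^sup>* (hd \<gamma>) (last \<gamma>)"
proof -
  have "\<gamma> \<noteq> [] \<Longrightarrow> successively child \<gamma> \<Longrightarrow> child\<^sup>*\<^sup>* (hd \<gamma>) (last \<gamma>)"
  proof (induction \<gamma>)
    case (Cons \<alpha> \<gamma>)
    then show ?case
      by (cases \<gamma>) (auto intro: converse_rtranclp_into_rtranclp)
  qed simp
  then show ?thesis using assms by (simp add: admissible_path_def)
qed

lemma closed_under_child_rtranclp:
  assumes "\<And>\<alpha> \<beta>. \<alpha> \<in> S \<Longrightarrow> child \<alpha> \<beta> \<Longrightarrow> \<beta> \<in> S"
  shows "child\<^sup>*\<^sup>* \<alpha> \<beta> \<Longrightarrow> \<alpha> \<in> S \<Longrightarrow> \<beta> \<in> S"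
  by (induction rule: rtranclp_induct) (auto intro: assms)

text \<open>Two states reachable from \<gamma> are joined by way of \<gamma>. Conversely an
  essential class is closed under children, so it contains \<gamma> and all that \<gamma> reaches,
  and its loop property confines it to that set.\<close>

lemma essential_class_eq:
  assumes \<gamma>: "\<gamma> \<in> char_vectors m \<rho> d K" and reach: "\<And>\<alpha>. \<alpha> \<in> char_vectors m \<rho> d K \<Longrightarrow> child\<^sup>*\<^sup>* \<alpha> \<gamma>"
  shows "essential_class m \<rho> d K = {\<beta>. child\<^sup>*\<^sup>* \<gamma> \<beta>}"
  unfolding essential_class_def
proof (rule the_equality)
  let ?S = "{\<beta>. child\<^sup>*\<^sup>* \<gamma> \<beta>}"
  have sub: "?S \<subseteq> char_vectors m \<rho> d K"
  proof
    fix \<beta> assume "\<beta> \<in> ?S"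
    then show "\<beta> \<in> char_vectors m \<rho> d K"
      using closed_under_child_rtranclp[of "char_vectors m \<rho> d K" \<gamma> \<beta>] child_in_char_vectors \<gamma> by blast
  qed
  show "is_essential_class m \<rho> d K ?S"
    unfolding is_essential_class_def loop_class_def
  proof (intro conjI ballI allI impI)
    show "?S \<noteq> {}" by blast
    show "?S \<subseteq> char_vectors m \<rho> d K" by (rule sub)
  next
    fix \<alpha> \<beta> assume ab: "\<alpha> \<in> ?S" "\<beta> \<in> ?S"
    then have "child\<^sup>*\<^sup>* \<alpha> \<beta>" using reach sub rtranclp_trans[of child \<alpha> \<gamma> \<beta>] by blast
    then obtain \<eta> where "admissible_path m \<rho> d K \<eta>" "set \<eta> \<subseteq> {\<delta>. child\<^sup>*\<^sup>* \<alpha> \<delta>}" "hd \<eta> = \<alpha>" "last \<eta> = \<beta>"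
      using rtranclp_child_path sub ab(1) by blast
    moreover have "{\<delta>. child\<^sup>*\<^sup>* \<alpha> \<delta>} \<subseteq> ?S" using ab(1) by (auto intro: rtranclp_trans)
    ultimately show "\<exists>\<eta>. admissible_path m \<rho> d K \<eta> \<and> set \<eta> \<subseteq> ?S \<and> hd \<eta> = \<alpha> \<and> last \<eta> = \<beta>"
      by blast
  next
    fix \<alpha> \<beta> assume "\<alpha> \<in> ?S" "child \<alpha> \<beta>"
    then show "\<beta> \<in> ?S" by (auto intro: rtranclp.rtrancl_into_rtrancl)
  qed
  fix \<Omega> assume \<Omega>: "is_essential_class m \<rho> d K \<Omega>"
  then have closed: "\<And>\<alpha> \<beta>. \<alpha> \<in> \<Omega> \<Longrightarrow> child \<alpha> \<beta> \<Longrightarrow> \<beta> \<in> \<Omega>" by (auto simp: is_essential_class_def)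
  obtain \<alpha> where "\<alpha> \<in> \<Omega>" "\<alpha> \<in> char_vectors m \<rho> d K"
    using \<Omega> by (auto simp: is_essential_class_def loop_class_def)
  then have g: "\<gamma> \<in> \<Omega>" using closed_under_child_rtranclp[of \<Omega> \<alpha> \<gamma>] closed reach by blast
  show "\<Omega> = ?S"
  proof
    show "?S \<subseteq> \<Omega>" using closed_under_child_rtranclp[of \<Omega> \<gamma>] closed g by blast
    show "\<Omega> \<subseteq> ?S"
    proof
      fix \<beta> assume "\<beta> \<in> \<Omega>"
      then obtain \<eta> where "admissible_path m \<rho> d K \<eta>" "hd \<eta> = \<gamma>" "last \<eta> = \<beta>"
        using \<Omega> g unfolding is_essential_class_def loop_class_def by blast
      then show "\<beta> \<in> ?S" using admissible_path_reach by blast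
    qed
  qed
qed

end

section \<open>A characteristic vector reachable from every other\<close>

context finite_type_ifs begin

lemma card_covers_le:
  assumes "\<Delta> \<in> net n" shows "card (left ` covers n \<Delta>) \<le> mult_bound"
proof -
  have "left ` covers n \<Delta> \<subseteq> lefts n \<inter> {snd \<Delta> - \<rho> ^ n..(snd \<Delta> - \<rho> ^ n) + \<rho> ^ n}"
    using net_less[OF assms] by (auto simp: covers_def lefts_def)
  then have "card (left ` covers n \<Delta>) \<le> card (lefts n \<inter> {snd \<Delta> - \<rho> ^ n..(snd \<Delta> - \<rho> ^ n) + \<rho> ^ n})"
    by (intro card_mono) auto
  also have "\<dots> \<le> mult_bound" by (rule card_lefts_interval)
  finally show ?thesis .
qed

text \<open>A net interval with the largest possible number of neighbours: no cell can overlap one of its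
  similar copies other than the copies of its own neighbours.\<close>

lemma max_net_translate:
  assumes \<Delta>: "\<Delta> \<in> net n"
    and maxi: "\<And>n' \<Delta>'. \<Delta>' \<in> net n' \<Longrightarrow> card (left ` covers n' \<Delta>') \<le> card (left ` covers n \<Delta>)"
    and \<omega>: "\<omega> \<in> words m k"
  defines "\<Delta>' \<equiv> (left \<omega> + \<rho> ^ k * fst \<Delta>, left \<omega> + \<rho> ^ k * snd \<Delta>)"
  shows "\<Delta>' \<in> net (k + n)" "norm_length \<rho> (k + n) \<Delta>' = norm_length \<rho> n \<Delta>" "nbrs (k + n) \<Delta>' = nbrs n \<Delta>"
proof -
  let ?g = "\<lambda>v. left \<omega> + \<rho> ^ k * v" and ?N = "k + n"
  define T where "T = ?g ` left ` covers n \<Delta>"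
  have lt: "fst \<Delta>' < snd \<Delta>'" using net_less[OF \<Delta>] rho_pos by (simp add: \<Delta>'_def)
  have left_\<omega>: "left (\<omega> @ \<sigma>) = ?g (left \<sigma>)" "?g (left \<sigma>) + \<rho> ^ ?N = ?g (left \<sigma> + \<rho> ^ n)" for \<sigma>
    using left_append[OF \<omega>] by (auto simp: algebra_simps power_add)
  have "inj_on ?g (left ` covers n \<Delta>)" using rho_pos by (auto simp: inj_on_def)
  then have cardT: "card T = card (left ` covers n \<Delta>)" by (simp add: T_def card_image)
  have T_cover: "\<omega> @ \<sigma> \<in> covers ?N \<Delta>'" if "\<sigma> \<in> covers n \<Delta>" for \<sigma>
    using that append_words[OF \<omega>, of \<sigma> n] rho_pos
    by (simp add: covers_def left_\<omega> \<Delta>'_def)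
  have T_bounds: "v \<le> fst \<Delta>'" "snd \<Delta>' \<le> v + \<rho> ^ ?N" if "v \<in> T" for v
    using that T_cover unfolding T_def by (auto simp: covers_def left_\<omega>)
  have T_sub: "T \<subseteq> left ` {\<sigma> \<in> words m ?N. left \<sigma> \<le> fst \<Delta>' \<and> snd \<Delta>' \<le> left \<sigma> + \<rho> ^ ?N}"
    using T_cover unfolding T_def covers_def by (force simp: left_\<omega>[symmetric])
  \<comment> \<open>The net interval around \<open>x\<close> is covered by all cells of
    \<open>T\<close> and by the cell of \<tau>; by maximality \<tau> cannot contribute a new left
    endpoint.\<close>
  have key: "left \<tau> \<in> T"
    if \<tau>: "\<tau> \<in> words m ?N" and x: "x \<in> K" "x \<notin> endpoints ?N" "fst \<Delta>' < x" "x < snd \<Delta>'"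
      "left \<tau> < x" "x < left \<tau> + \<rho> ^ ?N" for \<tau> x
  proof -
    obtain D where D: "D \<in> net ?N" "fst D < x" "x < snd D" using net_around[OF x(1,2)] .
    have "insert (left \<tau>) T \<subseteq> left ` covers ?N D"
    proof
      fix v assume v: "v \<in> insert (left \<tau>) T"
      then obtain \<eta> where \<eta>: "\<eta> \<in> words m ?N" "v = left \<eta>" using T_sub \<tau> by blast
      have "v < x" "x < v + \<rho> ^ ?N" using v x T_bounds[of v] by auto
      then have "left \<eta> < snd D" "fst D < left \<eta> + \<rho> ^ ?N" using D(2,3) \<eta>(2) by linarith+
      then show "v \<in> left ` covers ?N D"
        using cell_of_net[OF D(1) \<eta>(1) order_refl] \<eta> by (simp add: covers_def)
    qed
    then have "card (insert (left \<tau>) T) \<le> card (left ` covers ?N D)"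
      by (intro card_mono) (auto simp: finite_covers)
    also have "\<dots> \<le> card T" using maxi[OF D(1)] cardT by simp
    finally have "card (insert (left \<tau>) T) \<le> card T" .
    moreover have "finite T" by (simp add: T_def finite_covers)
    ultimately show ?thesis by (metis card_insert_disjoint not_less_eq_eq order_refl)
  qed
  \<comment> \<open>Near such an endpoint the cell of \<tau> has a point of \<open>K\<close> inside
    the copy, so \<open>key\<close> puts it into \<open>T\<close>; but cells of \<open>T\<close>
    span the whole copy and cannot end inside it.\<close>
  have no_endpoint: "e \<notin> endpoints ?N" if e: "fst \<Delta>' < e" "e < snd \<Delta>'" for e
  proof
    assume "e \<in> endpoints ?N"
    then obtain \<tau> where \<tau>: "\<tau> \<in> words m ?N" "e = left \<tau> \<or> e = left \<tau> + \<rho> ^ ?N"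
      unfolding level_endpoints_eq by blast
    define h where "h z = left \<tau> + \<rho> ^ ?N * z" for z
    have hK: "z \<in> K \<Longrightarrow> h z \<in> K" for z
      using ifs_word_in_K[OF \<tau>(1), of z] unfolding ifs_word_eq[OF \<tau>(1), of z] h_def .
    have fin: "finite (h -` endpoints ?N)" "finite ((\<lambda>z. h (1 - z)) -` endpoints ?N)"
      using rho_pos by (auto intro!: finite_vimageI finite_endpoints injI simp: h_def)
    from \<tau>(2) show False
    proof
      assume e1: "e = left \<tau>"
      have "0 < min 1 ((snd \<Delta>' - e) / \<rho> ^ ?N)" using e rho_pos by simp
      then obtain j where j: "\<rho> ^ j < min 1 ((snd \<Delta>' - e) / \<rho> ^ ?N)" "\<rho> ^ j \<notin> h -` endpoints ?N"
        using K_accumulates_at_0[OF _ fin(1)] by blast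
      have "h (\<rho> ^ j) < snd \<Delta>'" "h (\<rho> ^ j) < left \<tau> + \<rho> ^ ?N" "left \<tau> < h (\<rho> ^ j)"
        using j(1) rho_pos by (simp_all add: h_def e1 field_simps)
      then have "left \<tau> \<in> T"
        using key[OF \<tau>(1) hK[OF rho_power_in_K(1)[of j]]] j(2) e(1) e1 by simp
      then show False using T_bounds e(1) e1 by fastforce
    next
      assume e1: "e = left \<tau> + \<rho> ^ ?N"
      have "0 < min 1 ((e - fst \<Delta>') / \<rho> ^ ?N)" using e rho_pos by simp
      then obtain j where j: "\<rho> ^ j < min 1 ((e - fst \<Delta>') / \<rho> ^ ?N)" "\<rho> ^ j \<notin> (\<lambda>z. h (1 - z)) -` endpoints ?N"
        using K_accumulates_at_0[OF _ fin(2)] by blast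
      have "h (1 - \<rho> ^ j) = e - \<rho> ^ ?N * \<rho> ^ j" by (simp add: h_def e1 algebra_simps)
      moreover have "\<rho> ^ ?N * \<rho> ^ j < e - fst \<Delta>'" "\<rho> ^ ?N * \<rho> ^ j < \<rho> ^ ?N * 1" "0 < \<rho> ^ ?N * \<rho> ^ j"
        using j(1) rho_pos by (simp_all add: field_simps)
      ultimately have "fst \<Delta>' < h (1 - \<rho> ^ j)" "h (1 - \<rho> ^ j) < e" "left \<tau> < h (1 - \<rho> ^ j)"
        using e1 by linarith+
      then have "left \<tau> \<in> T"
        using key[OF \<tau>(1) hK[OF rho_power_in_K(2)[of j]]] j(2) e(2) e1 by simp
      then show False using T_bounds e(2) e1 by fastforce
    qed
  qed
  have in_E: "?g v \<in> endpoints ?N" if v: "v \<in> endpoints n" for v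
  proof -
    obtain \<sigma> where \<sigma>: "\<sigma> \<in> words m n" "v = left \<sigma> \<or> v = left \<sigma> + \<rho> ^ n"
      using v unfolding level_endpoints_eq by blast
    then have "?g v = left (\<omega> @ \<sigma>) \<or> ?g v = left (\<omega> @ \<sigma>) + \<rho> ^ ?N"
      using left_\<omega>[of \<sigma>] by auto
    then show ?thesis using append_words[OF \<omega> \<sigma>(1)] unfolding level_endpoints_eq by blast
  qed
  obtain x where x: "x \<in> K" "fst \<Delta> < x" "x < snd \<Delta>" using net_K_point[OF \<Delta>] by blast
  have "?g x \<in> K" using ifs_word_in_K[OF \<omega> x(1)] unfolding ifs_word_eq[OF \<omega>, of x] .
  moreover have "fst \<Delta>' < ?g x" "?g x < snd \<Delta>'" using x rho_pos by (simp_all add: \<Delta>'_def)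
  ultimately have "{fst \<Delta>'<..<snd \<Delta>'} \<inter> K \<noteq> {}" by (metis IntI empty_iff greaterThanLessThan_iff)
  moreover have "{fst \<Delta>'<..<snd \<Delta>'} \<inter> endpoints ?N = {}" using no_endpoint by auto
  moreover have "fst \<Delta>' \<in> endpoints ?N" "snd \<Delta>' \<in> endpoints ?N"
    using in_E net_endpoints[OF \<Delta>] by (simp_all add: \<Delta>'_def)
  ultimately show net: "\<Delta>' \<in> net ?N" using lt net_iff[of "fst \<Delta>'" "snd \<Delta>'" ?N] by simp
  show "norm_length \<rho> ?N \<Delta>' = norm_length \<rho> n \<Delta>"
    using rho_pos by (simp add: norm_length_def \<Delta>'_def power_add field_simps)
  have "T \<subseteq> left ` covers ?N \<Delta>'" using T_sub by (simp add: covers_def)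
  then have "T = left ` covers ?N \<Delta>'"
    using maxi[OF net] cardT by (intro card_seteq) (auto simp: finite_covers)
  then have "(\<lambda>v. (fst \<Delta>' - v) / \<rho> ^ ?N) ` left ` covers ?N \<Delta>' = (\<lambda>v. (fst \<Delta> - v) / \<rho> ^ n) ` left ` covers n \<Delta>"
  proof -
    have *: "(fst \<Delta>' - ?g v) / \<rho> ^ ?N = (fst \<Delta> - v) / \<rho> ^ n" for v
      using rho_pos by (simp add: \<Delta>'_def power_add field_simps)
    assume T: "T = left ` covers ?N \<Delta>'"
    have "(\<lambda>v. (fst \<Delta>' - v) / \<rho> ^ ?N) ` left ` covers ?N \<Delta>' = (\<lambda>v. (fst \<Delta>' - ?g v) / \<rho> ^ ?N) ` left ` covers n \<Delta>"
      unfolding T[symmetric] T_def by (rule image_image)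
    then show ?thesis unfolding * .
  qed
  then show "nbrs ?N \<Delta>' = nbrs n \<Delta>"
    unfolding neighbour_set_eq[OF lt] neighbour_set_eq[OF net_less[OF \<Delta>]] by simp
qed

text \<open>Copies of the maximal net interval share its length and neighbours but perhaps not its
  position. A fixed child has the same characteristic vector in every copy, and every net interval
  contains a copy.\<close>

lemma reachable_char_vec:
  "\<exists>\<gamma>\<in>char_vectors m \<rho> d K. \<forall>\<alpha>\<in>char_vectors m \<rho> d K. child\<^sup>*\<^sup>* \<alpha> \<gamma>"
proof -
  let ?c = "\<lambda>(n, \<Delta>). card (left ` covers n \<Delta>)"
  have "(0, (0, 1)) \<in> {(n, \<Delta>). \<Delta> \<in> net n}" by (simp add: net_intervals_def)
  moreover have "\<forall>p. p \<in> {(n, \<Delta>). \<Delta> \<in> net n} \<longrightarrow> ?c p < Suc mult_bound"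
    using card_covers_le by (auto simp: less_Suc_eq_le)
  ultimately have "\<exists>p. p \<in> {(n, \<Delta>). \<Delta> \<in> net n} \<and> (\<forall>q. q \<in> {(n, \<Delta>). \<Delta> \<in> net n} \<longrightarrow> ?c q \<le> ?c p)"
    by (rule ex_has_greatest_nat)
  then obtain n \<Delta> where \<Delta>: "\<Delta> \<in> net n"
    and maxi: "\<And>n' \<Delta>'. \<Delta>' \<in> net n' \<Longrightarrow> card (left ` covers n' \<Delta>') \<le> card (left ` covers n \<Delta>)"
    by auto
  \<comment> \<open>This cell only serves to show that \<Delta> has a child; the extra letter 0
    below takes it to a level strictly beyond \<open>n\<close>.\<close>
  obtain k \<eta> where k: "n \<le> k" "\<eta> \<in> words m k" "fst \<Delta> \<le> left \<eta>" "left \<eta> + \<rho> ^ k \<le> snd \<Delta>"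
    by (rule cell_in_net[OF \<Delta>])
  have "left (\<eta> @ [0]) = left \<eta>" "\<eta> @ [0] \<in> words m (Suc k)" using k(2) by (simp_all add: left_snoc d_0 snoc_words)
  moreover have "\<rho> ^ Suc k \<le> \<rho> ^ k" using rho_pos rho_less_1 by (intro power_decreasing) auto
  moreover obtain D where D: "D \<in> net (Suc k)" "left (\<eta> @ [0]) \<le> fst D" "snd D \<le> left (\<eta> @ [0]) + \<rho> ^ Suc k"
    using net_in_cell calculation(2) by blast
  ultimately have "fst \<Delta> \<le> fst D" "snd D \<le> snd \<Delta>" using k(3,4) by linarith+
  then have "sub_interval D \<Delta>" using net_less[OF D(1)] by (simp add: sub_interval_iff)
  then obtain D1 where D1: "D1 \<in> net (Suc n)" "sub_interval D1 \<Delta>"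
    using net_intermediate[OF D(1) \<Delta>, of "Suc n"] k(1) by (metis Suc_le_mono Suc_n_not_le_n nat_le_linear)
  obtain s t where st: "child_coords (norm_length \<rho> n \<Delta>) (set (nbrs n \<Delta>)) s t" "D1 = child_interval n \<Delta> s t"
    using child_obtain[OF \<Delta> D1] .
  define \<gamma> where "\<gamma> = char_vec (Suc n) D1"
  have "child\<^sup>*\<^sup>* \<alpha> \<gamma>" if \<alpha>: "\<alpha> \<in> char_vectors m \<rho> d K" for \<alpha>
  proof -
    obtain n' P where P: "P \<in> net n'" "\<alpha> = char_vec n' P" using \<alpha> unfolding char_vectors_def by blast
    obtain k \<omega> where \<omega>: "n' \<le> k" "\<omega> \<in> words m k" "fst P \<le> left \<omega>" "left \<omega> + \<rho> ^ k \<le> snd P"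
      by (rule cell_in_net[OF P(1)])
    define \<Delta>' where "\<Delta>' = (left \<omega> + \<rho> ^ k * fst \<Delta>, left \<omega> + \<rho> ^ k * snd \<Delta>)"
    note tr = max_net_translate[OF \<Delta> maxi \<omega>(2), folded \<Delta>'_def]
    let ?D = "child_interval (k + n) \<Delta>' s t"
    have D': "?D \<in> net (Suc (k + n))" "sub_interval ?D \<Delta>'"
      using child_interval_iff[OF tr(1), of s t] st(1) by (simp_all add: tr)
    have "char_vec (Suc (k + n)) ?D = \<gamma>"
      using char_vector_child[OF tr(1), of s t] char_vector_child[OF \<Delta> st(1)] st unfolding \<gamma>_def by (simp add: tr)
    moreover have "sub_interval \<Delta>' P"
    proof -
      have "fst \<Delta> \<in> {0..1}" "snd \<Delta> \<in> {0..1}" using net_endpoints[OF \<Delta>] endpoints_subset_K K_subset by blast+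
      then have "0 \<le> \<rho> ^ k * fst \<Delta>" "\<rho> ^ k * snd \<Delta> \<le> \<rho> ^ k" using rho_pos by (simp_all add: mult_left_le)
      then have "fst P \<le> fst \<Delta>'" "snd \<Delta>' \<le> snd P"
        unfolding \<Delta>'_def fst_conv snd_conv using \<omega>(3,4) by linarith+
      then show ?thesis using net_less[OF tr(1)] by (simp add: sub_interval_iff)
    qed
    then have "sub_interval ?D P" using D'(2) unfolding sub_interval_def by (rule subset_trans[rotated])
    moreover obtain r where r: "Suc (k + n) = n' + r" using le_Suc_ex[of n' "Suc (k + n)"] \<omega>(1) by auto
    ultimately show ?thesis using descendant_reachable[OF P(1), of ?D r, folded r] D'(1) P(2) by simp
  qed
  moreover have "\<gamma> \<in> char_vectors m \<rho> d K" unfolding \<gamma>_def using D1(1) by blast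
  ultimately show ?thesis by blast
qed

lemma essential_class_nonempty_closed:
  obtains n \<Delta> where "\<Delta> \<in> net n" "char_vec n \<Delta> \<in> essential_class m \<rho> d K"
    "\<And>\<alpha> \<beta>. \<alpha> \<in> essential_class m \<rho> d K \<Longrightarrow> child \<alpha> \<beta> \<Longrightarrow> \<beta> \<in> essential_class m \<rho> d K"
proof -
  obtain \<gamma> where \<gamma>: "\<gamma> \<in> char_vectors m \<rho> d K" "\<And>\<alpha>. \<alpha> \<in> char_vectors m \<rho> d K \<Longrightarrow> child\<^sup>*\<^sup>* \<alpha> \<gamma>"
    using reachable_char_vec by blast
  have eq: "essential_class m \<rho> d K = {\<beta>. child\<^sup>*\<^sup>* \<gamma> \<beta>}" by (rule essential_class_eq[OF \<gamma>])
  obtain n \<Delta> where "\<Delta> \<in> net n" "\<gamma> = char_vec n \<Delta>" using \<gamma>(1) unfolding char_vectors_def by blast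
  then show ?thesis
    by (intro that[of \<Delta> n]) (auto simp: eq intro: rtranclp.rtrancl_into_rtrancl)
qed

end

section \<open>Transition matrices and masses\<close>

locale weighted_ifs = equicontractive_ifs +
  fixes p :: "nat \<Rightarrow> real"
  assumes p_pos: "\<And>j. j \<le> m \<Longrightarrow> 0 < p j" and p_sum: "(\<Sum>j\<le>m. p j) = 1"
begin

definition weight :: "nat list \<Rightarrow> real" where "weight \<sigma> = prod_list (map p \<sigma>)"

text \<open>The \<open>q n v\<close> of the overview.\<close>

definition mass :: "nat \<Rightarrow> real \<Rightarrow> real" where
  "mass n v = (\<Sum>\<sigma>\<in>words m n. if left \<sigma> = v then weight \<sigma> else 0)"

lemma weight_append: "weight (\<sigma> @ \<tau>) = weight \<sigma> * weight \<tau>"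
  by (simp add: weight_def)

lemma weight_pos: "\<sigma> \<in> words m n \<Longrightarrow> 0 < weight \<sigma>"
proof (induction \<sigma> arbitrary: n)
  case (Cons j \<sigma>)
  then have "\<sigma> \<in> words m (n - 1)" "j \<le> m" by (auto simp: words_def)
  then show ?case using Cons.IH[of "n - 1"] p_pos[of j] by (simp add: weight_def)
qed (simp add: weight_def)

lemma sum_weight: "(\<Sum>\<sigma>\<in>words m n. weight \<sigma>) = 1"
proof (induction n)
  case (Suc n)
  have "(\<Sum>\<sigma>\<in>words m (Suc n). weight \<sigma>) = (\<Sum>\<sigma>\<in>words m n. weight \<sigma> * (\<Sum>l\<le>m. p l))"
    using sum_words_add[of weight m n 1]
    by (simp add: weight_append sum_words_1[unfolded One_nat_def] sum_distrib_left weight_def)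
  then show ?case using Suc p_sum by simp
qed (simp add: weight_def)

lemma mass_nonneg: "0 \<le> mass n v"
  unfolding mass_def by (intro sum_nonneg) (auto intro: less_imp_le weight_pos)

lemma mass_le_1: "mass n v \<le> 1"
proof -
  have "mass n v \<le> (\<Sum>\<sigma>\<in>words m n. weight \<sigma>)"
    unfolding mass_def by (intro sum_mono) (auto intro: less_imp_le weight_pos)
  then show ?thesis by (simp add: sum_weight)
qed

lemma mass_eq_0: "v \<notin> lefts n \<Longrightarrow> mass n v = 0"
  unfolding mass_def lefts_def by (intro sum.neutral) auto

text \<open>Words beginning with \<sigma> contribute only part of the mass on the right. This
  replaces an arbitrary word by one whose cell lies in an essential net interval.\<close>

lemma weight_mult_mass_le:
  assumes \<sigma>: "\<sigma> \<in> words m n"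
  shows "weight \<sigma> * mass k w \<le> mass (n + k) (left \<sigma> + \<rho> ^ n * w)"
proof -
  let ?u = "left \<sigma> + \<rho> ^ n * w"
  let ?f = "\<lambda>\<sigma>. \<Sum>\<tau>\<in>words m k. if left (\<sigma> @ \<tau>) = ?u then weight (\<sigma> @ \<tau>) else 0"
  have "weight \<sigma> * mass k w = ?f \<sigma>"
    unfolding mass_def sum_distrib_left
    using rho_pos by (intro sum.cong) (simp_all add: left_append[OF \<sigma>] weight_append)
  also have "\<dots> \<le> (\<Sum>\<sigma>\<in>words m n. ?f \<sigma>)"
  proof (rule member_le_sum[OF \<sigma>])
    fix \<sigma>' assume "\<sigma>' \<in> words m n - {\<sigma>}"
    then show "0 \<le> ?f \<sigma>'"
      by (intro sum_nonneg) (auto simp: weight_append intro!: mult_nonneg_nonneg less_imp_le[OF weight_pos])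
  qed simp
  also have "\<dots> = mass (n + k) ?u"
    unfolding mass_def by (simp only: sum_words_add)
  finally show ?thesis .
qed

text \<open>Every word with the prescribed left endpoint serves equally well, so the existential
  quantifier disappears and a condition in the coordinate of \<open>P\<close> remains.\<close>

lemma trans_letter_iff:
  assumes P: "P \<in> net n" and x: "x \<in> set (nbrs n P)" and s: "fst \<Delta> = fst P + \<rho> ^ n * s"
  shows "trans_letter m \<rho> d n P \<Delta> x y l \<longleftrightarrow> l \<le> m \<and> d l = s + x - \<rho> * y"
proof -
  obtain \<sigma>0 where \<sigma>0: "\<sigma>0 \<in> words m n" "left \<sigma>0 = fst P - \<rho> ^ n * x"
    using neighbour_iff[OF P] x by (auto simp: covers_def)
  have eq: "fst P - \<rho> ^ n * x + \<rho> ^ n * d l = fst \<Delta> - \<rho> ^ Suc n * y \<longleftrightarrow> d l = s + x - \<rho> * y"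
  proof -
    have "fst P - \<rho> ^ n * x + \<rho> ^ n * d l = fst \<Delta> - \<rho> ^ Suc n * y \<longleftrightarrow> \<rho> ^ n * d l = \<rho> ^ n * (s + x - \<rho> * y)"
      unfolding s by (auto simp: algebra_simps)
    then show ?thesis using rho_pos by simp
  qed
  have "(\<exists>\<sigma>\<in>words m n. left \<sigma> = fst P - \<rho> ^ n * x \<and> left (\<sigma> @ [l]) = fst \<Delta> - \<rho> ^ Suc n * y) \<longleftrightarrow>
      fst P - \<rho> ^ n * x + \<rho> ^ n * d l = fst \<Delta> - \<rho> ^ Suc n * y"
  proof
    assume "\<exists>\<sigma>\<in>words m n. left \<sigma> = fst P - \<rho> ^ n * x \<and> left (\<sigma> @ [l]) = fst \<Delta> - \<rho> ^ Suc n * y"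
    then obtain \<sigma> where \<sigma>: "\<sigma> \<in> words m n" "left \<sigma> = fst P - \<rho> ^ n * x" "left (\<sigma> @ [l]) = fst \<Delta> - \<rho> ^ Suc n * y"
      by blast
    then show "fst P - \<rho> ^ n * x + \<rho> ^ n * d l = fst \<Delta> - \<rho> ^ Suc n * y"
      using left_snoc[OF \<sigma>(1), of l] by simp
  next
    assume "fst P - \<rho> ^ n * x + \<rho> ^ n * d l = fst \<Delta> - \<rho> ^ Suc n * y"
    then have "left (\<sigma>0 @ [l]) = fst \<Delta> - \<rho> ^ Suc n * y" using left_snoc[OF \<sigma>0(1), of l] \<sigma>0(2) by simp
    then show "\<exists>\<sigma>\<in>words m n. left \<sigma> = fst P - \<rho> ^ n * x \<and> left (\<sigma> @ [l]) = fst \<Delta> - \<rho> ^ Suc n * y"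
      using \<sigma>0 by blast
  qed
  then show ?thesis unfolding trans_letter_def eq by blast
qed

text \<open>As the \<open>d l\<close> are distinct, the sum has at most one non-zero term. In this
  form the matrix visibly depends only on the two neighbour sets and on the offset
  \<open>s\<close>.\<close>

lemma net_transition_eq:
  assumes P: "P \<in> net n" and s: "fst \<Delta> = fst P + \<rho> ^ n * s"
  shows "net_transition m \<rho> d p n P \<Delta> = mat (length (nbrs n P)) (length (nbrs (Suc n) \<Delta>))
    (\<lambda>(j, k). \<Sum>l\<le>m. if d l = s + nbrs n P ! j - \<rho> * nbrs (Suc n) \<Delta> ! k then p l else 0)"
  unfolding net_transition_def Let_def
proof (rule cong_mat[OF refl refl], unfold prod.case)
  fix j k assume "j < length (nbrs n P)"
  then have x: "nbrs n P ! j \<in> set (nbrs n P)" by simp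
  let ?z = "s + nbrs n P ! j - \<rho> * nbrs (Suc n) \<Delta> ! k"
  note tl = trans_letter_iff[OF P x s]
  show "(if \<exists>l. trans_letter m \<rho> d n P \<Delta> (nbrs n P ! j) (nbrs (Suc n) \<Delta> ! k) l
      then p (THE l. trans_letter m \<rho> d n P \<Delta> (nbrs n P ! j) (nbrs (Suc n) \<Delta> ! k) l) else 0) =
    (\<Sum>l\<le>m. if d l = ?z then p l else 0)"
  proof (cases "\<exists>l\<le>m. d l = ?z")
    case True
    then obtain l where l: "l \<le> m" "d l = ?z" by blast
    have uniq: "l' = l" if "l' \<le> m" "d l' = ?z" for l' using d_inj that l by simp
    have "(THE l. l \<le> m \<and> d l = ?z) = l" by (rule the_equality) (use l uniq in blast)+
    moreover have "(\<Sum>l'\<le>m. if d l' = ?z then p l' else 0) = (\<Sum>l'\<le>m. if l' = l then p l' else 0)"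
    proof (rule sum.cong[OF refl])
      fix l' assume "l' \<in> {..m}"
      then have "d l' = ?z \<longleftrightarrow> l' = l" using uniq l(2) by blast
      then show "(if d l' = ?z then p l' else 0) = (if l' = l then p l' else 0)" by presburger
    qed
    moreover have "(\<Sum>l'\<le>m. if l' = l then p l' else 0) = p l" using l(1) by simp
    ultimately show ?thesis unfolding tl if_P[OF True] by (simp only:)
  next
    case False
    then have "(\<Sum>l\<le>m. if d l = ?z then p l else 0) = 0" by (intro sum.neutral) auto
    then show ?thesis unfolding tl if_not_P[OF False] by (rule sym)
  qed
qed

text \<open>Two realizations of the same pair of vectors have the same offset \<open>s\<close> by
  \<open>child_char_inject\<close>, hence the same matrix; the choice operator is harmless.\<close>

lemma transition_matrix_eq:
  assumes r: "realizes m \<rho> d K \<alpha> \<beta> n P \<Delta>"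
  shows "transition_matrix m \<rho> d K p \<alpha> \<beta> = net_transition m \<rho> d p n P \<Delta>"
proof -
  obtain n' P' \<Delta>' where some: "(SOME (n, P, \<Delta>). realizes m \<rho> d K \<alpha> \<beta> n P \<Delta>) = (n', P', \<Delta>')"
    by (metis prod_cases3)
  have "case (SOME (n, P, \<Delta>). realizes m \<rho> d K \<alpha> \<beta> n P \<Delta>) of (n, P, \<Delta>) \<Rightarrow> realizes m \<rho> d K \<alpha> \<beta> n P \<Delta>"
    by (rule someI[of "\<lambda>(n, P, \<Delta>). realizes m \<rho> d K \<alpha> \<beta> n P \<Delta>" "(n, P, \<Delta>)"]) (use r in simp)
  then have r': "realizes m \<rho> d K \<alpha> \<beta> n' P' \<Delta>'" unfolding some by simp
  have P: "P \<in> net n" "\<Delta> \<in> net (Suc n)" "sub_interval \<Delta> P"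
    and P': "P' \<in> net n'" "\<Delta>' \<in> net (Suc n')" "sub_interval \<Delta>' P'"
    using r r' by (simp_all add: realizes_def)
  have eq: "char_vec n P = char_vec n' P'" "char_vec (Suc n) \<Delta> = char_vec (Suc n') \<Delta>'"
    using r r' by (simp_all add: realizes_def)
  then have V: "norm_length \<rho> n P = norm_length \<rho> n' P'" "nbrs n P = nbrs n' P'" "nbrs (Suc n) \<Delta> = nbrs (Suc n') \<Delta>'"
    by (simp_all add: char_vector_def)
  obtain s t where st: "child_coords (norm_length \<rho> n P) (set (nbrs n P)) s t" "\<Delta> = child_interval n P s t"
    using child_obtain[OF P] .
  obtain s' t' where st': "child_coords (norm_length \<rho> n' P') (set (nbrs n' P')) s' t'" "\<Delta>' = child_interval n' P' s' t'"
    using child_obtain[OF P'] .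
  have "child_char (norm_length \<rho> n P) (set (nbrs n P)) s t = child_char (norm_length \<rho> n P) (set (nbrs n P)) s' t'"
    using char_vector_child[OF P(1) st(1)] char_vector_child[OF P'(1) st'(1)] eq(2) st(2) st'(2) V by simp
  then have "s = s'"
    using child_char_inject[OF _ st(1), of s' t'] st'(1) V by simp
  then have "net_transition m \<rho> d p n P \<Delta> = net_transition m \<rho> d p n' P' \<Delta>'"
    using net_transition_eq[OF P(1), of \<Delta> s] net_transition_eq[OF P'(1), of \<Delta>' s] st(2) st'(2) V by simp
  then show ?thesis unfolding transition_matrix_def some by simp
qed

text \<open>The masses at the neighbours form a row vector, multiplied on the right by the
  transition matrix. Words not covering \<open>P\<close> have no one-letter extension covering
  \<Delta>, so grouping by left endpoints over \<open>covers n P\<close> loses nothing.\<close>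

lemma mass_step:
  assumes P: "P \<in> net n" and \<Delta>: "\<Delta> \<in> net (Suc n)" "sub_interval \<Delta> P" and k: "k < length (nbrs (Suc n) \<Delta>)"
  shows "mass (Suc n) (fst \<Delta> - \<rho> ^ Suc n * nbrs (Suc n) \<Delta> ! k) =
    (\<Sum>j<length (nbrs n P). mass n (fst P - \<rho> ^ n * nbrs n P ! j) * net_transition m \<rho> d p n P \<Delta> $$ (j, k))"
proof -
  let ?y = "nbrs (Suc n) \<Delta> ! k"
  let ?u = "fst \<Delta> - \<rho> ^ Suc n * ?y"
  define s where "s = (fst \<Delta> - fst P) / \<rho> ^ n"
  have s: "fst \<Delta> = fst P + \<rho> ^ n * s" using rho_pos by (simp add: s_def)
  define g where "g v = (\<Sum>l\<le>m. if v + \<rho> ^ n * d l = ?u then p l else 0)" for v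
  let ?X = "left ` covers n P"
  obtain \<omega> where \<omega>: "\<omega> \<in> covers (Suc n) \<Delta>" "left \<omega> = ?u"
    using neighbour_iff[OF \<Delta>(1), of ?y] k by auto
  have zero: "g (left \<sigma>) = 0" if \<sigma>: "\<sigma> \<in> words m n" "\<sigma> \<notin> covers n P" for \<sigma>
    unfolding g_def
  proof (rule sum.neutral, rule ballI)
    fix l assume "l \<in> {..m}"
    have "left \<sigma> + \<rho> ^ n * d l \<noteq> ?u"
    proof
      assume u: "left \<sigma> + \<rho> ^ n * d l = ?u"
      have "?u \<le> fst \<Delta>" "snd \<Delta> \<le> ?u + \<rho> ^ Suc n" using \<omega> by (simp_all add: covers_def)
      then have "left \<sigma> \<le> fst \<Delta>" "snd \<Delta> \<le> left \<sigma> + \<rho> ^ n"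
        using subcell_bounds[of l n] \<open>l \<in> {..m}\<close> u by auto
      moreover have "fst P \<le> fst \<Delta>" "fst \<Delta> < snd \<Delta>" "snd \<Delta> \<le> snd P"
        using \<Delta>(2) net_less[OF \<Delta>(1)] by (simp_all add: sub_interval_iff)
      ultimately have "left \<sigma> < snd P" "fst P < left \<sigma> + \<rho> ^ n" by linarith+
      then show False using cell_of_net[OF P \<sigma>(1) order_refl] \<sigma> by (simp add: covers_def)
    qed
    then show "(if left \<sigma> + \<rho> ^ n * d l = ?u then p l else 0) = 0" by simp
  qed
  have "mass (Suc n) ?u = (\<Sum>\<sigma>\<in>words m n. \<Sum>l\<le>m. if left (\<sigma> @ [l]) = ?u then weight (\<sigma> @ [l]) else 0)"
    unfolding mass_def using sum_words_add[of _ m n 1] by (simp add: sum_words_1[unfolded One_nat_def])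
  also have "\<dots> = (\<Sum>\<sigma>\<in>words m n. weight \<sigma> * g (left \<sigma>))"
    unfolding g_def sum_distrib_left
    by (intro sum.cong refl) (auto simp: left_snoc weight_append weight_def)
  also have "\<dots> = (\<Sum>\<sigma>\<in>covers n P. weight \<sigma> * g (left \<sigma>))"
    by (rule sum.mono_neutral_right) (auto simp: zero, simp add: covers_def)
  also have "\<dots> = (\<Sum>v\<in>?X. \<Sum>\<sigma>\<in>{\<sigma> \<in> covers n P. left \<sigma> = v}. weight \<sigma> * g (left \<sigma>))"
    by (rule sum.image_gen[OF finite_covers])
  also have "\<dots> = (\<Sum>v\<in>?X. mass n v * g v)"
  proof (rule sum.cong[OF refl])
    fix v assume "v \<in> ?X"
    then have "{\<sigma> \<in> covers n P. left \<sigma> = v} = {\<sigma> \<in> words m n. left \<sigma> = v}" by (auto simp: covers_def)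
    moreover have "mass n v = (\<Sum>\<sigma>\<in>{\<sigma> \<in> words m n. left \<sigma> = v}. weight \<sigma>)"
      unfolding mass_def by (simp add: sum.inter_filter)
    ultimately show "(\<Sum>\<sigma>\<in>{\<sigma> \<in> covers n P. left \<sigma> = v}. weight \<sigma> * g (left \<sigma>)) = mass n v * g v"
      by (simp add: sum_distrib_right)
  qed
  also have "\<dots> = (\<Sum>x\<in>set (nbrs n P). mass n (fst P - \<rho> ^ n * x) * g (fst P - \<rho> ^ n * x))"
    unfolding set_neighbour_set[OF P]
    using rho_pos by (subst sum.reindex) (auto simp: inj_on_def)
  also have "\<dots> = (\<Sum>j<length (nbrs n P). mass n (fst P - \<rho> ^ n * nbrs n P ! j) * g (fst P - \<rho> ^ n * nbrs n P ! j))"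
    using sum.reindex_bij_betw[OF bij_betw_nth[OF distinct_neighbour_set refl refl], symmetric] .
  also have "\<dots> = (\<Sum>j<length (nbrs n P). mass n (fst P - \<rho> ^ n * nbrs n P ! j) * net_transition m \<rho> d p n P \<Delta> $$ (j, k))"
  proof (intro sum.cong refl arg_cong2[where f="(*)"])
    fix j assume j: "j \<in> {..<length (nbrs n P)}"
    have "fst P - \<rho> ^ n * x + \<rho> ^ n * d l = ?u \<longleftrightarrow> d l = s + x - \<rho> * ?y" for x l
    proof -
      have "fst P - \<rho> ^ n * x + \<rho> ^ n * d l = ?u \<longleftrightarrow> \<rho> ^ n * d l = \<rho> ^ n * (s + x - \<rho> * ?y)"
        unfolding s by (auto simp: algebra_simps)
      then show ?thesis using rho_pos by simp
    qed
    then show "g (fst P - \<rho> ^ n * nbrs n P ! j) = net_transition m \<rho> d p n P \<Delta> $$ (j, k)"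
      using j k unfolding net_transition_eq[OF P s] g_def by simp
  qed
  finally show ?thesis .
qed

lemma cv_neighbours_char_vec: "cv_neighbours (char_vec n \<Delta>) = nbrs n \<Delta>"
  by (simp add: cv_neighbours_def char_vector_def)

text \<open>The path consists of the characteristic vectors of the net intervals between \<Delta>
  and \<open>P\<close>. The induction peels off the top interval because \<open>path_matrix\<close>
  recurses on the head.\<close>

lemma net_path:
  "P \<in> net n \<Longrightarrow> \<Delta> \<in> net (n + k) \<Longrightarrow> sub_interval \<Delta> P \<Longrightarrow>
   \<exists>\<gamma>. admissible_path m \<rho> d K \<gamma> \<and> length \<gamma> = Suc k \<and> hd \<gamma> = char_vec n P \<and>
     path_matrix m \<rho> d K p \<gamma> \<in> carrier_mat (length (nbrs n P)) (length (nbrs (n + k) \<Delta>)) \<and>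
     (\<forall>c<length (nbrs (n + k) \<Delta>). mass (n + k) (fst \<Delta> - \<rho> ^ (n + k) * nbrs (n + k) \<Delta> ! c) =
       (\<Sum>j<length (nbrs n P). mass n (fst P - \<rho> ^ n * nbrs n P ! j) * path_matrix m \<rho> d K p \<gamma> $$ (j, c)))"
proof (induction k arbitrary: n P)
  case 0
  then have "P = \<Delta>" using net_self_sub by simp
  moreover have "(\<Sum>j<N. f j * (1\<^sub>m N $$ (j, c))) = f c" if "c < N" for N c :: nat and f :: "nat \<Rightarrow> real"
  proof -
    have "(\<Sum>j<N. f j * (1\<^sub>m N $$ (j, c))) = (\<Sum>j<N. if j = c then f j else 0)"
      using that by (intro sum.cong) auto
    then show ?thesis using that by simp
  qed
  ultimately show ?case using 0
    by (intro exI[of _ "[char_vec n P]"])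
      (auto simp: admissible_path_def cv_neighbours_char_vec simp del: index_one_mat)
next
  case (Suc k)
  obtain Q where Q: "Q \<in> net (Suc n)" "sub_interval \<Delta> Q" "sub_interval Q P"
    by (rule net_intermediate[OF Suc.prems(2,1,3), of "Suc n"]) auto
  let ?p = "length (nbrs n P)" and ?q = "length (nbrs (Suc n) Q)" and ?r = "length (nbrs (n + Suc k) \<Delta>)"
  obtain \<gamma> where \<gamma>: "admissible_path m \<rho> d K \<gamma>" "length \<gamma> = Suc k" "hd \<gamma> = char_vec (Suc n) Q"
    "path_matrix m \<rho> d K p \<gamma> \<in> carrier_mat ?q ?r"
    "\<And>c. c < ?r \<Longrightarrow> mass (n + Suc k) (fst \<Delta> - \<rho> ^ (n + Suc k) * nbrs (n + Suc k) \<Delta> ! c) =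
       (\<Sum>i<?q. mass (Suc n) (fst Q - \<rho> ^ Suc n * nbrs (Suc n) Q ! i) * path_matrix m \<rho> d K p \<gamma> $$ (i, c))"
    using Suc.IH[OF Q(1) _ Q(2)] Suc.prems(2) by auto
  let ?\<alpha> = "char_vec n P" and ?\<beta> = "char_vec (Suc n) Q" and ?M = "path_matrix m \<rho> d K p \<gamma>"
  let ?T = "net_transition m \<rho> d p n P Q"
  obtain \<gamma>' where \<gamma>': "\<gamma> = ?\<beta> # \<gamma>'" using \<gamma>(2,3) by (cases \<gamma>) auto
  have r: "realizes m \<rho> d K ?\<alpha> ?\<beta> n P Q" using Suc.prems(1) Q by (simp add: realizes_def)
  have T: "?T \<in> carrier_mat ?p ?q" by (simp add: net_transition_def Let_def)
  have M: "path_matrix m \<rho> d K p (?\<alpha> # \<gamma>) = ?T * ?M"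
    unfolding \<gamma>' path_matrix.simps(3) transition_matrix_eq[OF r] ..
  have "admissible_path m \<rho> d K (?\<alpha> # \<gamma>)"
    using \<gamma>(1) child_char_vec[OF Suc.prems(1) Q(1,3)] Suc.prems(1) unfolding \<gamma>'
    by (auto simp: admissible_path_def)
  moreover have "path_matrix m \<rho> d K p (?\<alpha> # \<gamma>) \<in> carrier_mat ?p ?r"
    unfolding M using T \<gamma>(4) by (rule mult_carrier_mat)
  moreover have "mass (n + Suc k) (fst \<Delta> - \<rho> ^ (n + Suc k) * nbrs (n + Suc k) \<Delta> ! c) =
      (\<Sum>j<?p. mass n (fst P - \<rho> ^ n * nbrs n P ! j) * path_matrix m \<rho> d K p (?\<alpha> # \<gamma>) $$ (j, c))"
    if c: "c < ?r" for c
  proof -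
    have entry: "(?T * ?M) $$ (j, c) = (\<Sum>i<?q. ?T $$ (j, i) * ?M $$ (i, c))" if "j < ?p" for j
    proof -
      have "(?T * ?M) $$ (j, c) = row ?T j \<bullet> col ?M c" using that c T \<gamma>(4) by auto
      also have "\<dots> = (\<Sum>i\<in>{0..<?q}. ?T $$ (j, i) * ?M $$ (i, c))"
        unfolding scalar_prod_def using that c T \<gamma>(4) by (intro sum.cong) auto
      finally show ?thesis by (simp add: atLeast0LessThan)
    qed
    let ?w = "\<lambda>j. mass n (fst P - \<rho> ^ n * nbrs n P ! j)"
    have "mass (n + Suc k) (fst \<Delta> - \<rho> ^ (n + Suc k) * nbrs (n + Suc k) \<Delta> ! c) =
       (\<Sum>i<?q. (\<Sum>j<?p. ?w j * ?T $$ (j, i)) * ?M $$ (i, c))"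
      unfolding \<gamma>(5)[OF c] by (intro sum.cong refl arg_cong2[where f="(*)"] mass_step[OF Suc.prems(1) Q(1,3)]) simp
    also have "\<dots> = (\<Sum>i<?q. \<Sum>j<?p. ?w j * (?T $$ (j, i) * ?M $$ (i, c)))"
      by (simp add: sum_distrib_right mult.assoc)
    also have "\<dots> = (\<Sum>j<?p. \<Sum>i<?q. ?w j * (?T $$ (j, i) * ?M $$ (i, c)))" by (rule sum.swap)
    also have "\<dots> = (\<Sum>j<?p. ?w j * (?T * ?M) $$ (j, c))"
      by (intro sum.cong refl) (simp add: entry sum_distrib_left)
    finally show ?thesis unfolding M .
  qed
  ultimately show ?case using \<gamma>(2) by (intro exI[of _ "?\<alpha> # \<gamma>"]) simp
qed

text \<open>The initial masses are at most 1, so the mass is bounded by one column sum of the path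
  matrix.\<close>

lemma mass_le_path_norm:
  assumes "P \<in> net n" "\<Delta> \<in> net (n + k)" "sub_interval \<Delta> P" "\<omega> \<in> covers (n + k) \<Delta>"
  shows "\<exists>\<gamma>. admissible_path m \<rho> d K \<gamma> \<and> length \<gamma> = k + 1 \<and> hd \<gamma> = char_vec n P \<and>
    mass (n + k) (left \<omega>) \<le> mat_norm (path_matrix m \<rho> d K p \<gamma>)"
proof -
  let ?p = "length (nbrs n P)" and ?r = "length (nbrs (n + k) \<Delta>)"
  obtain \<gamma> where \<gamma>: "admissible_path m \<rho> d K \<gamma>" "length \<gamma> = Suc k" "hd \<gamma> = char_vec n P"
    "path_matrix m \<rho> d K p \<gamma> \<in> carrier_mat ?p ?r"
    "\<And>c. c < ?r \<Longrightarrow> mass (n + k) (fst \<Delta> - \<rho> ^ (n + k) * nbrs (n + k) \<Delta> ! c) =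
       (\<Sum>j<?p. mass n (fst P - \<rho> ^ n * nbrs n P ! j) * path_matrix m \<rho> d K p \<gamma> $$ (j, c))"
    using net_path[OF assms(1-3)] by blast
  let ?M = "path_matrix m \<rho> d K p \<gamma>"
  have "(fst \<Delta> - left \<omega>) / \<rho> ^ (n + k) \<in> set (nbrs (n + k) \<Delta>)"
    unfolding set_neighbour_set[OF assms(2)] using assms(4) by blast
  then obtain c where c: "c < ?r" "nbrs (n + k) \<Delta> ! c = (fst \<Delta> - left \<omega>) / \<rho> ^ (n + k)"
    by (auto simp: in_set_conv_nth)
  have "mass (n + k) (left \<omega>) = (\<Sum>j<?p. mass n (fst P - \<rho> ^ n * nbrs n P ! j) * ?M $$ (j, c))"
    using \<gamma>(5)[OF c(1)] c(2) rho_pos by simp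
  also have "\<dots> \<le> (\<Sum>j<?p. \<bar>?M $$ (j, c)\<bar>)"
  proof (rule sum_mono)
    fix j
    have "mass n (fst P - \<rho> ^ n * nbrs n P ! j) * ?M $$ (j, c) \<le> mass n (fst P - \<rho> ^ n * nbrs n P ! j) * \<bar>?M $$ (j, c)\<bar>"
      by (intro mult_left_mono mass_nonneg) simp
    also have "\<dots> \<le> 1 * \<bar>?M $$ (j, c)\<bar>" by (intro mult_right_mono mass_le_1) simp
    finally show "mass n (fst P - \<rho> ^ n * nbrs n P ! j) * ?M $$ (j, c) \<le> \<bar>?M $$ (j, c)\<bar>" by simp
  qed
  also have "\<dots> \<le> (\<Sum>j<?p. \<Sum>c<?r. \<bar>?M $$ (j, c)\<bar>)"
    using c(1) by (intro sum_mono member_le_sum) auto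
  also have "\<dots> = mat_norm ?M" using \<gamma>(4) by (simp add: mat_norm_def)
  finally show ?thesis using \<gamma>(1-3) by (intro exI[of _ \<gamma>]) simp
qed

end

section \<open>The self-similar measure\<close>

locale self_similar_measure_ifs = weighted_ifs +
  fixes \<mu> :: "real measure"
  assumes self_similar: "is_self_similar_measure m \<rho> d p \<mu>"
begin

sublocale prob_space \<mu>
  using self_similar by (simp add: is_self_similar_measure_def)

lemma sets_mu [measurable_cong, simp]: "sets \<mu> = sets borel"
  using self_similar by (simp add: is_self_similar_measure_def)

lemma space_mu [simp]: "space \<mu> = UNIV"
  using sets_eq_imp_space_eq[OF sets_mu] by simp

lemma affine_vimage_borel: "A \<in> sets borel \<Longrightarrow> (\<lambda>x. c + r * x) -` A \<in> sets borel" for c r :: real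
  using measurable_sets[of "\<lambda>x. c + r * x" borel borel A] by simp

lemma measure_step:
  assumes "A \<in> sets borel"
  shows "measure \<mu> A = (\<Sum>l\<le>m. p l * measure \<mu> ((\<lambda>x. d l + \<rho> * x) -` A))"
proof -
  have "measure (distr \<mu> borel (ifs_map \<rho> d l)) A = measure \<mu> ((\<lambda>x. d l + \<rho> * x) -` A)" for l
  proof -
    have "ifs_map \<rho> d l = (\<lambda>x. d l + \<rho> * x)" by (simp add: fun_eq_iff ifs_map_def add.commute)
    moreover have "(\<lambda>x. d l + \<rho> * x) \<in> measurable \<mu> borel" by measurable
    ultimately show ?thesis using assms by (simp add: measure_distr)
  qed
  then show ?thesis using self_similar assms by (simp add: is_self_similar_measure_def)
qed

lemma measure_words:
  assumes "A \<in> sets borel"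
  shows "measure \<mu> A = (\<Sum>\<sigma>\<in>words m n. weight \<sigma> * measure \<mu> ((\<lambda>x. left \<sigma> + \<rho> ^ n * x) -` A))"
proof (induction n)
  case (Suc n)
  have "weight \<sigma> * measure \<mu> ((\<lambda>x. left \<sigma> + \<rho> ^ n * x) -` A) =
      (\<Sum>l\<le>m. weight (\<sigma> @ [l]) * measure \<mu> ((\<lambda>x. left (\<sigma> @ [l]) + \<rho> ^ Suc n * x) -` A))"
    if \<sigma>: "\<sigma> \<in> words m n" for \<sigma>
  proof -
    have "(\<lambda>x. d l + \<rho> * x) -` (\<lambda>x. left \<sigma> + \<rho> ^ n * x) -` A = (\<lambda>x. left (\<sigma> @ [l]) + \<rho> ^ Suc n * x) -` A" for l
    proof -
      have "left \<sigma> + \<rho> ^ n * (d l + \<rho> * x) = left (\<sigma> @ [l]) + \<rho> ^ Suc n * x" for x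
        using left_snoc[OF \<sigma>, of l] by (simp add: algebra_simps)
      then show ?thesis by (simp add: vimage_def)
    qed
    moreover have "weight (\<sigma> @ [l]) = weight \<sigma> * p l" for l by (simp add: weight_append weight_def)
    ultimately show ?thesis
      using measure_step[OF affine_vimage_borel[OF assms], of "left \<sigma>" "\<rho> ^ n"]
      by (simp add: sum_distrib_left mult.assoc)
  qed
  then have "measure \<mu> A = (\<Sum>\<sigma>\<in>words m n. \<Sum>l\<le>m. weight (\<sigma> @ [l]) * measure \<mu> ((\<lambda>x. left (\<sigma> @ [l]) + \<rho> ^ Suc n * x) -` A))"
    using Suc by simp
  then show ?case
    using sum_words_add[of "\<lambda>\<omega>. weight \<omega> * measure \<mu> ((\<lambda>x. left \<omega> + \<rho> ^ Suc n * x) -` A)" m n 1]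
    by (simp add: sum_words_1[unfolded One_nat_def])
qed (simp add: weight_def)

text \<open>Each map \<open>x \<mapsto> \<rho> * x + d j\<close> sends the \<open>R\<close>-neighbourhood of \<open>K\<close> into its \<open>\<rho> * R\<close>-neighbourhood,
  so by self-similarity the mass of the \<open>R\<close>-neighbourhood is the same for all \<open>R > 0\<close>.\<close>

lemma measure_K: "measure \<mu> K = 1"
proof -
  define B where "B R = {x. infdist x K \<le> R}" for R
  have "closed (B R)" for R unfolding B_def
    by (intro closed_Collect_le continuous_intros)
  then have B_borel [simp]: "B R \<in> sets borel" for R by (rule borel_closed)
  have B_mono: "R \<le> R' \<Longrightarrow> B R \<subseteq> B R'" for R R'
    unfolding B_def by (auto intro: order_trans)
  have closed_K: "closed K" using compact_K by (rule compact_imp_closed)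
  have step: "measure \<mu> (B R) \<le> measure \<mu> (B (\<rho> * R))" for R
  proof -
    have "measure \<mu> (B R) \<le> measure \<mu> ((\<lambda>x. d l + \<rho> * x) -` B (\<rho> * R))" if l: "l \<le> m" for l
    proof (rule finite_measure_mono)
      show "B R \<subseteq> (\<lambda>x. d l + \<rho> * x) -` B (\<rho> * R)"
      proof
        fix x assume x: "x \<in> B R"
        obtain y where y: "y \<in> K" "infdist x K = dist x y"
          using infdist_attains_inf[OF closed_K K_nonempty] by blast
        have "infdist (d l + \<rho> * x) K \<le> dist (d l + \<rho> * x) (\<rho> * y + d l)"
          by (intro infdist_le ifs_map_in_K l y)
        also have "\<dots> = \<rho> * dist x y"
          using rho_pos by (simp add: dist_real_def abs_mult flip: right_diff_distrib)
        also have "\<dots> \<le> \<rho> * R" using x y rho_pos by (simp add: B_def)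
        finally show "x \<in> (\<lambda>x. d l + \<rho> * x) -` B (\<rho> * R)" by (simp add: B_def)
      qed
    qed (simp add: affine_vimage_borel)
    then have "(\<Sum>l\<le>m. p l * measure \<mu> (B R)) \<le> (\<Sum>l\<le>m. p l * measure \<mu> ((\<lambda>x. d l + \<rho> * x) -` B (\<rho> * R)))"
      by (intro sum_mono mult_left_mono less_imp_le[OF p_pos]) auto
    then show ?thesis
      using measure_step[of "B (\<rho> * R)"] p_sum by (simp flip: sum_distrib_right)
  qed
  have "measure \<mu> (B R) \<le> measure \<mu> K" if R: "0 \<le> R" for R
  proof -
    have le: "measure \<mu> (B R) \<le> measure \<mu> (B (\<rho> ^ n * R))" for n
    proof (induction n)
      case (Suc n) then show ?case using step[of "\<rho> ^ n * R"] by (simp add: mult.assoc)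
    qed simp
    have "(\<Inter>n. B (\<rho> ^ n * R)) = K"
    proof
      show "K \<subseteq> (\<Inter>n. B (\<rho> ^ n * R))" using R rho_pos by (auto simp: B_def)
      show "(\<Inter>n. B (\<rho> ^ n * R)) \<subseteq> K"
      proof
        fix x assume x: "x \<in> (\<Inter>n. B (\<rho> ^ n * R))"
        have "(\<lambda>n. \<rho> ^ n * R) \<longlonglongrightarrow> 0 * R"
          using rho_pos rho_less_1 by (intro tendsto_mult LIMSEQ_realpow_zero tendsto_const) auto
        then have "infdist x K \<le> 0 * R"
          by (rule LIMSEQ_le_const) (use x in \<open>auto simp: B_def\<close>)
        then show "x \<in> K" using in_closed_iff_infdist_zero[OF closed_K K_nonempty] infdist_nonneg[of x K] by simp
      qed
    qed
    moreover have "decseq (\<lambda>n. B (\<rho> ^ n * R))"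
    proof (rule decseq_SucI)
      fix n
      have "\<rho> ^ Suc n * R \<le> \<rho> ^ n * R"
        using R rho_pos rho_less_1 by (intro mult_right_mono power_decreasing) auto
      then show "B (\<rho> ^ Suc n * R) \<subseteq> B (\<rho> ^ n * R)" by (rule B_mono)
    qed
    ultimately have "(\<lambda>n. measure \<mu> (B (\<rho> ^ n * R))) \<longlonglongrightarrow> measure \<mu> K"
      using finite_Lim_measure_decseq[of "\<lambda>n. B (\<rho> ^ n * R)"] by (simp add: image_subset_iff)
    then show ?thesis by (rule LIMSEQ_le_const) (use le in blast)
  qed
  note le_K = this
  \<comment> \<open>The neighbourhoods exhaust the line, so the bound by the mass of
    \<open>K\<close> passes to the total mass 1.\<close>
  have "incseq (\<lambda>n. B (real n))" by (auto simp: incseq_def intro!: B_mono)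
  moreover have "(\<Union>n. B (real n)) = UNIV" using real_arch_simple by (auto simp: B_def)
  ultimately have "(\<lambda>n. measure \<mu> (B (real n))) \<longlonglongrightarrow> measure \<mu> UNIV"
    using finite_Lim_measure_incseq[of "\<lambda>n. B (real n)"] by (simp add: image_subset_iff)
  then have "measure \<mu> UNIV \<le> measure \<mu> K"
    by (rule LIMSEQ_le_const2) (use le_K in auto)
  then show ?thesis using prob_space by (intro antisym) simp_all
qed

lemma measure_disjoint_K:
  assumes "A \<in> sets borel" "A \<inter> K = {}" shows "measure \<mu> A = 0"
proof -
  have K: "K \<in> sets borel" using compact_K by (simp add: borel_compact)
  have "measure \<mu> (A \<union> K) = measure \<mu> A + measure \<mu> K"
    using assms K by (intro finite_measure_Union) auto
  then show ?thesis using measure_K prob_le_1[of "A \<union> K"] measure_nonneg[of \<mu> A] by linarith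
qed

text \<open>As \<mu> lives on \<open>K\<close>, only words whose cell meets the ball contribute. The
  window extends 2 \<rho>^n to the left: once for the radius, once for the length of a cell.\<close>

lemma measure_cball_le:
  assumes c: "\<And>v. mass n v \<le> c" and M: "card (lefts n \<inter> {x - 2 * \<rho> ^ n..x + \<rho> ^ n}) \<le> M"
  shows "measure \<mu> (cball x (\<rho> ^ n)) \<le> real M * c"
proof -
  let ?A = "cball x (\<rho> ^ n)" and ?I = "{x - 2 * \<rho> ^ n..x + \<rho> ^ n}"
  have c0: "0 \<le> c" using c[of 0] mass_nonneg[of n 0] by linarith
  have zero: "measure \<mu> ((\<lambda>y. left \<sigma> + \<rho> ^ n * y) -` ?A) = 0" if \<sigma>: "left \<sigma> \<notin> ?I" for \<sigma>
  proof (rule measure_disjoint_K)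
    show "(\<lambda>y. left \<sigma> + \<rho> ^ n * y) -` ?A \<inter> K = {}"
    proof (rule equals0I)
      fix y assume y: "y \<in> (\<lambda>y. left \<sigma> + \<rho> ^ n * y) -` ?A \<inter> K"
      then have "0 \<le> \<rho> ^ n * y" "\<rho> ^ n * y \<le> \<rho> ^ n" using K_subset rho_pos by (auto simp: mult_left_le)
      moreover have "\<bar>x - (left \<sigma> + \<rho> ^ n * y)\<bar> \<le> \<rho> ^ n" using y by (simp add: dist_real_def)
      ultimately have "left \<sigma> \<in> ?I" unfolding atLeastAtMost_iff abs_le_iff by linarith
      then show False using \<sigma> by contradiction
    qed
  qed (simp add: affine_vimage_borel)
  have "measure \<mu> ?A = (\<Sum>\<sigma>\<in>words m n. weight \<sigma> * measure \<mu> ((\<lambda>y. left \<sigma> + \<rho> ^ n * y) -` ?A))"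
    by (rule measure_words) simp
  also have "\<dots> \<le> (\<Sum>\<sigma>\<in>words m n. if left \<sigma> \<in> ?I then weight \<sigma> else 0)"
  proof (rule sum_mono)
    fix \<sigma> assume "\<sigma> \<in> words m n"
    then show "weight \<sigma> * measure \<mu> ((\<lambda>y. left \<sigma> + \<rho> ^ n * y) -` ?A) \<le> (if left \<sigma> \<in> ?I then weight \<sigma> else 0)"
      using zero[of \<sigma>] weight_pos[of \<sigma> n] prob_le_1 by (simp add: mult_left_le del: atLeastAtMost_iff)
  qed
  also have "\<dots> = (\<Sum>\<sigma>\<in>{\<sigma> \<in> words m n. left \<sigma> \<in> ?I}. weight \<sigma>)"
    by (rule sum.inter_filter[symmetric]) simp
  also have "\<dots> = (\<Sum>v\<in>lefts n \<inter> ?I. mass n v)"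
  proof -
    have "(\<Sum>\<sigma>\<in>{\<sigma> \<in> words m n. left \<sigma> \<in> ?I}. weight \<sigma>) =
        (\<Sum>v\<in>left ` {\<sigma> \<in> words m n. left \<sigma> \<in> ?I}. \<Sum>\<sigma>\<in>{\<sigma>' \<in> {\<sigma> \<in> words m n. left \<sigma> \<in> ?I}. left \<sigma>' = v}. weight \<sigma>)"
      by (rule sum.image_gen) simp
    also have "left ` {\<sigma> \<in> words m n. left \<sigma> \<in> ?I} = lefts n \<inter> ?I"
      unfolding lefts_def by blast
    also have "(\<Sum>v\<in>lefts n \<inter> ?I. \<Sum>\<sigma>\<in>{\<sigma>' \<in> {\<sigma> \<in> words m n. left \<sigma> \<in> ?I}. left \<sigma>' = v}. weight \<sigma>) =
        (\<Sum>v\<in>lefts n \<inter> ?I. mass n v)"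
    proof (rule sum.cong[OF refl])
      fix v assume v: "v \<in> lefts n \<inter> ?I"
      have "{\<sigma>' \<in> {\<sigma> \<in> words m n. left \<sigma> \<in> ?I}. left \<sigma>' = v} = {\<sigma> \<in> words m n. left \<sigma> = v}"
        using v by blast
      then show "(\<Sum>\<sigma>\<in>{\<sigma>' \<in> {\<sigma> \<in> words m n. left \<sigma> \<in> ?I}. left \<sigma>' = v}. weight \<sigma>) = mass n v"
        unfolding mass_def by (simp only: sum.inter_filter[OF finite_words])
    qed
    finally show ?thesis .
  qed
  also have "\<dots> \<le> real (card (lefts n \<inter> ?I)) * c"
    by (rule sum_bounded_above) (rule c)
  also have "\<dots> \<le> real M * c" using M c0 by (intro mult_right_mono) auto
  finally show ?thesis .
qed

end

section \<open>From essential paths to a uniform bound on masses\<close>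

locale weighted_finite_type_ifs = finite_type_ifs m \<rho> d K F + weighted_ifs m \<rho> d K p
  for m \<rho> d K F p
begin

text \<open>Prefixing with a fixed word whose cell lies in an essential net interval transports the
  bound for essential paths to all words.\<close>

lemma mass_le_powr:
  assumes s: "0 \<le> s" and C: "0 < C" and bdd: "bdd_above {real n * \<epsilon> n | n. 1 \<le> n}"
    and H: "\<And>n \<gamma>. 1 \<le> n \<Longrightarrow> admissible_path m \<rho> d K \<gamma> \<Longrightarrow> length \<gamma> = n + 1 \<Longrightarrow>
           set \<gamma> \<subseteq> essential_class m \<rho> d K \<Longrightarrow>
           mat_norm (path_matrix m \<rho> d K p \<gamma>) \<le> C * \<rho> powr (s * real n * (1 - \<epsilon> n))"
  shows "\<exists>Q>0. \<forall>k v. mass k v \<le> Q * \<rho> powr (real k * s)"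
proof -
  obtain B where B: "\<And>n. 1 \<le> n \<Longrightarrow> real n * \<epsilon> n \<le> B" using bdd unfolding bdd_above_def by blast
  obtain n P where P: "P \<in> net n" "char_vec n P \<in> essential_class m \<rho> d K"
    and closed: "\<And>\<alpha> \<beta>. \<alpha> \<in> essential_class m \<rho> d K \<Longrightarrow> child \<alpha> \<beta> \<Longrightarrow> \<beta> \<in> essential_class m \<rho> d K"
    by (rule essential_class_nonempty_closed) blast
  obtain N \<sigma> where N: "n \<le> N" and \<sigma>: "\<sigma> \<in> words m N" "fst P \<le> left \<sigma>" "left \<sigma> + \<rho> ^ N \<le> snd P"
    by (rule cell_in_net[OF P(1)])
  have w: "0 < weight \<sigma>" using \<sigma>(1) by (rule weight_pos)
  \<comment> \<open>The 1 serves level 0; the other constant collects the price of the prefix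
    \<sigma> and of the bound \<open>B\<close> on n eps_n.\<close>
  define Q where "Q = max 1 (C * \<rho> powr (- s * B) / weight \<sigma>)"
  have "mass k v \<le> Q * \<rho> powr (real k * s)" for k v
  proof (cases "k = 0 \<or> v \<notin> lefts k")
    case True
    then show ?thesis using mass_le_1[of 0 v] mass_eq_0[of v k] rho_pos by (auto simp: Q_def)
  next
    case False
    then obtain \<tau> where \<tau>: "\<tau> \<in> words m k" "v = left \<tau>" by (auto simp: lefts_def)
    \<comment> \<open>Number of steps from the level of \<open>P\<close> to that of \<sigma>
      followed by \<tau>. It is positive since \<open>k\<close> > 0, as the norm bound requires, and
      at least \<open>k\<close>, so \<rho>^(s r) \<le> \<rho>^(s k).\<close>
    define r where "r = N + k - n"
    have r: "N + k = n + r" "1 \<le> r" "k \<le> r" using N False by (auto simp: r_def)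
    have \<omega>: "\<sigma> @ \<tau> \<in> words m (n + r)" using append_words[OF \<sigma>(1) \<tau>(1)] r(1) by simp
    have left_\<omega>: "left (\<sigma> @ \<tau>) = left \<sigma> + \<rho> ^ N * left \<tau>" by (rule left_append[OF \<sigma>(1)])
    obtain \<Delta> where \<Delta>: "\<Delta> \<in> net (n + r)" "left (\<sigma> @ \<tau>) \<le> fst \<Delta>" "snd \<Delta> \<le> left (\<sigma> @ \<tau>) + \<rho> ^ (n + r)"
      by (rule net_in_cell[OF \<omega>])
    have cov: "\<sigma> @ \<tau> \<in> covers (n + r) \<Delta>"
    proof -
      have "left (\<sigma> @ \<tau>) < snd \<Delta>" "fst \<Delta> < left (\<sigma> @ \<tau>) + \<rho> ^ (n + r)"
        using \<Delta>(2,3) net_less[OF \<Delta>(1)] by linarith+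
      then show ?thesis using cell_of_net[OF \<Delta>(1) \<omega> order_refl] \<omega> by (simp add: covers_def)
    qed
    have "sub_interval \<Delta> P"
    proof -
      have "0 \<le> \<rho> ^ N * left \<tau>" using left_nonneg[OF \<tau>(1)] rho_pos by simp
      moreover have "\<rho> ^ N * (left \<tau> + \<rho> ^ k) \<le> \<rho> ^ N * 1"
        using right_le_1[OF \<tau>(1)] rho_pos by (intro mult_left_mono) auto
      then have "\<rho> ^ N * left \<tau> + \<rho> ^ (n + r) \<le> \<rho> ^ N" unfolding r(1)[symmetric] by (simp add: algebra_simps power_add)
      ultimately have "fst P \<le> fst \<Delta>" "snd \<Delta> \<le> snd P" using \<Delta>(2,3) \<sigma>(2,3) left_\<omega> by linarith+
      then show ?thesis using net_less[OF \<Delta>(1)] by (simp add: sub_interval_iff)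
    qed
    from mass_le_path_norm[OF P(1) \<Delta>(1) this cov] obtain \<gamma> where \<gamma>: "admissible_path m \<rho> d K \<gamma>"
      "length \<gamma> = r + 1" "hd \<gamma> = char_vec n P"
      "mass (n + r) (left (\<sigma> @ \<tau>)) \<le> mat_norm (path_matrix m \<rho> d K p \<gamma>)" by blast
    have "set \<gamma> \<subseteq> essential_class m \<rho> d K"
    proof -
      have "\<eta> \<noteq> [] \<Longrightarrow> hd \<eta> \<in> essential_class m \<rho> d K \<Longrightarrow> successively child \<eta> \<Longrightarrow> set \<eta> \<subseteq> essential_class m \<rho> d K" for \<eta>
      proof (induction \<eta>)
        case (Cons \<alpha> \<eta>)
        then show ?case using closed by (cases \<eta>) auto
      qed simp
      then show ?thesis using \<gamma>(1,3) P(2) by (simp add: admissible_path_def)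
    qed
    have "weight \<sigma> * mass k v \<le> mass (n + r) (left (\<sigma> @ \<tau>))"
      using weight_mult_mass_le[OF \<sigma>(1), of k v] left_\<omega> r(1) \<tau>(2) by simp
    also have "\<dots> \<le> mat_norm (path_matrix m \<rho> d K p \<gamma>)" by (rule \<gamma>)
    also have "\<dots> \<le> C * \<rho> powr (s * real r * (1 - \<epsilon> r))"
      by (rule H) (use r(2) \<gamma>(1,2) \<open>set \<gamma> \<subseteq> _\<close> in auto)
    also have "\<dots> \<le> C * \<rho> powr (real k * s - s * B)"
    proof -
      have "s * (real r * \<epsilon> r) \<le> s * B" using B[OF r(2)] s by (rule mult_left_mono)
      moreover have "s * real k \<le> s * real r" using r(3) s by (intro mult_left_mono) auto
      ultimately have "real k * s - s * B \<le> s * real r * (1 - \<epsilon> r)" by (simp add: algebra_simps)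
      then have "\<rho> powr (s * real r * (1 - \<epsilon> r)) \<le> \<rho> powr (real k * s - s * B)"
        using rho_pos rho_less_1 by (intro powr_mono') auto
      then show ?thesis using C by simp
    qed
    also have "\<dots> = C * \<rho> powr (- s * B) * \<rho> powr (real k * s)"
      by (simp flip: powr_add)
    finally have "mass k v \<le> C * \<rho> powr (- s * B) / weight \<sigma> * \<rho> powr (real k * s)"
      using w by (simp add: field_simps)
    also have "\<dots> \<le> Q * \<rho> powr (real k * s)" unfolding Q_def by (intro mult_right_mono) auto
    finally show ?thesis .
  qed
  moreover have "0 < Q" by (simp add: Q_def)
  ultimately show ?thesis by blast
qed

end

section \<open>Comparison with Hausdorff measure\<close>

locale self_similar_finite_type_ifs =
  weighted_finite_type_ifs m \<rho> d K F p + self_similar_measure_ifs m \<rho> d K p \<mu>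
  for m \<rho> d K F p \<mu>
begin

text \<open>The mass distribution principle: each covering set lies in a ball whose radius is a
  power of \<rho> comparable with its diameter, and \<mu> of that ball is at most a constant times
  the radius to the power \<open>sim_dim\<close>.\<close>

lemma null_if_hausdorff_null:
  assumes Q: "0 < Q" "\<And>k v. mass k v \<le> Q * \<rho> powr (real k * sim_dim)"
    and A: "A \<in> sets borel" "hausdorff_outer sim_dim A = 0"
  shows "emeasure \<mu> A = 0"
proof -
  \<comment> \<open>The window of \<open>measure_cball_le\<close> has length 3 \<rho>^k and so
    contains at most (3 + 1) \<open>mult_bound\<close> left endpoints.\<close>
  define c where "c = 4 * real mult_bound * Q"
  have c: "0 < c" using Q(1) mult_bound_pos by (simp add: c_def)
  have "emeasure \<mu> A \<le> 0"
  proof (rule ennreal_le_epsilon)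
    fix e0 :: real assume e0: "0 < e0"
    \<comment> \<open>The gauges and the added errors are each worth at most \<open>e\<close>; this
      choice makes their weighted total \<open>e0\<close>.\<close>
    define e where "e = e0 / (c * (\<rho> powr (- sim_dim) + 1))"
    have pos: "0 < c * (\<rho> powr (- sim_dim) + 1)" using c rho_pos by (simp add: add_pos_pos)
    then have e: "0 < e" using e0 by (simp add: e_def)
    have "hausdorff_delta sim_dim 1 A \<le> hausdorff_outer sim_dim A" by (rule hausdorff_delta_le_outer) simp
    then have "hausdorff_delta sim_dim 1 A < ennreal e" using A(2) e by simp
    then obtain U where U: "A \<subseteq> (\<Union>i. U i)" "\<And>i. bounded (U i)" "\<And>i. diameter (U i) \<le> 1"
      "(\<Sum>i. hausdorff_gauge sim_dim (U i)) < ennreal e" by (rule hausdorff_delta_less) blast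
    have "\<exists>V\<in>sets borel. U i \<subseteq> V \<and> emeasure \<mu> V \<le>
        ennreal c * (ennreal (\<rho> powr (- sim_dim)) * hausdorff_gauge sim_dim (U i) + ennreal (e * (1/2) ^ Suc i))" for i
    proof (cases "U i = {}")
      case False
      then obtain x where x: "x \<in> U i" by blast
      have "0 < e * (1/2) ^ Suc i" using e by simp
      from scale_obtain[OF diameter_ge_0[OF U(2)] U(3) sim_dim_pos this]
      obtain k where k: "diameter (U i) \<le> \<rho> ^ k"
        "\<rho> powr (real k * sim_dim) \<le> \<rho> powr (- sim_dim) * diameter (U i) powr sim_dim + e * (1/2) ^ Suc i" by metis
      have "U i \<subseteq> cball x (\<rho> ^ k)"
        using diameter_bounded_bound[OF U(2) x] k(1) by fastforce
      moreover have "emeasure \<mu> (cball x (\<rho> ^ k)) \<le>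
          ennreal c * (ennreal (\<rho> powr (- sim_dim)) * hausdorff_gauge sim_dim (U i) + ennreal (e * (1/2) ^ Suc i))"
      proof -
        have "card (lefts k \<inter> {x - 2 * \<rho> ^ k..x + \<rho> ^ k}) \<le> 4 * mult_bound"
          using card_lefts_interval_multiple[of k "x - 2 * \<rho> ^ k" 3] by (simp add: add.commute)
        then have "measure \<mu> (cball x (\<rho> ^ k)) \<le> real (4 * mult_bound) * (Q * \<rho> powr (real k * sim_dim))"
          by (intro measure_cball_le Q(2))
        also have "\<dots> = c * \<rho> powr (real k * sim_dim)" by (simp add: c_def)
        also have "\<dots> \<le> c * (\<rho> powr (- sim_dim) * diameter (U i) powr sim_dim + e * (1/2) ^ Suc i)"
          using c k(2) by (intro mult_left_mono) auto
        finally have "emeasure \<mu> (cball x (\<rho> ^ k)) \<le>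
            ennreal (c * (\<rho> powr (- sim_dim) * diameter (U i) powr sim_dim + e * (1/2) ^ Suc i))"
          unfolding emeasure_eq_measure by (rule ennreal_leI)
        also have "\<dots> = ennreal c * (ennreal (\<rho> powr (- sim_dim)) * hausdorff_gauge sim_dim (U i) + ennreal (e * (1/2) ^ Suc i))"
          using c e False sim_dim_pos
          by (simp add: hausdorff_gauge_def ennreal_mult ennreal_plus del: power_Suc)
        finally show ?thesis .
      qed
      ultimately show ?thesis by (intro bexI[of _ "cball x (\<rho> ^ k)"]) auto
    qed (intro bexI[of _ "{}"]; simp)
    then obtain V where V: "\<And>i. V i \<in> sets borel" "\<And>i. U i \<subseteq> V i" "\<And>i. emeasure \<mu> (V i) \<le>
        ennreal c * (ennreal (\<rho> powr (- sim_dim)) * hausdorff_gauge sim_dim (U i) + ennreal (e * (1/2) ^ Suc i))"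
      by metis
    have "A \<subseteq> (\<Union>i. V i)" using U(1) V(2) by blast
    then have "emeasure \<mu> A \<le> emeasure \<mu> (\<Union>i. V i)"
      using V(1) by (intro emeasure_mono) auto
    also have "\<dots> \<le> (\<Sum>i. emeasure \<mu> (V i))" using V(1) by (intro emeasure_subadditive_countably) auto
    also have "\<dots> \<le> (\<Sum>i. ennreal c * (ennreal (\<rho> powr (- sim_dim)) * hausdorff_gauge sim_dim (U i) + ennreal (e * (1/2) ^ Suc i)))"
      using V(3) by (intro suminf_le) auto
    also have "\<dots> = ennreal c * (ennreal (\<rho> powr (- sim_dim)) * (\<Sum>i. hausdorff_gauge sim_dim (U i)) + (\<Sum>i. ennreal (e * (1/2) ^ Suc i)))"
      by (simp add: suminf_add[symmetric] del: power_Suc)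
    also have "(\<Sum>i. ennreal (e * (1/2) ^ Suc i)) = ennreal e"
      using e sums_mult[OF power_half_series, of e] by (intro suminf_ennreal_eq) auto
    also have "ennreal c * (ennreal (\<rho> powr (- sim_dim)) * (\<Sum>i. hausdorff_gauge sim_dim (U i)) + ennreal e)
        \<le> ennreal c * (ennreal (\<rho> powr (- sim_dim)) * ennreal e + ennreal e)"
      using U(4) by (intro mult_left_mono add_right_mono) auto
    also have "\<dots> = ennreal (c * (\<rho> powr (- sim_dim) * e + e))"
      using c e by (simp add: ennreal_mult ennreal_plus)
    also have "c * (\<rho> powr (- sim_dim) * e + e) = c * (\<rho> powr (- sim_dim) + 1) * e" by (simp add: algebra_simps)
    also have "\<dots> = e0"
      unfolding e_def times_divide_eq_right
      by (rule nonzero_mult_div_cancel_left) (rule less_imp_neq[OF pos, THEN not_sym])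
    finally show "emeasure \<mu> A \<le> 0 + ennreal e0" by simp
  qed
  then show ?thesis by simp
qed

text \<open>The scaling factor is non-zero because \<open>K\<close> has finite measure, so null sets
  of the normalized measure meet \<open>K\<close> in Hausdorff null sets; the part outside
  \<open>K\<close> is \<mu>-null since \<mu> is carried by \<open>K\<close>.\<close>

lemma absolutely_continuous_normalized_hausdorff:
  assumes Q: "0 < Q" "\<And>k v. mass k v \<le> Q * \<rho> powr (real k * sim_dim)"
  shows "absolutely_continuous (normalized_hausdorff sim_dim K) \<mu>"
  unfolding absolutely_continuous_def
proof
  have K: "K \<in> sets borel" using compact_K by (simp add: borel_compact)
  fix A assume "A \<in> null_sets (normalized_hausdorff sim_dim K)"
  then have A: "A \<in> sets borel" and 0: "emeasure (normalized_hausdorff sim_dim K) A = 0"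
    by (auto simp: null_sets_def normalized_hausdorff_def sets_hausdorff_measure)
  have "inverse (hausdorff_outer sim_dim K) \<noteq> 0"
    using hausdorff_outer_K_le by (auto simp: ennreal_inverse_eq_0_iff top_unique)
  then have "hausdorff_outer sim_dim (K \<inter> A) = 0"
    using 0 unfolding emeasure_normalized_hausdorff[OF K A] by simp
  then have "emeasure \<mu> (K \<inter> A) = 0"
    using K A by (intro null_if_hausdorff_null[OF Q]) auto
  moreover have "emeasure \<mu> (A - K) = 0"
    using measure_disjoint_K[OF sets.Diff[OF A K] Diff_disjoint[of K A, unfolded Int_commute[of K]]]
    by (simp add: emeasure_eq_measure)
  moreover have "emeasure \<mu> A \<le> emeasure \<mu> (K \<inter> A) + emeasure \<mu> (A - K)"
    using emeasure_subadditive[of "K \<inter> A" \<mu> "A - K"] K A by (simp add: Int_commute Int_Diff_Un)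
  ultimately show "A \<in> null_sets \<mu>" using A by (auto simp: null_sets_def)
qed

end

theorem proposition3p19:
  fixes m :: nat and \<rho> :: real and d p :: "nat \<Rightarrow> real"
    and K :: "real set" and \<mu> :: "real measure"
    and s C :: real and \<epsilon> :: "nat \<Rightarrow> real"
  assumes "1 \<le> m" and "0 < \<rho>" and "\<rho> < 1"
    and "d 0 = 0" and "strict_mono_on {..m} d"
    and "is_attractor m \<rho> d K" and "convex hull K = {0..1}"
    and "finite_type m \<rho> d"
    and "\<And>j. j \<le> m \<Longrightarrow> 0 < p j" and "(\<Sum>j\<le>m. p j) = 1"
    and "is_self_similar_measure m \<rho> d p \<mu>"
    and "s = hausdorff_dim K"
    and "0 < C" and "bdd_above {real n * \<epsilon> n | n. 1 \<le> n}"
    and "\<And>n \<gamma>. 1 \<le> n \<Longrightarrow> admissible_path m \<rho> d K \<gamma> \<Longrightarrow> length \<gamma> = n + 1 \<Longrightarrow>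
           set \<gamma> \<subseteq> essential_class m \<rho> d K \<Longrightarrow>
           mat_norm (path_matrix m \<rho> d K p \<gamma>) \<le> C * \<rho> powr (s * real n * (1 - \<epsilon> n))"
  shows "absolutely_continuous (normalized_hausdorff s K) \<mu>"
proof -
  obtain F where F: "finite F" "\<And>n \<sigma> \<sigma>'. n \<ge> 1 \<Longrightarrow> \<sigma> \<in> words m n \<Longrightarrow> \<sigma>' \<in> words m n \<Longrightarrow>
      \<bar>ifs_word \<rho> d \<sigma> 0 - ifs_word \<rho> d \<sigma>' 0\<bar> / \<rho> ^ n > 1 \<or>
      (ifs_word \<rho> d \<sigma> 0 - ifs_word \<rho> d \<sigma>' 0) / \<rho> ^ n \<in> F"
    using assms(8) unfolding finite_type_def by blast
  interpret self_similar_finite_type_ifs m \<rho> d K F p \<mu>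
    by unfold_locales (fact assms F)+
  \<comment> \<open>The lower bound for the Hausdorff measure of \<open>K\<close> enters here,
    turning the dimension into the explicit exponent.\<close>
  have s: "s = sim_dim" using assms(12) hausdorff_dim_K by simp
  obtain Q where "0 < Q" "\<And>k v. mass k v \<le> Q * \<rho> powr (real k * s)"
    using mass_le_powr[OF _ assms(13,14,15)] sim_dim_pos s by auto
  then show ?thesis unfolding s by (rule absolutely_continuous_normalized_hausdorff)
qed

end
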